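(* Let $G=(V,E)$ be an undirected graph with $n$ vertices, $m$ edges and nonnegative edge weights $w$, let $S\subseteq V$ and $T=V\setminus S$. There is an $O(m+n\log n)$ time algorithm that outputs an estimate $R'$ such that $R_{ST}\leq R'\leq 2R_{ST}+\min_{s\in S,\,t\in T,\,(s,t)\in E} w(s,t)$. If $G$ is unweighted, the algorithm runs in $O(m+n)$ time and $R_{ST}\leq R'\leq 2R_{ST}+1$.
   Context: $d(u,v)$ denotes the shortest path distance in $G$. For $v\in S$, $\varepsilon_{ST}(v)=\max_{u\in T}d(v,u)$, and the $ST$-Radius is $R_{ST}=\min_{v\in S}\varepsilon_{ST}(v)$. *)

theory Defs
  imports "Graph_Theory.Pair_Digraph" "Graph_Theory.Shortest_Path"
begin

section \<open>Eccentricities and the radius between two vertex sets\<close>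

text \<open>
  An undirected graph is a symmetric loop-free finite pair digraph (locale \<^locale>\<open>pair_graph\<close>): an
  edge between \<open>u\<close> and \<open>v\<close> is the pair of arcs \<open>(u, v)\<close>, \<open>(v, u)\<close>, and counts once in \<open>num_edges\<close>.
\<close>

definition num_edges :: "'a pair_pre_digraph \<Rightarrow> nat" where
  "num_edges G = card ((\<lambda>(u, v). {u, v}) ` parcs G)"

text \<open>The distance is \<open>\<infinity>\<close> between vertices in different connected components.\<close>

abbreviation dist_in :: "'a pair_pre_digraph \<Rightarrow> ('a \<times> 'a \<Rightarrow> real) \<Rightarrow> 'a \<Rightarrow> 'a \<Rightarrow> ereal" where
  "dist_in G w \<equiv> wf_digraph.\<mu> (with_proj G) w"

definition ST_ecc :: "'a pair_pre_digraph \<Rightarrow> ('a \<times> 'a \<Rightarrow> real) \<Rightarrow> 'a set \<Rightarrow> 'a \<Rightarrow> ereal" where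
  "ST_ecc G w T v = Max ((\<lambda>u. dist_in G w v u) ` T)"

definition ST_radius ::
    "'a pair_pre_digraph \<Rightarrow> ('a \<times> 'a \<Rightarrow> real) \<Rightarrow> 'a set \<Rightarrow> 'a set \<Rightarrow> ereal" where
  "ST_radius G w S T = Min (ST_ecc G w T ` S)"


section \<open>The machine model\<close>

text \<open>
  A random access machine with two disjoint sorts of memory, programmed in a structured language.
  Each sort has named scalar registers and named arrays with indirect addressing.

  \<^item> Natural numbers serve as indices and counters. The only arithmetic on them is successor and
    truncated predecessor, so that in \<open>k\<close> steps of a fixed program the largest number present grows
    by at most \<open>O(k)\<close>. Hence charging unit cost hides no large-word arithmetic.
  \<^item> Weights and distances can only be added and compared (the comparison-addition model), with the
    constants 0, 1 and \<open>\<infinity>\<close>. There is no conversion between the two sorts.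

  Every operation, array access, comparison, assignment and jump is charged one unit.
\<close>

datatype nexp = NConst nat | NVar string | NGet string nexp | Inc nexp | Dec nexp

datatype rexp = Zero | One | Infty | RVar string | RGet string nexp | Add rexp rexp

datatype bexp = NLess nexp nexp | RLess rexp rexp | Neg bexp | Conj bexp bexp

datatype com =
    Skip
  | NAssign string nexp
  | NPut string nexp nexp  \<comment> \<open>array, index, value\<close>
  | RAssign string rexp
  | RPut string nexp rexp
  | Seq com com
  | Cond bexp com com
  | While bexp com

record state =
  nvar :: "string \<Rightarrow> nat"
  narr :: "string \<Rightarrow> nat \<Rightarrow> nat"
  rvar :: "string \<Rightarrow> ereal"
  rarr :: "string \<Rightarrow> nat \<Rightarrow> ereal"

primrec nval :: "nexp \<Rightarrow> state \<Rightarrow> nat" where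
  "nval (NConst k) \<sigma> = k"
| "nval (NVar x) \<sigma> = nvar \<sigma> x"
| "nval (NGet a i) \<sigma> = narr \<sigma> a (nval i \<sigma>)"
| "nval (Inc e) \<sigma> = nval e \<sigma> + 1"
| "nval (Dec e) \<sigma> = nval e \<sigma> - 1"

primrec rval :: "rexp \<Rightarrow> state \<Rightarrow> ereal" where
  "rval Zero \<sigma> = 0"
| "rval One \<sigma> = 1"
| "rval Infty \<sigma> = \<infinity>"
| "rval (RVar x) \<sigma> = rvar \<sigma> x"
| "rval (RGet a i) \<sigma> = rarr \<sigma> a (nval i \<sigma>)"
| "rval (Add e f) \<sigma> = rval e \<sigma> + rval f \<sigma>"

primrec bval :: "bexp \<Rightarrow> state \<Rightarrow> bool" where
  "bval (NLess e f) \<sigma> = (nval e \<sigma> < nval f \<sigma>)"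
| "bval (RLess e f) \<sigma> = (rval e \<sigma> < rval f \<sigma>)"
| "bval (Neg b) \<sigma> = (\<not> bval b \<sigma>)"
| "bval (Conj b c) \<sigma> = (bval b \<sigma> \<and> bval c \<sigma>)"

primrec ncost :: "nexp \<Rightarrow> nat" where
  "ncost (NConst k) = 1"
| "ncost (NVar x) = 1"
| "ncost (NGet a i) = ncost i + 1"
| "ncost (Inc e) = ncost e + 1"
| "ncost (Dec e) = ncost e + 1"

primrec rcost :: "rexp \<Rightarrow> nat" where
  "rcost Zero = 1"
| "rcost One = 1"
| "rcost Infty = 1"
| "rcost (RVar x) = 1"
| "rcost (RGet a i) = ncost i + 1"
| "rcost (Add e f) = rcost e + rcost f + 1"

primrec bcost :: "bexp \<Rightarrow> nat" where
  "bcost (NLess e f) = ncost e + ncost f + 1"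
| "bcost (RLess e f) = rcost e + rcost f + 1"
| "bcost (Neg b) = bcost b + 1"
| "bcost (Conj b c) = bcost b + bcost c + 1"

text \<open>\<open>run c \<sigma> k \<sigma>'\<close>: started in \<open>\<sigma>\<close>, the command \<open>c\<close> terminates in \<open>\<sigma>'\<close> after exactly \<open>k\<close> steps.\<close>

inductive run :: "com \<Rightarrow> state \<Rightarrow> nat \<Rightarrow> state \<Rightarrow> bool" where
  Skip: "run Skip \<sigma> 1 \<sigma>"
| NAssign: "run (NAssign x e) \<sigma> (ncost e + 1) (\<sigma>\<lparr>nvar := (nvar \<sigma>)(x := nval e \<sigma>)\<rparr>)"
| NPut: "run (NPut a i e) \<sigma> (ncost i + ncost e + 1)
    (\<sigma>\<lparr>narr := (narr \<sigma>)(a := (narr \<sigma> a)(nval i \<sigma> := nval e \<sigma>))\<rparr>)"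
| RAssign: "run (RAssign x e) \<sigma> (rcost e + 1) (\<sigma>\<lparr>rvar := (rvar \<sigma>)(x := rval e \<sigma>)\<rparr>)"
| RPut: "run (RPut a i e) \<sigma> (ncost i + rcost e + 1)
    (\<sigma>\<lparr>rarr := (rarr \<sigma>)(a := (rarr \<sigma> a)(nval i \<sigma> := rval e \<sigma>))\<rparr>)"
| Seq: "run c \<sigma> k \<sigma>' \<Longrightarrow> run d \<sigma>' l \<sigma>'' \<Longrightarrow> run (Seq c d) \<sigma> (k + l) \<sigma>''"
| CondTrue: "bval b \<sigma> \<Longrightarrow> run c \<sigma> k \<sigma>' \<Longrightarrow> run (Cond b c d) \<sigma> (bcost b + k + 1) \<sigma>'"
| CondFalse: "\<not> bval b \<sigma> \<Longrightarrow> run d \<sigma> k \<sigma>' \<Longrightarrow> run (Cond b c d) \<sigma> (bcost b + k + 1) \<sigma>'"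
| WhileFalse: "\<not> bval b \<sigma> \<Longrightarrow> run (While b c) \<sigma> (bcost b + 1) \<sigma>"
| WhileTrue: "bval b \<sigma> \<Longrightarrow> run c \<sigma> k \<sigma>' \<Longrightarrow> run (While b c) \<sigma>' l \<sigma>'' \<Longrightarrow>
    run (While b c) \<sigma> (bcost b + k + l + 1) \<sigma>''"

text \<open>Programs are deterministic, so final state and running time are functions of the input.\<close>

lemma run_deterministic: "run c \<sigma> k \<sigma>' \<Longrightarrow> run c \<sigma> l \<sigma>'' \<Longrightarrow> k = l \<and> \<sigma>' = \<sigma>''"
proof (induction arbitrary: l \<sigma>'' rule: run.induct)
  case (Seq c \<sigma> k \<sigma>' d l \<sigma>'')
  from Seq.prems show ?case by (cases) (use Seq.IH in blast)
next
  case (CondTrue b \<sigma> c k \<sigma>' d)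
  from CondTrue.prems show ?case by (cases) (use CondTrue in blast)+
next
  case (CondFalse b \<sigma> d k \<sigma>' c)
  from CondFalse.prems show ?case by (cases) (use CondFalse in blast)+
next
  case (WhileFalse b \<sigma> c)
  from WhileFalse.prems show ?case by (cases) (use WhileFalse in auto)
next
  case (WhileTrue b \<sigma> c k \<sigma>' l \<sigma>'')
  from WhileTrue.prems show ?case by (cases) (use WhileTrue in blast)+
qed (auto elim: run.cases)


section \<open>Input format\<close>

text \<open>
  The vertices are \<open>0, \<dots>, n - 1\<close>, and the graph is given by adjacency lists stored consecutively:
  the neighbours of \<open>u\<close>, in arbitrary order, occupy the cells \<open>off u, \<dots>, off (u + 1) - 1\<close> of \<open>adj\<close>,
  and \<open>wt\<close> holds the weights of the corresponding edges. Membership in \<open>S\<close> is given by a bit array.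
  All other registers and array cells may have arbitrary initial contents.
\<close>

definition holds_input ::
    "state \<Rightarrow> nat pair_pre_digraph \<Rightarrow> (nat \<times> nat \<Rightarrow> real) \<Rightarrow> nat set \<Rightarrow> bool" where
  "holds_input \<sigma> G w S \<longleftrightarrow>
    (let n = nvar \<sigma> ''n''; off = narr \<sigma> ''off''; adj = narr \<sigma> ''adj''; wt = rarr \<sigma> ''wt'' in
      pverts G = {..<n} \<and>
      off 0 = 0 \<and>
      (\<forall>u<n. off u \<le> off (u + 1) \<and>
        bij_betw adj {off u..<off (u + 1)} {v. (u, v) \<in> parcs G} \<and>
        (\<forall>i\<in>{off u..<off (u + 1)}. wt i = ereal (w (u, adj i)))) \<and>
      (\<forall>u<n. narr \<sigma> ''inS'' u = (if u \<in> S then 1 else 0)))"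

definition result :: "state \<Rightarrow> ereal" where
  "result \<sigma> = rvar \<sigma> ''result''"

end

theory Submission
  imports Defs
begin

text \<open>
  Let \<open>(s, t)\<close> be a lightest edge from \<open>S\<close> to \<open>T\<close>. The estimate is the eccentricity of \<open>s\<close>: if
  \<open>c\<close> attains the radius \<open>R\<close>, every \<open>u \<in> T\<close> is reached along \<open>s, t, c, u\<close> at cost at most
  \<open>w (s, t) + R + R\<close>. Without such an edge the radius is \<open>\<infinity>\<close>. So one single-source computation
  suffices. It is breadth-first search if all weights are 1, and otherwise Dijkstra's algorithm with
  the hollow heaps of Hansen, Kaplan, Tarjan and Zwick: decreasing a key creates a new node, which
  takes all but the two children of highest rank from the old one. The old node stays behind,
  hollow, until it surfaces as a root. Every insertion and key decrease then costs amortised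
  constant time, and every extraction time proportional to the maximal rank, which is logarithmic
  because a node of rank \<open>r\<close> keeps children of ranks \<open>r - 1\<close> and \<open>r - 2\<close>.
\<close>

section \<open>Running time reasoning\<close>

text \<open>Steps are counted exactly and memory starts with arbitrary contents, which shapes the
  whole argument. A heap node is never reused, so ranks are logarithmic in the number of nodes ever
  created rather than in the number of vertices. This is harmless: a search creates at most one node
  per arc and one for the source, fewer than n^2 in total, and log (n^2) = 2 log n. The table
  indexed by ranks is not cleared in advance, since the machine has no direct way to compute its
  size; a register \<open>lim\<close> delimits the part in use and grows by one when a root of rank
  \<open>lim\<close> is stored. Amortisation uses explicit credits: 300 for a root, 400 for each
  hollow node, and 400 more for each of its children. These constants are generous roundings of
  instruction counts. Correctness of the search is proved once for an abstract queue. Labels are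
  upper bounds on distances throughout; equality follows only at the end, because labels that no arc
  can improve are also lower bounds.\<close>

definition exec :: "com \<Rightarrow> state \<Rightarrow> (nat \<Rightarrow> state \<Rightarrow> bool) \<Rightarrow> bool" where
  "exec c \<sigma> Q \<longleftrightarrow> (\<exists>k \<sigma>'. run c \<sigma> k \<sigma>' \<and> Q k \<sigma>')"

lemma exec_mono: "exec c \<sigma> Q \<Longrightarrow> (\<And>k \<sigma>'. Q k \<sigma>' \<Longrightarrow> Q' k \<sigma>') \<Longrightarrow> exec c \<sigma> Q'"
  unfolding exec_def by blast

text \<open>Determinism turns the existential in \<open>exec\<close> into a substitution. As
  simplification rules, such equivalences execute loop-free code symbolically and leave the exact
  number of steps in the goal, so that only loops need invariants.\<close>

lemma exec_iff: "run c \<sigma> k \<sigma>' \<Longrightarrow> exec c \<sigma> Q \<longleftrightarrow> Q k \<sigma>'"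
  unfolding exec_def using run_deterministic by blast

lemmas exec_simps [simp] =
  exec_iff[OF run.Skip] exec_iff[OF run.NAssign] exec_iff[OF run.NPut]
  exec_iff[OF run.RAssign] exec_iff[OF run.RPut]

inductive_cases run_SeqE: "run (Seq c d) \<sigma> k \<sigma>'"
inductive_cases run_CondE: "run (Cond b c d) \<sigma> k \<sigma>'"

lemma exec_Seq_iff [simp]:
  "exec (Seq c d) \<sigma> Q \<longleftrightarrow> exec c \<sigma> (\<lambda>k \<sigma>'. exec d \<sigma>' (\<lambda>l. Q (k + l)))"
  unfolding exec_def by (blast elim: run_SeqE intro: run.intros)

lemma exec_Cond_iff [simp]:
  "exec (Cond b c d) \<sigma> Q \<longleftrightarrow>
    (if bval b \<sigma> then exec c \<sigma> (\<lambda>k. Q (bcost b + k + 1)) else exec d \<sigma> (\<lambda>k. Q (bcost b + k + 1)))"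
  unfolding exec_def by (auto elim!: run_CondE intro: run.intros[simplified])

section \<open>Frame conditions from the locations that a program writes\<close>

datatype loc = NV string | NA string | RV string | RA string

primrec writes :: "com \<Rightarrow> loc set" where
  "writes Skip = {}"
| "writes (NAssign x e) = {NV x}"
| "writes (NPut a i e) = {NA a}"
| "writes (RAssign x e) = {RV x}"
| "writes (RPut a i e) = {RA a}"
| "writes (Seq c d) = writes c \<union> writes d"
| "writes (Cond b c d) = writes c \<union> writes d"
| "writes (While b c) = writes c"

definition agree :: "loc set \<Rightarrow> state \<Rightarrow> state \<Rightarrow> bool" where
  "agree L \<sigma> \<sigma>' \<longleftrightarrow>
    (\<forall>x. NV x \<notin> L \<longrightarrow> nvar \<sigma>' x = nvar \<sigma> x) \<and> (\<forall>x. NA x \<notin> L \<longrightarrow> narr \<sigma>' x = narr \<sigma> x) \<and>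
    (\<forall>x. RV x \<notin> L \<longrightarrow> rvar \<sigma>' x = rvar \<sigma> x) \<and> (\<forall>x. RA x \<notin> L \<longrightarrow> rarr \<sigma>' x = rarr \<sigma> x)"

lemma agreeD:
  assumes "agree L \<sigma> \<sigma>'"
  shows "NV x \<notin> L \<Longrightarrow> nvar \<sigma>' x = nvar \<sigma> x" "NA x \<notin> L \<Longrightarrow> narr \<sigma>' x = narr \<sigma> x"
    "RV x \<notin> L \<Longrightarrow> rvar \<sigma>' x = rvar \<sigma> x" "RA x \<notin> L \<Longrightarrow> rarr \<sigma>' x = rarr \<sigma> x"
  using assms by (auto simp: agree_def)

lemma agree_refl [simp]: "agree L \<sigma> \<sigma>"
  by (simp add: agree_def)

lemma agree_trans: "agree L \<sigma> \<sigma>' \<Longrightarrow> agree L \<sigma>' \<sigma>'' \<Longrightarrow> agree L \<sigma> \<sigma>''"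
  by (simp add: agree_def)

lemma agree_mono: "agree L \<sigma> \<sigma>' \<Longrightarrow> L \<subseteq> L' \<Longrightarrow> agree L' \<sigma> \<sigma>'"
  unfolding agree_def by blast

text \<open>Since \<open>writes c\<close> is computed from the program text, every claim that a
  register or array is untouched reduces to comparing names.\<close>

lemma run_agree: "run c \<sigma> k \<sigma>' \<Longrightarrow> agree (writes c) \<sigma> \<sigma>'"
proof (induction rule: run.induct)
  case (Seq c \<sigma> k \<sigma>' d l \<sigma>'')
  then show ?case by (auto intro!: agree_trans[of _ \<sigma> \<sigma>' \<sigma>''] elim: agree_mono)
next
  case (WhileTrue b \<sigma> c k \<sigma>' l \<sigma>'')
  then show ?case by (auto intro: agree_trans)
qed (auto simp: agree_def)

lemma exec_agree:
  assumes "exec c \<sigma> Q" "\<And>k \<sigma>'. Q k \<sigma>' \<Longrightarrow> agree (writes c) \<sigma> \<sigma>' \<Longrightarrow> Q' k \<sigma>'"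
  shows "exec c \<sigma> Q'"
  using assms run_agree unfolding exec_def by blast

text \<open>The ghost value \<open>\<phi>\<close> is a supply of credits from which the loop pays its steps.\<close>

lemma exec_While:
  assumes init: "I \<sigma> \<phi>"
    and step: "\<And>\<sigma>' \<phi>. I \<sigma>' \<phi> \<Longrightarrow> bval b \<sigma>' \<Longrightarrow> agree (writes c) \<sigma> \<sigma>' \<Longrightarrow>
      exec c \<sigma>' (\<lambda>k \<sigma>''. \<exists>\<phi>'. I \<sigma>'' \<phi>' \<and> k + bcost b + 1 + \<phi>' \<le> \<phi>)"
    and final: "\<And>k \<sigma>' \<phi>'. I \<sigma>' \<phi>' \<Longrightarrow> \<not> bval b \<sigma>' \<Longrightarrow> agree (writes c) \<sigma> \<sigma>' \<Longrightarrow>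
      k + \<phi>' \<le> \<phi> + bcost b + 1 \<Longrightarrow> Q k \<sigma>'"
  shows "exec (While b c) \<sigma> Q"
proof -
  have "\<exists>k \<sigma>'' \<phi>'. run (While b c) \<sigma>' k \<sigma>'' \<and> I \<sigma>'' \<phi>' \<and> \<not> bval b \<sigma>'' \<and>
      agree (writes c) \<sigma> \<sigma>'' \<and> k + \<phi>' \<le> \<phi> + bcost b + 1"
    if "I \<sigma>' \<phi>" "agree (writes c) \<sigma> \<sigma>'" for \<sigma>' \<phi>
    using that
  proof (induction \<phi> arbitrary: \<sigma>' rule: less_induct)
    case (less \<phi>)
    show ?case
    proof (cases "bval b \<sigma>'")
      case True
      obtain k \<sigma>1 \<phi>1 where 1: "run c \<sigma>' k \<sigma>1" "I \<sigma>1 \<phi>1" "k + bcost b + 1 + \<phi>1 \<le> \<phi>"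
        using step[OF less.prems(1) True less.prems(2)] unfolding exec_def by blast
      have "agree (writes c) \<sigma> \<sigma>1"
        using less.prems(2) run_agree[OF 1(1)] by (rule agree_trans)
      \<comment> \<open>An iteration uses up at least \<open>bcost b + 1\<close> credits, so the
        supply strictly decreases: the induction that bounds the time also proves
        termination.\<close>
      from less.IH[OF _ 1(2) this] 1(3) obtain l \<sigma>'' \<phi>'
        where "run (While b c) \<sigma>1 l \<sigma>''" "I \<sigma>'' \<phi>'" "\<not> bval b \<sigma>''" "agree (writes c) \<sigma> \<sigma>''"
          "l + \<phi>' \<le> \<phi>1 + bcost b + 1"
        by auto
      moreover from run.WhileTrue[OF True 1(1) this(1)]
      have "run (While b c) \<sigma>' (bcost b + k + l + 1) \<sigma>''" .
      moreover have "bcost b + k + l + 1 + \<phi>' \<le> \<phi> + bcost b + 1"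
        using calculation(5) 1(3) by linarith
      ultimately show ?thesis by blast
    next
      case False
      then show ?thesis using less.prems run.WhileFalse[OF False]
        by (intro exI[of _ "bcost b + 1"] exI[of _ \<sigma>'] exI[of _ \<phi>]) auto
    qed
  qed
  from this[OF init agree_refl] show ?thesis unfolding exec_def using final by blast
qed

section \<open>Hollow heaps\<close>

text \<open>
  The heap has the nodes \<open>V\<close>, the roots \<open>R\<close>, and the children \<open>K u\<close> of a node \<open>u\<close> in order of
  decreasing rank. The vertex \<open>v\<close> is in the heap iff \<open>node v \<noteq> 0\<close>, and a node \<open>u\<close> is hollow iff
  \<open>node (item u) \<noteq> u\<close>; the key of a full node is the label \<open>d\<close> of its vertex.
\<close>

definition hheap :: "nat \<Rightarrow> nat \<Rightarrow> nat set \<Rightarrow> nat set \<Rightarrow> (nat \<Rightarrow> nat list) \<Rightarrow> (nat \<Rightarrow> nat) \<Rightarrow>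
    (nat \<Rightarrow> nat) \<Rightarrow> (nat \<Rightarrow> ereal) \<Rightarrow> (nat \<Rightarrow> nat) \<Rightarrow> (nat \<Rightarrow> ereal) \<Rightarrow> bool" where
  "hheap n m V R K rank item key node d \<longleftrightarrow>
    V \<subseteq> {1..m} \<and> R \<subseteq> V \<and>
    (\<forall>u\<in>V. set (K u) \<subseteq> V - R) \<and>
    (\<forall>u\<in>V. \<forall>u'\<in>V. u \<noteq> u' \<longrightarrow> set (K u) \<inter> set (K u') = {}) \<and>
    (\<forall>c\<in>V - R. \<exists>u\<in>V. c \<in> set (K u)) \<and>
    (\<forall>u\<in>V. \<forall>i<length (K u). rank (K u ! i) + i + 1 = rank u) \<and>
    (\<forall>u\<in>V. min 2 (rank u) \<le> length (K u)) \<and>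
    (\<forall>u\<in>V. \<forall>c\<in>set (K u). key u \<le> key c) \<and>
    (\<forall>u\<in>V. item u < n) \<and>
    (\<forall>v<n. node v \<noteq> 0 \<longrightarrow> node v \<in> V \<and> item (node v) = v) \<and>
    (\<forall>u\<in>V. node (item u) = u \<longrightarrow> length (K u) = rank u \<and> key u = d (item u))"

lemma hheapI:
  assumes "V \<subseteq> {1..m}" "R \<subseteq> V"
    and "\<And>u. u \<in> V \<Longrightarrow> set (K u) \<subseteq> V - R"
    and "\<And>u u'. u \<in> V \<Longrightarrow> u' \<in> V \<Longrightarrow> u \<noteq> u' \<Longrightarrow> set (K u) \<inter> set (K u') = {}"
    and "\<And>c. c \<in> V - R \<Longrightarrow> \<exists>u\<in>V. c \<in> set (K u)"
    and "\<And>u i. u \<in> V \<Longrightarrow> i < length (K u) \<Longrightarrow> rank (K u ! i) + i + 1 = rank u"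
    and "\<And>u. u \<in> V \<Longrightarrow> min 2 (rank u) \<le> length (K u)"
    and "\<And>u c. u \<in> V \<Longrightarrow> c \<in> set (K u) \<Longrightarrow> key u \<le> key c"
    and "\<And>u. u \<in> V \<Longrightarrow> item u < n"
    and "\<And>v. v < n \<Longrightarrow> node v \<noteq> 0 \<Longrightarrow> node v \<in> V \<and> item (node v) = v"
    and "\<And>u. u \<in> V \<Longrightarrow> node (item u) = u \<Longrightarrow> length (K u) = rank u \<and> key u = d (item u)"
  shows "hheap n m V R K rank item key node d"
  unfolding hheap_def using assms by (intro conjI ballI allI impI) simp_all

text \<open>A potential. Destroying a hollow root turns each of its children into a root that must
  receive a root's credit; the extra 1 pays for the node itself.\<close>

definition hollow_weight ::
    "nat set \<Rightarrow> (nat \<Rightarrow> nat list) \<Rightarrow> (nat \<Rightarrow> nat) \<Rightarrow> (nat \<Rightarrow> nat) \<Rightarrow> nat" where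
  "hollow_weight V K item node = (\<Sum>u\<in>{u\<in>V. node (item u) \<noteq> u}. length (K u) + 1)"

section \<open>Structure of hollow heaps and the logarithmic rank bound\<close>

context
  fixes n m V R K rank item key node d
  assumes heap: "hheap n m V R K rank item key node d"
begin

lemma
  shows hheap_V: "V \<subseteq> {1..m}" and hheap_R: "R \<subseteq> V"
    and hheap_K: "u \<in> V \<Longrightarrow> set (K u) \<subseteq> V - R"
    and hheap_disj: "u \<in> V \<Longrightarrow> u' \<in> V \<Longrightarrow> u \<noteq> u' \<Longrightarrow> set (K u) \<inter> set (K u') = {}"
    and hheap_parent: "c \<in> V \<Longrightarrow> c \<notin> R \<Longrightarrow> \<exists>u\<in>V. c \<in> set (K u)"
    and hheap_rank: "u \<in> V \<Longrightarrow> i < length (K u) \<Longrightarrow> rank (K u ! i) + i + 1 = rank u"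
    and hheap_length: "u \<in> V \<Longrightarrow> min 2 (rank u) \<le> length (K u)"
    and hheap_key: "u \<in> V \<Longrightarrow> c \<in> set (K u) \<Longrightarrow> key u \<le> key c"
    and hheap_item: "u \<in> V \<Longrightarrow> item u < n"
    and hheap_node: "v < n \<Longrightarrow> node v \<noteq> 0 \<Longrightarrow> node v \<in> V \<and> item (node v) = v"
    and hheap_full: "u \<in> V \<Longrightarrow> node (item u) = u \<Longrightarrow> length (K u) = rank u \<and> key u = d (item u)"
  using heap unfolding hheap_def by simp_all

lemma hheap_finite: "finite V"
  using hheap_V finite_subset by blast

lemma hheap_zero: "0 \<notin> V"
  using hheap_V by auto

lemma hheap_child_rank: "u \<in> V \<Longrightarrow> c \<in> set (K u) \<Longrightarrow> rank c < rank u"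
  by (fastforce simp: in_set_conv_nth dest: hheap_rank)

text \<open>The invariant fixes the rank of the child at position i as
  \<open>rank u - i - 1\<close>, so different positions hold nodes of different ranks.\<close>

lemma hheap_distinct: "u \<in> V \<Longrightarrow> distinct (K u)"
  unfolding distinct_conv_nth
proof (intro allI impI notI)
  fix i j
  assume "u \<in> V" "i < length (K u)" "j < length (K u)" "i \<noteq> j" "K u ! i = K u ! j"
  with hheap_rank[of u i] hheap_rank[of u j] show False by simp
qed

text \<open>From a node to its parent the rank strictly increases and the key does not. The climb is
  bounded by the largest rank \<open>B\<close> in the heap, so the induction runs on the gap to
  \<open>B\<close>.\<close>

lemma hheap_root_le:
  assumes "u \<in> V"
  shows "\<exists>r\<in>R. key r \<le> key u"
proof -
  define B where "B = Max (rank ` V)"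
  have B: "rank v \<le> B" if "v \<in> V" for v
    unfolding B_def using that hheap_finite by simp
  from assms show ?thesis
  proof (induction "B - rank u" arbitrary: u rule: less_induct)
    case less
    show ?case
    proof (cases "u \<in> R")
      case False
      with hheap_parent less.prems obtain p where p: "p \<in> V" "u \<in> set (K p)" by blast
      have "B - rank p < B - rank u"
        using hheap_child_rank[OF p] B[OF p(1)] by linarith
      from less.hyps[OF this p(1)] hheap_key[OF p] show ?thesis by (meson order_trans)
    qed auto
  qed
qed

lemma hheap_min:
  assumes "u \<in> R" "\<And>r. r \<in> R \<Longrightarrow> key u \<le> key r" "v < n" "node v \<noteq> 0"
  shows "key u \<le> d v"
proof -
  from hheap_node[OF assms(3,4)] have "node v \<in> V" "item (node v) = v" by auto
  moreover from this hheap_full have "key (node v) = d v" by metis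
  ultimately show ?thesis using hheap_root_le[of "node v"] assms(2) by (metis order_trans)
qed

text \<open>The argument counts descendants \<open>D u\<close>, hollow ones included. The first two
  children have disjoint sets of descendants, and estimating both by the smaller rank r - 2 doubles
  the count every two ranks. A Fibonacci bound would be sharper but would change only the
  constant.\<close>

lemma hheap_rank_bound:
  assumes "u \<in> V"
  shows "2 ^ (rank u div 2) \<le> card V"
proof -
  define A where "A = {(c, u). u \<in> V \<and> c \<in> set (K u)}"
  define D where "D u = {x. (x, u) \<in> A\<^sup>*}" for u
  have sv: "single_valued A"
    unfolding A_def single_valued_def using hheap_disj by blast
  have mono: "rank x \<le> rank y" if "(x, y) \<in> A\<^sup>*" for x y
    using that
  proof (induction rule: rtrancl_induct)
    case (step y z)
    then show ?case using hheap_child_rank[of z y] unfolding A_def by force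
  qed simp
  have D_V: "D u \<subseteq> V" if "u \<in> V" for u
  proof
    fix x assume "x \<in> D u"
    then have "(x, u) \<in> A\<^sup>*" by (simp add: D_def)
    then show "x \<in> V" using that
      by (cases rule: converse_rtranclE) (use hheap_K in \<open>auto simp: A_def\<close>)
  qed
  have fin: "finite (D u)" if "u \<in> V" for u
    using D_V[OF that] hheap_finite finite_subset by blast
  \<comment> \<open>Each child has a single parent, so a common descendant of the siblings
    \<open>c\<close> and \<open>c'\<close> would make one of them a proper descendant of the other.
    The path upwards from the lower one starts with its parent \<open>u\<close>, so \<open>u\<close>
    would lie below its own child, against the ranks.\<close>
  have disj: "D c \<inter> D c' = {}" if "u \<in> V" "c \<in> set (K u)" "c' \<in> set (K u)" "c \<noteq> c'" for u c c'
  proof -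
    have False if "(c, c') \<in> A\<^sup>*" "c \<in> set (K u)" "c' \<in> set (K u)" "c \<noteq> c'" for c c'
    proof -
      from that(1,4) obtain z where z: "(c, z) \<in> A" "(z, c') \<in> A\<^sup>*"
        by (auto elim: converse_rtranclE)
      have "(c, u) \<in> A" using that \<open>u \<in> V\<close> by (simp add: A_def)
      with z(1) sv have "z = u" by (auto dest: single_valuedD)
      with mono[OF z(2)] hheap_child_rank[OF \<open>u \<in> V\<close> that(3)] show False by simp
    qed
    then show ?thesis
      using that single_valued_confluent[OF sv] unfolding D_def by blast
  qed
  have "2 ^ (rank u div 2) \<le> card (D u)" if "u \<in> V" for u
    using that
  proof (induction "rank u" arbitrary: u rule: less_induct)
    case less
    have self: "u \<in> D u" by (simp add: D_def)
    show ?case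
    proof (cases "rank u < 2")
      case True
      then have "rank u div 2 = 0" by simp
      moreover have "card (D u) > 0" using self fin[OF less.prems] card_gt_0_iff by blast
      ultimately show ?thesis by simp
    next
      case False
      then have len: "2 \<le> length (K u)" using hheap_length[OF less.prems] by simp
      define c c' where "c = K u ! 0" and "c' = K u ! 1"
      have c: "c \<in> set (K u)" "c' \<in> set (K u)" unfolding c_def c'_def using len by (auto intro!: nth_mem)
      have rk: "rank c + 1 = rank u" "rank c' + 2 = rank u"
        unfolding c_def c'_def using hheap_rank[OF less.prems, of 0] hheap_rank[OF less.prems, of 1] len
        by force+
      then have ne: "c \<noteq> c'" by auto
      have cV: "c \<in> V" "c' \<in> V" using c hheap_K[OF less.prems] by auto
      have sub: "D c \<union> D c' \<subseteq> D u"
        using c less.prems unfolding D_def A_def by (auto intro: rtrancl_into_rtrancl)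
      have half: "rank u div 2 = Suc (rank c' div 2)" using rk by simp
      have "2 ^ (rank c' div 2) \<le> (2::nat) ^ (rank c div 2)" using rk by (intro power_increasing) auto
      also have "\<dots> \<le> card (D c)" using less.hyps[of c] rk cV by simp
      finally have "2 ^ (rank u div 2) \<le> card (D c) + card (D c')"
        using less.hyps[of c'] rk cV unfolding half by simp
      also have "\<dots> = card (D c \<union> D c')"
        using disj[OF less.prems c ne] fin cV by (simp add: card_Un_disjoint)
      also have "\<dots> \<le> card (D u)" using sub fin[OF less.prems] by (rule card_mono[rotated])
      finally show ?thesis .
    qed
  qed
  from this[OF assms] card_mono[OF hheap_finite D_V[OF assms]] show ?thesis by linarith
qed

text \<open>Prepending \<open>t\<close> moves every old child one position down, which offsets the
  rank of \<open>p\<close> going up by one, and \<open>t\<close> itself has the right rank for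
  position 0. That \<open>p\<close> is full gives \<open>length (K p) = rank p\<close>, and this
  equality survives the link.\<close>

lemma hheap_link:
  assumes "p \<in> R" "t \<in> R" "p \<noteq> t" "rank p = rank t" "node (item p) = p" "key p \<le> key t"
  shows "hheap n m V (R - {t}) (K(p := t # K p)) (rank(p := Suc (rank p))) item key node d"
proof -
  have pV: "p \<in> V" "t \<in> V" using assms hheap_R by auto
  have pK: "p \<notin> set (K u)" "t \<notin> set (K u)" if "u \<in> V" for u using hheap_K[OF that] assms by auto
  have len: "length (K p) = rank p" using hheap_full[OF pV(1) assms(5)] by simp
  have rank: "(rank(p := Suc (rank p))) ((K(p := t # K p)) u ! i) + i + 1 = (rank(p := Suc (rank p))) u"
    if "u \<in> V" "i < length ((K(p := t # K p)) u)" for u i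
  proof (cases "u = p")
    case True
    then show ?thesis
      using that hheap_rank[of p] pK[OF pV(1)] assms
      by (cases i) (auto dest: nth_mem)
  next
    case False
    then have "K u ! i \<noteq> p" using that pK[of u] by (auto dest: nth_mem)
    then show ?thesis using that False hheap_rank[of u i] by simp
  qed
  have disj: "\<forall>u\<in>V. \<forall>u'\<in>V. u \<noteq> u' \<longrightarrow> set ((K(p := t # K p)) u) \<inter> set ((K(p := t # K p)) u') = {}"
    using hheap_disj pK by auto
  have parent: "\<forall>c\<in>V - (R - {t}). \<exists>u\<in>V. c \<in> set ((K(p := t # K p)) u)"
  proof
    fix c assume c: "c \<in> V - (R - {t})"
    show "\<exists>u\<in>V. c \<in> set ((K(p := t # K p)) u)"
    proof (cases "c = t")
      case True then show ?thesis using pV by (intro bexI[of _ p]) auto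
    next
      case False
      then obtain u where "u \<in> V" "c \<in> set (K u)" using hheap_parent c by auto
      then show ?thesis by (intro bexI[of _ u]) auto
    qed
  qed
  have K: "set ((K(p := t # K p)) u) \<subseteq> V - (R - {t})" if "u \<in> V" for u
    using hheap_K[OF that] pV by (cases "u = p") auto
  show ?thesis
  proof (rule hheapI, goal_cases)
    case 1
    then show ?case using hheap_V by simp
  next
    case 2
    then show ?case using hheap_R by auto
  next
    case (4 u u')
    then show ?case using disj by blast
  next
    case (5 c)
    then show ?case using parent by blast
  next
    case (7 u)
    then show ?case using hheap_length[of u] len by auto
  next
    case (8 u c)
    then show ?case using hheap_key[of u c] assms by (auto split: if_splits)
  next
    case (11 u)
    then show ?case using hheap_full[of u] len by auto
  qed (rule K rank hheap_item hheap_node; assumption)+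
qed

text \<open>The invariant is inherited by the remaining nodes, as no other node has \<open>u\<close>
  or a child of \<open>u\<close> among its children. The weight released is just what the new roots
  have to be paid with.\<close>

lemma hheap_destroy:
  assumes "u \<in> R" "node (item u) \<noteq> u"
  shows "hheap n m (V - {u}) (R - {u} \<union> set (K u)) K rank item key node d"
    and "hollow_weight (V - {u}) K item node + length (K u) + 1 = hollow_weight V K item node"
proof -
  have uV: "u \<in> V" using assms hheap_R by auto
  have K: "set (K v) \<subseteq> V - {u} - (R - {u} \<union> set (K u))" if "v \<in> V - {u}" for v
    using that hheap_K[of v] hheap_disj[of v u] uV assms by auto
  have parent: "\<exists>v\<in>V - {u}. c \<in> set (K v)" if "c \<in> V - {u} - (R - {u} \<union> set (K u))" for c
    using that hheap_parent[of c] by auto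
  have sub: "R - {u} \<union> set (K u) \<subseteq> V - {u}" using hheap_R hheap_K[OF uV] assms by auto
  have node: "node v \<in> V - {u} \<and> item (node v) = v" if "v < n" "node v \<noteq> 0" for v
    using that hheap_node[of v] assms by auto
  show "hheap n m (V - {u}) (R - {u} \<union> set (K u)) K rank item key node d"
  proof (rule hheapI, goal_cases)
    case 1
    then show ?case using hheap_V by auto
  qed (use sub K parent node hheap_disj hheap_rank hheap_length hheap_key hheap_item hheap_full in \<open>simp_all\<close>)
  have "{v\<in>V. node (item v) \<noteq> v} = insert u {v\<in>V - {u}. node (item v) \<noteq> v}"
    using assms uV by auto
  then show "hollow_weight (V - {u}) K item node + length (K u) + 1 = hollow_weight V K item node"
    unfolding hollow_weight_def using hheap_finite by simp
qed

text \<open>Extraction only clears the pointer from the vertex to its node; the node turns hollow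
  and stays in place. The increase of the potential by \<open>rank u + 1\<close> is where the
  logarithm enters the cost.\<close>

lemma hheap_extract:
  assumes "u \<in> V" "node (item u) = u"
  shows "hheap n m V R K rank item key (node(item u := 0)) d"
    and "hollow_weight V K item (node(item u := 0)) = hollow_weight V K item node + rank u + 1"
proof -
  have u0: "u \<noteq> 0" using assms hheap_zero by metis
  show "hheap n m V R K rank item key (node(item u := 0)) d"
  proof (rule hheapI, goal_cases)
    case (5 c)
    then show ?case using hheap_parent by blast
  next
    case (10 w)
    then show ?case using hheap_node by (auto split: if_splits)
  next
    case (11 u)
    then show ?case using hheap_full hheap_zero by (metis fun_upd_apply)
  qed (rule hheap_V hheap_R hheap_K hheap_disj hheap_rank hheap_length hheap_key hheap_item; assumption)+
  have "{v\<in>V. (node(item u := 0)) (item v) \<noteq> v} = insert u {v\<in>V. node (item v) \<noteq> v}"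
    using assms u0 hheap_zero by (auto intro: gr0I)
  then show "hollow_weight V K item (node(item u := 0)) = hollow_weight V K item node + rank u + 1"
    unfolding hollow_weight_def using hheap_finite assms hheap_full[OF assms] by simp
qed

lemma hheap_push_new:
  assumes "v < n" "node v = 0"
  shows "hheap n (Suc m) (insert (Suc m) V) (insert (Suc m) R) (K(Suc m := [])) (rank(Suc m := 0))
      (item(Suc m := v)) (key(Suc m := x)) (node(v := Suc m)) (d(v := x))"
    and "hollow_weight (insert (Suc m) V) (K(Suc m := [])) (item(Suc m := v)) (node(v := Suc m))
      = hollow_weight V K item node"
proof -
  have q: "Suc m \<notin> V" using hheap_V by auto
  have v: "node (item u) \<noteq> u" if "u \<in> V" "item u = v" for u
    using that assms hheap_zero by metis
  have K: "Suc m \<notin> set (K u)" if "u \<in> V" for u using hheap_K[OF that] q by auto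
  have rank: "(rank(Suc m := 0)) ((K(Suc m := [])) u ! i) + i + 1 = (rank(Suc m := 0)) u"
    if "u \<in> insert (Suc m) V" "i < length ((K(Suc m := [])) u)" for u i
  proof (cases "u = Suc m")
    case False
    then have "u \<in> V" "i < length (K u)" using that by auto
    then have "K u ! i \<noteq> Suc m" using K nth_mem by metis
    then show ?thesis using that False hheap_rank[of u i] by simp
  qed (use that in simp)
  have node: "(node(v := Suc m)) w \<in> insert (Suc m) V \<and> (item(Suc m := v)) ((node(v := Suc m)) w) = w"
    if "w < n" "(node(v := Suc m)) w \<noteq> 0" for w
    using that hheap_node[of w] q by auto
  have full: "length ((K(Suc m := [])) u) = (rank(Suc m := 0)) u \<and> (key(Suc m := x)) u = (d(v := x)) ((item(Suc m := v)) u)"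
    if "u \<in> insert (Suc m) V" "(node(v := Suc m)) ((item(Suc m := v)) u) = u" for u
    using that hheap_full[of u] v[of u] q by (auto split: if_splits)
  show "hheap n (Suc m) (insert (Suc m) V) (insert (Suc m) R) (K(Suc m := [])) (rank(Suc m := 0))
      (item(Suc m := v)) (key(Suc m := x)) (node(v := Suc m)) (d(v := x))"
  proof (rule hheapI, goal_cases)
    case 1
    then show ?case using hheap_V by auto
  next
    case 2
    then show ?case using hheap_R by auto
  next
    case (3 u)
    then show ?case using hheap_K[of u] K[of u] q by auto
  next
    case (4 u u')
    then show ?case using hheap_disj[of u u'] by auto
  next
    case (5 c)
    then obtain u where "u \<in> V" "c \<in> set (K u)" using hheap_parent[of c] by blast
    then show ?case using q by (intro bexI[of _ u]) auto
  next
    case (7 u)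
    then show ?case using hheap_length[of u] by auto
  next
    case (8 u c)
    then show ?case using hheap_key[of u c] K[of u] by (auto split: if_splits)
  next
    case (9 u)
    then show ?case using hheap_item[of u] assms by auto
  qed (rule rank node full; assumption)+
  have "{u \<in> insert (Suc m) V. (node(v := Suc m)) ((item(Suc m := v)) u) \<noteq> u} = {u\<in>V. node (item u) \<noteq> u}"
    using v q by auto
  then show "hollow_weight (insert (Suc m) V) (K(Suc m := [])) (item(Suc m := v)) (node(v := Suc m))
      = hollow_weight V K item node"
    unfolding hollow_weight_def using q by (intro sum.cong) auto
qed

text \<open>Dropping two children shifts positions by two, exactly the difference in rank between
  \<open>p\<close> and \<open>q\<close>. The old node keeps its rank with a shortened list, which is
  why the invariant asks only for \<open>min 2 (rank u)\<close> children in general. Now hollow with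
  at most two children, \<open>p\<close> adds at most 2 + 1 to the weight. For ranks up to 2 the
  truncated subtraction and \<open>drop 2\<close> give rank 0 and no children.\<close>

lemma hheap_decrease:
  assumes "v < n" "node v = p" "p \<noteq> 0" "x \<le> d v"
  defines "q \<equiv> Suc m"
  defines "K' \<equiv> K(p := take 2 (K p), q := drop 2 (K p))"
  shows "hheap n q (insert q V) (insert q R) K' (rank(q := rank p - 2))
      (item(q := v)) (key(q := x)) (node(v := q)) (d(v := x))"
    and "hollow_weight (insert q V) K' (item(q := v)) (node(v := q)) \<le> hollow_weight V K item node + 3"
proof -
  have q: "q \<notin> V" using hheap_V unfolding q_def by auto
  have p: "p \<in> V" "item p = v" using hheap_node[of v] assms by auto
  have pq: "p \<noteq> q" using p q by auto
  have len: "length (K p) = rank p" "key p = d v" using hheap_full[of p] p assms by auto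
  have v: "u = p" if "u \<in> V" "item u = v" "node v = u" for u
    using that assms by auto
  have K: "q \<notin> set (K u)" "p \<notin> set (K p)" if "u \<in> V" for u
    using hheap_K[OF that] q hheap_child_rank[OF p(1)] by auto
  have set_take_drop: "set (take 2 (K p)) \<union> set (drop 2 (K p)) = set (K p)"
    by (metis append_take_drop_id set_append)
  have take_drop: "set (take 2 (K p)) \<inter> set (drop 2 (K p)) = {}"
    using hheap_distinct[OF p(1)] by (simp add: set_take_disj_set_drop_if_distinct)
  have sub: "set (K' u) \<subseteq> set (K (if u = q then p else u))" if "u \<in> insert q V" for u
    unfolding K'_def using set_take_drop by auto
  have rank: "(rank(q := rank p - 2)) (K' u ! i) + i + 1 = (rank(q := rank p - 2)) u"
    if u: "u \<in> insert q V" "i < length (K' u)" for u i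
  proof -
    have "K' u ! i \<in> set (K (if u = q then p else u))" using sub[OF u(1)] nth_mem[OF u(2)] by blast
    moreover have "(if u = q then p else u) \<in> V" using u p by auto
    ultimately have ne: "K' u ! i \<noteq> q" using K(1) by metis
    consider "u = q" | "u = p" | "u \<noteq> q" "u \<noteq> p" by blast
    then show ?thesis
    proof cases
      case 1
      then have "2 + i < length (K p)" using u by (simp add: K'_def)
      with 1 show ?thesis using u ne hheap_rank[OF p(1), of "2 + i"] by (simp add: K'_def)
    next
      case 2
      then show ?thesis using u ne pq hheap_rank[OF p(1), of i] by (simp add: K'_def)
    next
      case 3
      then show ?thesis using u ne hheap_rank[of u i] by (simp add: K'_def)
    qed
  qed
  have node: "(node(v := q)) w \<in> insert q V \<and> (item(q := v)) ((node(v := q)) w) = w"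
    if "w < n" "(node(v := q)) w \<noteq> 0" for w
    using that hheap_node[of w] q by auto
  have full: "length (K' u) = (rank(q := rank p - 2)) u \<and> (key(q := x)) u = (d(v := x)) ((item(q := v)) u)"
    if "u \<in> insert q V" "(node(v := q)) ((item(q := v)) u) = u" for u
    using that hheap_full[of u] q len p unfolding K'_def by (auto split: if_splits)
  have disj: "set (K' u) \<inter> set (K' u') = {}" if "u \<in> insert q V" "u' \<in> insert q V" "u \<noteq> u'" for u u'
  proof (cases "{u, u'} = {p, q}")
    case True
    then show ?thesis using take_drop pq unfolding K'_def by (auto simp: doubleton_eq_iff)
  next
    case False
    then have "(if u = q then p else u) \<noteq> (if u' = q then p else u')" using that by auto
    then show ?thesis
      using sub[OF that(1)] sub[OF that(2)] that p
        hheap_disj[of "if u = q then p else u" "if u' = q then p else u'"]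
      by (auto split: if_splits)
  qed
  have parent: "\<exists>u\<in>insert q V. c \<in> set (K' u)" if c: "c \<in> insert q V - insert q R" for c
  proof -
    obtain u where u: "u \<in> V" "c \<in> set (K u)" using c hheap_parent[of c] by blast
    show ?thesis
    proof (cases "u = p")
      case True
      then have "c \<in> set (K' p) \<or> c \<in> set (K' q)" using u set_take_drop pq unfolding K'_def by auto
      then show ?thesis using p by auto
    next
      case False
      then have "c \<in> set (K' u)" using u q unfolding K'_def by auto
      then show ?thesis using u by auto
    qed
  qed
  have K': "set (K' u) \<subseteq> insert q V - insert q R" if u: "u \<in> insert q V" for u
  proof -
    from u have "(if u = q then p else u) \<in> V" using p by auto
    from hheap_K[OF this] K(1)[OF this] sub[OF u] show ?thesis by blast
  qed
  have key: "(key(q := x)) u \<le> (key(q := x)) c" if u: "u \<in> insert q V" and c: "c \<in> set (K' u)" for u c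
  proof (cases "u = q")
    case True
    then have "c \<in> set (K p)" using sub[OF u] c by auto
    with hheap_key[OF p(1) this] K(1)[OF p(1)] True len assms(4) show ?thesis
      by (auto intro: order_trans)
  next
    case False
    then have "u \<in> V" "c \<in> set (K u)" using u sub[OF u] c by auto
    with hheap_key[of u c] K(1)[of u] False show ?thesis by auto
  qed
  show "hheap n q (insert q V) (insert q R) K' (rank(q := rank p - 2))
      (item(q := v)) (key(q := x)) (node(v := q)) (d(v := x))"
  proof (rule hheapI, goal_cases)
    case 1
    then show ?case using hheap_V by (auto simp: q_def)
  next
    case 2
    then show ?case using hheap_R by auto
  next
    case (7 u)
    then show ?case using hheap_length[of u] len unfolding K'_def by auto
  next
    case (9 u)
    then show ?case using hheap_item[of u] assms by auto
  qed (rule K' disj parent rank key node full; assumption)+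
  have "{u \<in> insert q V. (node(v := q)) ((item(q := v)) u) \<noteq> u} = insert p {u\<in>V. node (item u) \<noteq> u}"
    using q p pq assms(2) by auto
  moreover have "p \<notin> {u\<in>V. node (item u) \<noteq> u}" using p assms by auto
  moreover have "(\<Sum>u\<in>{u\<in>V. node (item u) \<noteq> u}. length (K' u) + 1) = (\<Sum>u\<in>{u\<in>V. node (item u) \<noteq> u}. length (K u) + 1)"
    using q p assms(2) by (intro sum.cong) (auto simp: K'_def)
  ultimately show "hollow_weight (insert q V) K' (item(q := v)) (node(v := q)) \<le> hollow_weight V K item node + 3"
    unfolding hollow_weight_def using hheap_finite pq by (simp add: K'_def)
qed

end

section \<open>Hollow heaps in memory\<close>

text \<open>Linked lists terminated by the null pointer 0, which is why nodes are numbered from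
  1.\<close>

fun chain :: "(nat \<Rightarrow> nat) \<Rightarrow> nat \<Rightarrow> nat list \<Rightarrow> bool" where
  "chain nx p [] \<longleftrightarrow> p = 0"
| "chain nx p (u # us) \<longleftrightarrow> p = u \<and> u \<noteq> 0 \<and> chain nx (nx u) us"

lemma chain_upd: "y \<notin> set us \<Longrightarrow> chain (nx(y := z)) p us \<longleftrightarrow> chain nx p us"
  by (induction us arbitrary: p) auto

lemma chain_nonempty: "chain nx p us \<Longrightarrow> p \<noteq> 0 \<Longrightarrow> \<exists>us'. us = p # us' \<and> chain nx (nx p) us'"
  by (cases us) auto

lemma chain_empty: "chain nx 0 us \<longleftrightarrow> us = []"
  by (cases us) auto

text \<open>Insertion and key decrease share this code. For a vertex outside the heap
  \<open>p\<close> is 0, and since the null node is given rank 0, the test \<open>1 < rank p\<close>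
  fails and nothing is taken over. Otherwise \<open>c\<close> is the second child of
  \<open>p\<close>, after which the list is cut.\<close>

definition heap_push :: com where
  "heap_push =
    Seq (RPut ''d'' (NVar ''v'') (RVar ''x''))
    (Seq (NAssign ''cnt'' (Inc (NVar ''cnt'')))
    (Seq (NPut ''item'' (NVar ''cnt'') (NVar ''v''))
    (Seq (RPut ''key'' (NVar ''cnt'') (RVar ''x''))
    (Seq (NAssign ''p'' (NGet ''node'' (NVar ''v'')))
    (Seq
      (Cond (NLess (NConst 1) (NGet ''rank'' (NVar ''p'')))
        (Seq (NPut ''rank'' (NVar ''cnt'') (Dec (Dec (NGet ''rank'' (NVar ''p'')))))
        (Seq (NAssign ''c'' (NGet ''nxt'' (NGet ''kid'' (NVar ''p''))))
        (Seq (NPut ''kid'' (NVar ''cnt'') (NGet ''nxt'' (NVar ''c'')))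
          (NPut ''nxt'' (NVar ''c'') (NConst 0)))))
        (Seq (NPut ''rank'' (NVar ''cnt'') (NConst 0))
          (NPut ''kid'' (NVar ''cnt'') (NConst 0))))
    (Seq (NPut ''node'' (NVar ''v'') (NVar ''cnt''))
    (Seq (NPut ''nxt'' (NVar ''cnt'') (NVar ''roots''))
      (NAssign ''roots'' (NVar ''cnt'')))))))))"

definition heap_link :: com where
  "heap_link =
    Seq (NAssign ''t'' (NGet ''tab'' (NVar ''r'')))
    (Seq (NPut ''tab'' (NVar ''r'') (NConst 0))
    (Seq
      (Cond (RLess (RGet ''key'' (NVar ''t'')) (RGet ''key'' (NVar ''p'')))
        (Seq (NAssign ''c'' (NVar ''p''))
        (Seq (NAssign ''p'' (NVar ''t''))
          (NAssign ''t'' (NVar ''c''))))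
        Skip)
    (Seq (NPut ''nxt'' (NVar ''t'') (NGet ''kid'' (NVar ''p'')))
    (Seq (NPut ''kid'' (NVar ''p'') (NVar ''t''))
    (Seq (NAssign ''r'' (Inc (NVar ''r'')))
      (NPut ''rank'' (NVar ''p'') (NVar ''r'')))))))"

text \<open>The table acts like a binary counter: each cell holds at most one root of its rank, and
  a collision links two roots and carries to the next rank. Cells at or above \<open>lim\<close>
  count as empty whatever they contain.\<close>

definition heap_place :: com where
  "heap_place =
    Seq (NAssign ''r'' (NGet ''rank'' (NVar ''p'')))
    (Seq
      (While (Conj (NLess (NVar ''r'') (NVar ''lim''))
                   (NLess (NConst 0) (NGet ''tab'' (NVar ''r''))))
        heap_link)
    (Seq (Cond (NLess (NVar ''r'') (NVar ''lim'')) Skip (NAssign ''lim'' (Inc (NVar ''lim''))))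
      (NPut ''tab'' (NVar ''r'') (NVar ''p''))))"

definition heap_destroy :: com where
  "heap_destroy =
    Seq (NAssign ''c'' (NGet ''kid'' (NVar ''p'')))
      (While (NLess (NConst 0) (NVar ''c''))
        (Seq (NAssign ''t'' (NGet ''nxt'' (NVar ''c'')))
        (Seq (NPut ''nxt'' (NVar ''c'') (NVar ''roots''))
        (Seq (NAssign ''roots'' (NVar ''c''))
          (NAssign ''c'' (NVar ''t''))))))"

definition heap_consolidate :: com where
  "heap_consolidate =
    While (NLess (NConst 0) (NVar ''roots''))
      (Seq (NAssign ''p'' (NVar ''roots''))
      (Seq (NAssign ''roots'' (NGet ''nxt'' (NVar ''p'')))
      (Seq (NAssign ''c'' (NGet ''node'' (NGet ''item'' (NVar ''p''))))
        (Cond (Conj (Neg (NLess (NVar ''c'') (NVar ''p''))) (Neg (NLess (NVar ''p'') (NVar ''c''))))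
          heap_place heap_destroy))))"

text \<open>The value \<open>u = n\<close> means that no candidate has been seen yet, so
  \<open>du\<close> is uninitialised and must not decide the comparison. The same pass empties the
  table for the next consolidation.\<close>

definition heap_collect :: com where
  "heap_collect =
    Seq (NAssign ''u'' (NVar ''n''))
    (Seq (NAssign ''r'' (NConst 0))
      (While (NLess (NVar ''r'') (NVar ''lim''))
        (Seq (NAssign ''t'' (NGet ''tab'' (NVar ''r'')))
        (Seq
          (Cond (NLess (NConst 0) (NVar ''t''))
            (Seq (NPut ''tab'' (NVar ''r'') (NConst 0))
            (Seq (NPut ''nxt'' (NVar ''t'') (NVar ''roots''))
            (Seq (NAssign ''roots'' (NVar ''t''))
              (Cond (Conj (NLess (NVar ''u'') (NVar ''n''))
                          (Neg (RLess (RGet ''key'' (NVar ''t'')) (RVar ''du''))))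
                Skip
                (Seq (NAssign ''u'' (NGet ''item'' (NVar ''t'')))
                  (RAssign ''du'' (RGet ''key'' (NVar ''t''))))))))
            Skip)
          (NAssign ''r'' (Inc (NVar ''r'')))))))"

definition heap_extract :: com where
  "heap_extract =
    Seq heap_consolidate
    (Seq heap_collect
      (Cond (NLess (NVar ''u'') (NVar ''n'')) (NPut ''node'' (NVar ''u'') (NConst 0)) Skip))"

section \<open>Heap invariants on machine states, and amortised costs of the operations\<close>

definition heap_mem :: "state \<Rightarrow> nat set \<Rightarrow> nat set \<Rightarrow> (nat \<Rightarrow> nat list) \<Rightarrow> bool" where
  "heap_mem \<sigma> V R K \<longleftrightarrow>
    hheap (nvar \<sigma> ''n'') (nvar \<sigma> ''cnt'') V R K (narr \<sigma> ''rank'') (narr \<sigma> ''item'')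
      (rarr \<sigma> ''key'') (narr \<sigma> ''node'') (rarr \<sigma> ''d'') \<and>
    (\<forall>u\<in>V. chain (narr \<sigma> ''nxt'') (narr \<sigma> ''kid'' u) (K u)) \<and> narr \<sigma> ''rank'' 0 = 0"

definition weight :: "state \<Rightarrow> nat set \<Rightarrow> (nat \<Rightarrow> nat list) \<Rightarrow> nat" where
  "weight \<sigma> V K = hollow_weight V K (narr \<sigma> ''item'') (narr \<sigma> ''node'')"

definition tab_mem :: "state \<Rightarrow> nat set \<Rightarrow> bool" where
  "tab_mem \<sigma> I \<longleftrightarrow> I = {r. r < nvar \<sigma> ''lim'' \<and> narr \<sigma> ''tab'' r \<noteq> 0} \<and>
    (\<forall>r\<in>I. narr \<sigma> ''rank'' (narr \<sigma> ''tab'' r) = r \<and>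
      narr \<sigma> ''node'' (narr \<sigma> ''item'' (narr \<sigma> ''tab'' r)) = narr \<sigma> ''tab'' r)"

text \<open>A root to be placed has rank at most \<open>lim\<close>, so raising \<open>lim\<close>
  by one always suffices and no cell with unknown contents comes into use. The second conjunct says
  that \<open>lim - 1\<close> was the rank of an actual node when \<open>lim\<close> was raised,
  which makes \<open>lim\<close> logarithmic in the number of nodes.\<close>

definition lim_bounded :: "state \<Rightarrow> nat set \<Rightarrow> bool" where
  "lim_bounded \<sigma> V \<longleftrightarrow> (\<forall>u\<in>V. narr \<sigma> ''rank'' u \<le> nvar \<sigma> ''lim'') \<and>
    (nvar \<sigma> ''lim'' = 0 \<or> 2 ^ ((nvar \<sigma> ''lim'' - 1) div 2) \<le> nvar \<sigma> ''cnt'')"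

text \<open>The credit \<open>\<phi>\<close> is the potential of the heap, \<open>j\<close> the number of insertions still allowed.\<close>

definition heap_inv :: "nat \<Rightarrow> state \<Rightarrow> nat set \<Rightarrow> nat \<Rightarrow> nat \<Rightarrow> bool" where
  "heap_inv M \<sigma> Q j \<phi> \<longleftrightarrow> (\<exists>V K rs.
    heap_mem \<sigma> V (set rs) K \<and> chain (narr \<sigma> ''nxt'') (nvar \<sigma> ''roots'') rs \<and> distinct rs \<and>
    tab_mem \<sigma> {} \<and> lim_bounded \<sigma> V \<and> nvar \<sigma> ''cnt'' + j \<le> M \<and>
    Q = {v. v < nvar \<sigma> ''n'' \<and> narr \<sigma> ''node'' v \<noteq> 0} \<and>
    \<phi> = 300 * length rs + 400 * weight \<sigma> V K)"

lemma tab_mem_agree: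
  assumes "agree L \<sigma> \<sigma>'" "L \<inter> {NV ''lim'', NA ''tab'', NA ''rank'', NA ''item'', NA ''node''} = {}"
  shows "tab_mem \<sigma>' I \<longleftrightarrow> tab_mem \<sigma> I"
  using assms(2) unfolding tab_mem_def by (simp add: agreeD[OF assms(1)])

lemma lim_bounded_agree:
  assumes "agree L \<sigma> \<sigma>'" "L \<inter> {NV ''lim'', NA ''rank'', NV ''cnt''} = {}"
  shows "lim_bounded \<sigma>' V \<longleftrightarrow> lim_bounded \<sigma> V"
  using assms(2) unfolding lim_bounded_def by (simp add: agreeD[OF assms(1)])

lemma exec_heap_push:
  "exec heap_push \<sigma> (\<lambda>k \<sigma>'. k \<le> 60 \<and>
    (let q = Suc (nvar \<sigma> ''cnt''); v = nvar \<sigma> ''v''; x = rvar \<sigma> ''x''; nxt = narr \<sigma> ''nxt'';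
         p = narr \<sigma> ''node'' v; c = nxt (narr \<sigma> ''kid'' p); steal = narr \<sigma> ''rank'' p > 1 in
      nvar \<sigma>' ''cnt'' = q \<and> nvar \<sigma>' ''roots'' = q \<and>
      narr \<sigma>' ''item'' = (narr \<sigma> ''item'')(q := v) \<and>
      rarr \<sigma>' ''key'' = (rarr \<sigma> ''key'')(q := x) \<and>
      rarr \<sigma>' ''d'' = (rarr \<sigma> ''d'')(v := x) \<and>
      narr \<sigma>' ''node'' = (narr \<sigma> ''node'')(v := q) \<and>
      narr \<sigma>' ''rank'' = (narr \<sigma> ''rank'')(q := narr \<sigma> ''rank'' p - 2) \<and>
      narr \<sigma>' ''kid'' = (narr \<sigma> ''kid'')(q := if steal then nxt c else 0) \<and>
      narr \<sigma>' ''nxt'' = (if steal then nxt(c := 0) else nxt)(q := nvar \<sigma> ''roots'')))"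
  by (simp add: heap_push_def Let_def numeral_2_eq_2)

text \<open>The amortised cost 1560 consists of 60 steps, 300 credits for the new root, and 3 * 400
  for the hollow weight that a key decrease can create.\<close>

lemma heap_push:
  assumes inv: "heap_inv M \<sigma> Q (Suc j) \<phi>"
    and v: "nvar \<sigma> ''v'' < nvar \<sigma> ''n''"
    and x: "rvar \<sigma> ''x'' < rarr \<sigma> ''d'' (nvar \<sigma> ''v'')"
  shows "exec heap_push \<sigma> (\<lambda>k \<sigma>'. \<exists>\<phi>'. k + \<phi>' \<le> \<phi> + 1560 \<and>
    rarr \<sigma>' ''d'' = (rarr \<sigma> ''d'')(nvar \<sigma> ''v'' := rvar \<sigma> ''x'') \<and>
    heap_inv M \<sigma>' (insert (nvar \<sigma> ''v'') Q) j \<phi>')"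
proof -
  define q v x nxt kid rank p c where defs: "q = Suc (nvar \<sigma> ''cnt'')" "v = nvar \<sigma> ''v''"
    "x = rvar \<sigma> ''x''" "nxt = narr \<sigma> ''nxt''" "kid = narr \<sigma> ''kid''" "rank = narr \<sigma> ''rank''"
    "p = narr \<sigma> ''node'' v" "c = nxt (kid p)"
  obtain V K rs where mem: "heap_mem \<sigma> V (set rs) K"
    and roots: "chain nxt (nvar \<sigma> ''roots'') rs" "distinct rs"
    and rest: "tab_mem \<sigma> {}" "lim_bounded \<sigma> V" "nvar \<sigma> ''cnt'' + Suc j \<le> M"
      "Q = {v. v < nvar \<sigma> ''n'' \<and> narr \<sigma> ''node'' v \<noteq> 0}"
      "\<phi> = 300 * length rs + 400 * weight \<sigma> V K"
    using inv unfolding heap_inv_def defs by auto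
  have heap: "hheap (nvar \<sigma> ''n'') (nvar \<sigma> ''cnt'') V (set rs) K rank (narr \<sigma> ''item'')
      (rarr \<sigma> ''key'') (narr \<sigma> ''node'') (rarr \<sigma> ''d'')"
    and kids: "\<And>u. u \<in> V \<Longrightarrow> chain nxt (kid u) (K u)" and rank0: "rank 0 = 0"
    using mem unfolding heap_mem_def defs by auto
  have q: "q \<notin> V" "q \<noteq> 0" using hheap_V[OF heap] unfolding defs by auto
  have qK: "q \<notin> set (K u)" if "u \<in> V" for u using hheap_K[OF heap that] q by auto
  have qrs: "q \<notin> set rs" using hheap_R[OF heap] q by auto
  define V' R' where "V' = insert q V" and "R' = insert q (set rs)"
  define K' where "K' = (if p = 0 then K(q := []) else K(p := take 2 (K p), q := drop 2 (K p)))"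
  define rank' where "rank' = rank(q := rank p - 2)"
  define item' where "item' = (narr \<sigma> ''item'')(q := v)"
  define node' where "node' = (narr \<sigma> ''node'')(v := q)"
  define kid' where "kid' = kid(q := if rank p > 1 then nxt c else 0)"
  define nxt' where "nxt' = (if rank p > 1 then nxt(c := 0) else nxt)(q := nvar \<sigma> ''roots'')"
  have heap': "hheap (nvar \<sigma> ''n'') q V' R' K' rank' item' ((rarr \<sigma> ''key'')(q := x)) node'
      ((rarr \<sigma> ''d'')(v := x))"
    and weight': "hollow_weight V' K' item' node' \<le> weight \<sigma> V K + 3"
  proof -
    have "hheap (nvar \<sigma> ''n'') q V' R' K' rank' item' ((rarr \<sigma> ''key'')(q := x)) node'
      ((rarr \<sigma> ''d'')(v := x)) \<and> hollow_weight V' K' item' node' \<le> weight \<sigma> V K + 3"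
    proof (cases "p = 0")
      case True
      have "v < nvar \<sigma> ''n''" "narr \<sigma> ''node'' v = 0" using v True unfolding defs by auto
      from hheap_push_new(1)[OF heap this, of x] hheap_push_new(2)[OF heap this] True rank0 show ?thesis
        unfolding V'_def R'_def K'_def rank'_def item'_def node'_def weight_def defs by simp
    next
      case False
      have "v < nvar \<sigma> ''n''" "narr \<sigma> ''node'' v = p" "x \<le> rarr \<sigma> ''d'' v"
        using v x unfolding defs by auto
      from hheap_decrease[OF heap this(1,2) False this(3)] False show ?thesis
        unfolding V'_def R'_def K'_def rank'_def item'_def node'_def weight_def defs by simp
    qed
    then show "hheap (nvar \<sigma> ''n'') q V' R' K' rank' item' ((rarr \<sigma> ''key'')(q := x)) node'
      ((rarr \<sigma> ''d'')(v := x))" "hollow_weight V' K' item' node' \<le> weight \<sigma> V K + 3" by auto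
  qed
  have p: "p \<in> V \<and> length (K p) = rank p" if "p \<noteq> 0"
  proof -
    have "v < nvar \<sigma> ''n''" "narr \<sigma> ''node'' v \<noteq> 0" using that v unfolding defs by auto
    from hheap_node[OF heap this] hheap_full[OF heap, of p] show ?thesis unfolding defs(7) by simp
  qed
  have chains: "(\<forall>u\<in>V'. chain nxt' (kid' u) (K' u)) \<and> chain nxt' q (q # rs)"
  proof (cases "rank p > 1")
    case False
    \<comment> \<open>With rank at most 1 the list of \<open>p\<close> has at most one entry, so
      splitting it after two leaves \<open>p\<close> unchanged and \<open>q\<close> without
      children, as in the branch of the code that takes over nothing.\<close>
    have "take 2 (K p) = K p \<and> drop 2 (K p) = []" if "p \<noteq> 0" using p[OF that] False by simp
    then have "K' = K(q := [])" unfolding K'_def by auto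
    then show ?thesis
      using False kids q qK qrs roots
      unfolding V'_def kid'_def nxt'_def by (auto simp: chain_upd)
  next
    case True
    then have "p \<noteq> 0" using rank0 by (cases p) auto
    with p have pV: "p \<in> V" and len: "length (K p) = rank p" by auto
    \<comment> \<open>A full node has as many children as its rank, here at least two. The register
      \<open>c\<close> points to \<open>b\<close>; setting its successor to 0 leaves
      \<open>[a, b]\<close> to \<open>p\<close>, while the rest \<open>us\<close> becomes the list
      of \<open>q\<close>.\<close>
    then obtain a b us where Kp: "K p = a # b # us"
      using True by (cases "K p"; cases "tl (K p)") auto
    have ch: "kid p = a" "nxt a = b" "a \<noteq> 0" "b \<noteq> 0" "chain nxt (nxt b) us"
      using kids[OF pV] Kp by auto
    have c: "c = b" unfolding defs(8) ch(1,2) ..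
    have ab: "a \<noteq> b" "b \<notin> set us" using hheap_distinct[OF heap pV] Kp by auto
    have qab: "q \<noteq> a" "q \<noteq> b" "q \<notin> set us" using qK[OF pV] Kp by auto
    have brs: "b \<notin> set rs" using hheap_K[OF heap pV] Kp by auto
    have bK: "b \<notin> set (K u)" if "u \<in> V" "u \<noteq> p" for u
      using hheap_disj[OF heap that(1) pV that(2)] Kp by auto
    have nxt': "nxt' = nxt(b := 0, q := nvar \<sigma> ''roots'')" unfolding nxt'_def c using True by simp
    have K': "K' = K(p := [a, b], q := us)" unfolding K'_def using \<open>p \<noteq> 0\<close> Kp by simp
    have kid': "kid' = kid(q := nxt b)" unfolding kid'_def c using True by simp
    have "chain nxt' (kid' u) (K' u)" if u: "u \<in> V'" for u
    proof -
      consider "u = q" | "u = p" | "u \<in> V" "u \<noteq> p" "u \<noteq> q" using u unfolding V'_def by auto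
      then show ?thesis
      proof cases
        case 1
        then show ?thesis using ch ab qab by (simp add: K' nxt' kid' chain_upd)
      next
        case 2
        then have "u \<noteq> q" using pV q by auto
        then show ?thesis using 2 ch ab qab by (simp add: K' nxt' kid')
      next
        case 3
        then show ?thesis using kids[OF 3(1)] bK[OF 3(1,2)] qK[OF 3(1)]
          by (simp add: K' nxt' kid' chain_upd)
      qed
    qed
    moreover have "chain nxt' q (q # rs)" using q qrs brs roots by (simp add: nxt' chain_upd)
    ultimately show ?thesis by blast
  qed
  show ?thesis
  proof (rule exec_agree[OF exec_heap_push], goal_cases)
    case (1 k \<sigma>')
    from 1(1) have k: "k \<le> 60" and new: "nvar \<sigma>' ''cnt'' = q" "nvar \<sigma>' ''roots'' = q"
      "narr \<sigma>' ''item'' = item'" "rarr \<sigma>' ''key'' = (rarr \<sigma> ''key'')(q := x)"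
      "rarr \<sigma>' ''d'' = (rarr \<sigma> ''d'')(v := x)" "narr \<sigma>' ''node'' = node'"
      "narr \<sigma>' ''rank'' = rank'" "narr \<sigma>' ''kid'' = kid'" "narr \<sigma>' ''nxt'' = nxt'"
      by (simp_all add: Let_def defs item'_def node'_def rank'_def kid'_def nxt'_def)
    note ag = 1(2)
    have same: "nvar \<sigma>' ''n'' = nvar \<sigma> ''n''" "nvar \<sigma>' ''lim'' = nvar \<sigma> ''lim''"
      "narr \<sigma>' ''tab'' = narr \<sigma> ''tab''"
      by (simp_all add: agreeD[OF ag] heap_push_def)
    have "heap_inv M \<sigma>' (insert v Q) j (300 * length (q # rs) + 400 * weight \<sigma>' V' K')"
      unfolding heap_inv_def
    proof (intro exI[of _ V'] exI[of _ K'] exI[of _ "q # rs"] conjI)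
      show "heap_mem \<sigma>' V' (set (q # rs)) K'"
        using heap' chains rank0 q unfolding heap_mem_def new same R'_def by (simp add: rank'_def)
      show "tab_mem \<sigma>' {}" using rest(1) unfolding tab_mem_def same by auto
      show "lim_bounded \<sigma>' V'"
        using rest(2) p rank0 unfolding lim_bounded_def new same rank'_def V'_def
        by (cases "p = 0") (auto simp: defs(1,6) intro: order_trans[OF diff_le_self])
      show "insert v Q = {v. v < nvar \<sigma>' ''n'' \<and> narr \<sigma>' ''node'' v \<noteq> 0}"
        unfolding new same rest(4) node'_def using q v by (auto simp: defs)
    qed (use chains rest roots qrs in \<open>auto simp: new defs\<close>)
    moreover have "weight \<sigma>' V' K' \<le> weight \<sigma> V K + 3" using weight' unfolding weight_def new .
    ultimately show ?case
      using k rest(5) new(5) unfolding defs by (intro exI conjI) auto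
  qed
qed

lemma exec_heap_link:
  "exec heap_link \<sigma> (\<lambda>k \<sigma>'. k \<le> 40 \<and>
    (let r = nvar \<sigma> ''r''; p = nvar \<sigma> ''p''; t = narr \<sigma> ''tab'' r; key = rarr \<sigma> ''key'';
         p' = (if key t < key p then t else p); t' = (if key t < key p then p else t) in
      nvar \<sigma>' ''p'' = p' \<and> nvar \<sigma>' ''r'' = Suc r \<and>
      narr \<sigma>' ''tab'' = (narr \<sigma> ''tab'')(r := 0) \<and>
      narr \<sigma>' ''nxt'' = (narr \<sigma> ''nxt'')(t' := narr \<sigma> ''kid'' p') \<and>
      narr \<sigma>' ''kid'' = (narr \<sigma> ''kid'')(p' := t') \<and>
      narr \<sigma>' ''rank'' = (narr \<sigma> ''rank'')(p' := Suc r)))"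
  by (simp add: heap_link_def Let_def)

text \<open>During consolidation the roots are spread over three places: the list \<open>rs\<close>
  still to be processed, the table cells with indices in \<open>I\<close>, and a set
  \<open>X\<close> outside both, namely the root being placed or the children of a destroyed node
  that still await insertion into the list.\<close>

definition heap_work ::
    "state \<Rightarrow> nat set \<Rightarrow> nat set \<Rightarrow> nat list \<Rightarrow> nat set \<Rightarrow> (nat \<Rightarrow> nat list) \<Rightarrow> bool" where
  "heap_work \<sigma> V X rs I K \<longleftrightarrow>
    heap_mem \<sigma> V (X \<union> set rs \<union> narr \<sigma> ''tab'' ` I) K \<and>
    X \<inter> (set rs \<union> narr \<sigma> ''tab'' ` I) = {} \<and> set rs \<inter> narr \<sigma> ''tab'' ` I = {} \<and>
    chain (narr \<sigma> ''nxt'') (nvar \<sigma> ''roots'') rs \<and> distinct rs \<and>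
    tab_mem \<sigma> I \<and> lim_bounded \<sigma> V"

definition heap_locs :: "loc set" where
  "heap_locs = {NV ''n'', NV ''cnt'', NV ''lim'', NV ''roots'', NA ''rank'', NA ''item'', NA ''node'',
    NA ''kid'', NA ''nxt'', NA ''tab'', RA ''key'', RA ''d''}"

lemma heap_agree:
  assumes "agree L \<sigma> \<sigma>'" "L \<inter> heap_locs = {}"
  shows heap_work_agree: "heap_work \<sigma>' V X rs I K \<longleftrightarrow> heap_work \<sigma> V X rs I K"
    and heap_inv_agree: "heap_inv M \<sigma>' Q j \<phi> \<longleftrightarrow> heap_inv M \<sigma> Q j \<phi>"
    and weight_agree: "weight \<sigma>' V K = weight \<sigma> V K"
  using assms(2)
  unfolding heap_locs_def heap_inv_def heap_work_def heap_mem_def weight_def tab_mem_def lim_bounded_def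
  by (simp_all add: agreeD[OF assms(1)])

text \<open>The root with the smaller key stays in hand as the new \<open>p\<close>, with rank one
  higher, and the other disappears below it. Cell r is vacated, and its credit will pay for the
  link.\<close>

lemma heap_link:
  assumes work: "heap_work \<sigma> V {nvar \<sigma> ''p''} rs I K"
    and full: "narr \<sigma> ''node'' (narr \<sigma> ''item'' (nvar \<sigma> ''p'')) = nvar \<sigma> ''p''"
    and rank: "narr \<sigma> ''rank'' (nvar \<sigma> ''p'') = nvar \<sigma> ''r''"
    and I: "nvar \<sigma> ''r'' \<in> I"
  shows "exec heap_link \<sigma> (\<lambda>k \<sigma>'. k \<le> 40 \<and> (\<exists>K'. heap_work \<sigma>' V {nvar \<sigma>' ''p''} rs (I - {nvar \<sigma> ''r''}) K' \<and>
    narr \<sigma>' ''node'' (narr \<sigma>' ''item'' (nvar \<sigma>' ''p'')) = nvar \<sigma>' ''p'' \<and>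
    narr \<sigma>' ''rank'' (nvar \<sigma>' ''p'') = nvar \<sigma>' ''r'' \<and> weight \<sigma>' V K' = weight \<sigma> V K))"
proof -
  define r p key tab where defs: "r = nvar \<sigma> ''r''" "p = nvar \<sigma> ''p''" "key = rarr \<sigma> ''key''"
    "tab = narr \<sigma> ''tab''"
  define t where "t = tab r"
  define p' t' where p't': "p' = (if key t < key p then t else p)" "t' = (if key t < key p then p else t)"
  define R where "R = {p} \<union> set rs \<union> tab ` I"
  from work have heap: "hheap (nvar \<sigma> ''n'') (nvar \<sigma> ''cnt'') V R K (narr \<sigma> ''rank'')
      (narr \<sigma> ''item'') key (narr \<sigma> ''node'') (rarr \<sigma> ''d'')"
    and kids: "\<And>u. u \<in> V \<Longrightarrow> chain (narr \<sigma> ''nxt'') (narr \<sigma> ''kid'' u) (K u)"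
    and rank0: "narr \<sigma> ''rank'' 0 = 0"
    and disj: "p \<notin> set rs" "p \<notin> tab ` I" "set rs \<inter> tab ` I = {}"
    and roots: "chain (narr \<sigma> ''nxt'') (nvar \<sigma> ''roots'') rs" "distinct rs"
    and tab: "tab_mem \<sigma> I" and lim: "lim_bounded \<sigma> V"
    unfolding heap_work_def heap_mem_def defs R_def by auto
  have tabI: "I = {r. r < nvar \<sigma> ''lim'' \<and> tab r \<noteq> 0}"
    and tab_rank: "\<And>i. i \<in> I \<Longrightarrow> narr \<sigma> ''rank'' (tab i) = i"
    and tab_full: "\<And>i. i \<in> I \<Longrightarrow> narr \<sigma> ''node'' (narr \<sigma> ''item'' (tab i)) = tab i"
    using tab unfolding tab_mem_def defs by auto
  have rI: "r \<in> I" using I unfolding defs .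
  \<comment> \<open>The index of a cell is the rank of its entry, so different cells hold different
    roots.\<close>
  have tab_other: "tab i \<noteq> t" "tab i \<noteq> p" if "i \<in> I" "i \<noteq> r" for i
    using that tab_rank[of i] tab_rank[OF rI] disj unfolding t_def by auto
  have tR: "t \<in> R" "t \<noteq> p" "t \<notin> set rs" using rI disj unfolding R_def t_def by auto
  have pR: "p \<in> R" unfolding R_def by simp
  have p't'R: "p' \<in> R" "t' \<in> R" "p' \<noteq> t'" "narr \<sigma> ''rank'' p' = narr \<sigma> ''rank'' t'"
    "narr \<sigma> ''node'' (narr \<sigma> ''item'' p') = p'" "key p' \<le> key t'"
    using tR pR rank tab_rank[OF rI] full tab_full[OF rI] unfolding p't' t_def defs by auto
  define K' where "K' = K(p' := t' # K p')"
  have rank_p': "narr \<sigma> ''rank'' p' = r" using rank tab_rank[OF rI] unfolding p't' t_def defs by auto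
  have "p' \<in> V" "t' \<in> V" using p't'R hheap_R[OF heap] by auto
  with hheap_zero[OF heap] have V: "p' \<in> V" "t' \<in> V" "p' \<noteq> 0" "t' \<noteq> 0" by metis+
  have heap': "hheap (nvar \<sigma> ''n'') (nvar \<sigma> ''cnt'') V (R - {t'}) K' ((narr \<sigma> ''rank'')(p' := Suc r))
      (narr \<sigma> ''item'') key (narr \<sigma> ''node'') (rarr \<sigma> ''d'')"
    using hheap_link[OF heap p't'R] unfolding K'_def rank_p' .
  have "tab(r := 0) ` (I - {r}) = tab ` (I - {r})" by auto
  moreover have "R = {p, t} \<union> set rs \<union> tab ` (I - {r})" unfolding R_def t_def using rI by auto
  moreover have "t \<notin> tab ` (I - {r})" "p \<notin> tab ` (I - {r})" using tab_other by auto
  ultimately have R': "R - {t'} = {p'} \<union> set rs \<union> tab(r := 0) ` (I - {r})"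
    and disj': "p' \<notin> set rs \<union> tab(r := 0) ` (I - {r})" "set rs \<inter> tab(r := 0) ` (I - {r}) = {}"
    using tR disj unfolding p't' by (auto split: if_splits)
  have t'K: "t' \<notin> set (K u)" if "u \<in> V" for u using hheap_K[OF heap that] p't'R by auto
  have t'rs: "t' \<notin> set rs" using tR disj unfolding p't' by auto
  show ?thesis
  proof (rule exec_agree[OF exec_heap_link], goal_cases)
    case (1 k \<sigma>')
    from 1(1) have k: "k \<le> 40" and new: "nvar \<sigma>' ''p'' = p'" "nvar \<sigma>' ''r'' = Suc r"
      "narr \<sigma>' ''tab'' = tab(r := 0)" "narr \<sigma>' ''nxt'' = (narr \<sigma> ''nxt'')(t' := narr \<sigma> ''kid'' p')"
      "narr \<sigma>' ''kid'' = (narr \<sigma> ''kid'')(p' := t')" "narr \<sigma>' ''rank'' = (narr \<sigma> ''rank'')(p' := Suc r)"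
      unfolding Let_def p't' t_def defs by simp_all
    note ag = 1(2)
    have same: "nvar \<sigma>' ''n'' = nvar \<sigma> ''n''" "nvar \<sigma>' ''lim'' = nvar \<sigma> ''lim''"
      "nvar \<sigma>' ''cnt'' = nvar \<sigma> ''cnt''" "nvar \<sigma>' ''roots'' = nvar \<sigma> ''roots''"
      "narr \<sigma>' ''item'' = narr \<sigma> ''item''" "narr \<sigma>' ''node'' = narr \<sigma> ''node''"
      "rarr \<sigma>' ''key'' = key" "rarr \<sigma>' ''d'' = rarr \<sigma> ''d''"
      by (simp_all add: agreeD[OF ag] heap_link_def defs)
    have "chain (narr \<sigma>' ''nxt'') (narr \<sigma>' ''kid'' u) (K' u)" if "u \<in> V" for u
      using kids[OF that] kids[OF V(1)] t'K[OF that] t'K[OF V(1)] V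
      unfolding new K'_def by (auto simp: chain_upd)
    then have mem': "heap_mem \<sigma>' V ({p'} \<union> set rs \<union> narr \<sigma>' ''tab'' ` (I - {r})) K'"
      using heap' R' rank0 V unfolding heap_mem_def same new by simp
    have tab': "tab_mem \<sigma>' (I - {r})"
      using tab_rank tab_full tab_other unfolding tab_mem_def new same tabI p't' by auto
    have lim': "lim_bounded \<sigma>' V"
      using lim rI unfolding lim_bounded_def same new tabI by auto
    have "heap_work \<sigma>' V {p'} rs (I - {r}) K'"
      unfolding heap_work_def
      using mem' tab' lim' disj' roots t'rs unfolding new(3,4) same by (auto simp: chain_upd)
    \<comment> \<open>Only the children of \<open>p'\<close> change, and \<open>p'\<close> is full,
      so it does not contribute to the weight.\<close>
    moreover have "weight \<sigma>' V K' = weight \<sigma> V K"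
      unfolding weight_def hollow_weight_def same K'_def
      using p't'R by (intro sum.cong) auto
    ultimately show ?case
      using k p't'R(5) unfolding new same defs(1)[symmetric] by auto
  qed
qed

lemma exec_SeqI:
  assumes "exec c \<sigma> Q'" "\<And>k \<sigma>'. Q' k \<sigma>' \<Longrightarrow> agree (writes c) \<sigma> \<sigma>' \<Longrightarrow> exec d \<sigma>' (\<lambda>l. Q (k + l))"
  shows "exec (Seq c d) \<sigma> Q"
  unfolding exec_Seq_iff by (rule exec_agree[OF assms(1)]) (rule assms(2))

lemma finite_tab: "tab_mem \<sigma> I \<Longrightarrow> finite I"
  unfolding tab_mem_def by auto

text \<open>Amortisation of a binary counter: each occupied cell holds 100 credits, which pay for
  the iteration that empties it. The allowance of 200 covers the remaining steps and the 100 credits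
  of the cell filled at the end.\<close>

lemma heap_place:
  assumes work: "heap_work \<sigma> V {nvar \<sigma> ''p''} rs I K"
    and full: "narr \<sigma> ''node'' (narr \<sigma> ''item'' (nvar \<sigma> ''p'')) = nvar \<sigma> ''p''"
  shows "exec heap_place \<sigma> (\<lambda>k \<sigma>'. \<exists>I' K'. heap_work \<sigma>' V {} rs I' K' \<and>
    weight \<sigma>' V K' = weight \<sigma> V K \<and> k + 100 * card I' \<le> 100 * card I + 200)"
    (is "exec _ _ ?post")
proof -
  define \<sigma>1 where "\<sigma>1 = \<sigma>\<lparr>nvar := (nvar \<sigma>)(''r'' := narr \<sigma> ''rank'' (nvar \<sigma> ''p''))\<rparr>"
  have 1: "heap_work \<sigma>1 V {nvar \<sigma>1 ''p''} rs I K" "weight \<sigma>1 V K = weight \<sigma> V K"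
    "narr \<sigma>1 ''node'' (narr \<sigma>1 ''item'' (nvar \<sigma>1 ''p'')) = nvar \<sigma>1 ''p''"
    "narr \<sigma>1 ''rank'' (nvar \<sigma>1 ''p'') = nvar \<sigma>1 ''r''"
  proof -
    have ag: "agree {NV ''r''} \<sigma> \<sigma>1" by (simp add: agree_def \<sigma>1_def)
    show "heap_work \<sigma>1 V {nvar \<sigma>1 ''p''} rs I K" "weight \<sigma>1 V K = weight \<sigma> V K"
      using work by (simp_all add: heap_agree[OF ag] heap_locs_def) (simp add: \<sigma>1_def)
  qed (use full in \<open>simp_all add: \<sigma>1_def\<close>)
  define Inv where "Inv \<tau> \<phi> \<longleftrightarrow> (\<exists>I' K'. heap_work \<tau> V {nvar \<tau> ''p''} rs I' K' \<and>
      narr \<tau> ''node'' (narr \<tau> ''item'' (nvar \<tau> ''p'')) = nvar \<tau> ''p'' \<and>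
      narr \<tau> ''rank'' (nvar \<tau> ''p'') = nvar \<tau> ''r'' \<and>
      weight \<tau> V K' = weight \<sigma> V K \<and> \<phi> = 100 * card I')" for \<tau> \<phi>
  let ?b = "Conj (NLess (NVar ''r'') (NVar ''lim'')) (NLess (NConst 0) (NGet ''tab'' (NVar ''r'')))"
  let ?loop = "While ?b heap_link"
  let ?tail = "Seq (Cond (NLess (NVar ''r'') (NVar ''lim'')) Skip (NAssign ''lim'' (Inc (NVar ''lim''))))
      (NPut ''tab'' (NVar ''r'') (NVar ''p''))"
  have loop: "exec ?loop \<sigma>1 (\<lambda>k \<tau>. \<exists>\<phi>'. Inv \<tau> \<phi>' \<and> \<not> bval ?b \<tau> \<and> k + \<phi>' \<le> 100 * card I + bcost ?b + 1)"
  proof (rule exec_While[where I = Inv])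
    show "Inv \<sigma>1 (100 * card I)" unfolding Inv_def using 1 by blast
    show "exec heap_link \<tau> (\<lambda>k \<tau>'. \<exists>\<phi>'. Inv \<tau>' \<phi>' \<and> k + bcost ?b + 1 + \<phi>' \<le> \<phi>)"
      if "Inv \<tau> \<phi>" "bval ?b \<tau>" for \<tau> \<phi>
    proof -
      obtain I' K' where IK: "heap_work \<tau> V {nvar \<tau> ''p''} rs I' K'"
        "narr \<tau> ''node'' (narr \<tau> ''item'' (nvar \<tau> ''p'')) = nvar \<tau> ''p''"
        "narr \<tau> ''rank'' (nvar \<tau> ''p'') = nvar \<tau> ''r''"
        "weight \<tau> V K' = weight \<sigma> V K" "\<phi> = 100 * card I'"
        using \<open>Inv \<tau> \<phi>\<close> unfolding Inv_def by blast
      have tab: "tab_mem \<tau> I'" using IK(1) unfolding heap_work_def by blast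
      then have r: "nvar \<tau> ''r'' \<in> I'" using \<open>bval ?b \<tau>\<close> unfolding tab_mem_def by simp
      then have "card I' = Suc (card (I' - {nvar \<tau> ''r''}))"
        using finite_tab[OF tab] by (simp only: card_Suc_Diff1)
      then show ?thesis
        using IK(4,5)
        by (intro exec_mono[OF heap_link[OF IK(1,2,3) r]] exI[of _ "100 * card (I' - {nvar \<tau> ''r''})"])
          (auto simp: Inv_def intro!: exI[of _ "I' - {nvar \<tau> ''r''}"])
    qed
  qed blast
  show ?thesis
    unfolding heap_place_def
  proof (rule exec_SeqI[where Q' = "\<lambda>k \<tau>. k = 3 \<and> \<tau> = \<sigma>1"])
    show "exec (NAssign ''r'' (NGet ''rank'' (NVar ''p''))) \<sigma> (\<lambda>k \<tau>. k = 3 \<and> \<tau> = \<sigma>1)"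
      by (simp add: \<sigma>1_def)
    fix k0 :: nat and \<tau>0 :: state assume k0: "k0 = 3 \<and> \<tau>0 = \<sigma>1"
    show "exec (Seq ?loop ?tail) \<tau>0 (\<lambda>l. ?post (k0 + l))"
      unfolding conjunct2[OF k0] conjunct1[OF k0]
    proof (rule exec_SeqI[OF loop])
      fix k :: nat and \<tau> :: state assume "\<exists>\<phi>'. Inv \<tau> \<phi>' \<and> \<not> bval ?b \<tau> \<and> k + \<phi>' \<le> 100 * card I + bcost ?b + 1"
      then obtain I' K' where IK: "heap_work \<tau> V {nvar \<tau> ''p''} rs I' K'"
        "narr \<tau> ''node'' (narr \<tau> ''item'' (nvar \<tau> ''p'')) = nvar \<tau> ''p''"
        "narr \<tau> ''rank'' (nvar \<tau> ''p'') = nvar \<tau> ''r''"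
        "weight \<tau> V K' = weight \<sigma> V K" and r: "\<not> bval ?b \<tau>" and k: "k + 100 * card I' \<le> 100 * card I + 9"
        unfolding Inv_def by auto
      define p r tab lim where defs: "p = nvar \<tau> ''p''" "r = nvar \<tau> ''r''" "tab = narr \<tau> ''tab''"
        "lim = nvar \<tau> ''lim''"
      have I': "I' = {i. i < lim \<and> tab i \<noteq> 0}" and mem: "heap_mem \<tau> V (insert p (set rs) \<union> tab ` I') K'"
        and lims: "lim_bounded \<tau> V" and tabm: "tab_mem \<tau> I'"
        using IK(1) unfolding heap_work_def tab_mem_def defs by auto
      have rI: "r \<notin> I'" using r unfolding I' defs by simp
      have heap: "hheap (nvar \<tau> ''n'') (nvar \<tau> ''cnt'') V (insert p (set rs) \<union> tab ` I') K' (narr \<tau> ''rank'')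
          (narr \<tau> ''item'') (rarr \<tau> ''key'') (narr \<tau> ''node'') (rarr \<tau> ''d'')"
        using mem unfolding heap_mem_def by simp
      have p: "p \<in> V" "p \<noteq> 0" using hheap_R[OF heap] hheap_zero[OF heap] by auto
      have r_le: "r \<le> lim" using lims p(1) IK(3) unfolding lim_bounded_def defs by auto
      have img: "tab(r := p) ` insert r I' = insert p (tab ` I')" using rI by auto
      \<comment> \<open>This restores the logarithmic bound if \<open>lim\<close> is raised: that
        happens only for \<open>r = lim\<close>, and then r is the new
        \<open>lim - 1\<close>.\<close>
      have "2 ^ (r div 2) \<le> card V" using hheap_rank_bound[OF heap p(1)] IK(3) unfolding defs by simp
      also have "\<dots> \<le> nvar \<tau> ''cnt''" using card_mono[OF _ hheap_V[OF heap]] by simp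
      finally have bound: "2 ^ (r div 2) \<le> nvar \<tau> ''cnt''" .
      have tail: "exec ?tail \<tau> (\<lambda>l \<sigma>'. l \<le> 20 \<and> narr \<sigma>' ''tab'' = tab(r := p) \<and>
          nvar \<sigma>' ''lim'' = (if r < lim then lim else Suc lim))"
        by (simp add: defs)
      show "exec ?tail \<tau> (\<lambda>l. ?post (3 + (k + l)))"
      proof (rule exec_agree[OF tail])
        fix l :: nat and \<sigma>' :: state
        assume "l \<le> 20 \<and> narr \<sigma>' ''tab'' = tab(r := p) \<and> nvar \<sigma>' ''lim'' = (if r < lim then lim else Suc lim)"
        then have l: "l \<le> 20" and new: "narr \<sigma>' ''tab'' = tab(r := p)"
          "nvar \<sigma>' ''lim'' = (if r < lim then lim else Suc lim)" by auto
        assume ag: "agree (writes ?tail) \<tau> \<sigma>'"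
        have same: "nvar \<sigma>' ''n'' = nvar \<tau> ''n''" "nvar \<sigma>' ''cnt'' = nvar \<tau> ''cnt''"
          "nvar \<sigma>' ''roots'' = nvar \<tau> ''roots''" "narr \<sigma>' ''nxt'' = narr \<tau> ''nxt''"
          "narr \<sigma>' ''kid'' = narr \<tau> ''kid''" "narr \<sigma>' ''rank'' = narr \<tau> ''rank''"
          "narr \<sigma>' ''item'' = narr \<tau> ''item''" "narr \<sigma>' ''node'' = narr \<tau> ''node''"
          "rarr \<sigma>' ''key'' = rarr \<tau> ''key''" "rarr \<sigma>' ''d'' = rarr \<tau> ''d''"
          by (simp_all add: agreeD[OF ag])
        have "tab_mem \<sigma>' (insert r I')"
          using tabm r_le rI IK(2,3) p unfolding tab_mem_def new same I' by (auto simp: defs)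
        moreover have "lim_bounded \<sigma>' V"
          using lims bound r_le unfolding lim_bounded_def new same by (auto simp: defs)
        moreover have "heap_mem \<sigma>' V ({} \<union> set rs \<union> narr \<sigma>' ''tab'' ` insert r I') K'"
          using mem unfolding heap_mem_def new(1) same img by (simp add: Un_commute)
        ultimately have "heap_work \<sigma>' V {} rs (insert r I') K'"
          using IK(1) unfolding heap_work_def same new(1) img by (simp add: defs)
        moreover have "weight \<sigma>' V K' = weight \<sigma> V K" using IK(4) unfolding weight_def same .
        moreover have "card (insert r I') = Suc (card I')" using finite_tab[OF tabm] rI by simp
        ultimately show "?post (3 + (k + l)) \<sigma>'"
          using l k by (intro exI[of _ "insert r I'"] exI[of _ K']) simp
      qed
    qed
  qed
qed

text \<open>The weight drops by the number of children plus one. Of the 400 credits thus freed per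
  child, 300 go to the new root and 100 exceed the cost of moving it; the last 400 cover the
  constant overhead.\<close>

lemma heap_destroy:
  assumes work: "heap_work \<sigma> V {nvar \<sigma> ''p''} rs I K"
    and hollow: "narr \<sigma> ''node'' (narr \<sigma> ''item'' (nvar \<sigma> ''p'')) \<noteq> nvar \<sigma> ''p''"
  shows "exec heap_destroy \<sigma> (\<lambda>k \<sigma>'. \<exists>V' rs'. heap_work \<sigma>' V' {} rs' I K \<and>
    k + 300 * length rs' + 400 * weight \<sigma>' V' K \<le> 300 * length rs + 400 * weight \<sigma> V K)"
    (is "exec _ _ ?post")
proof -
  define p where "p = nvar \<sigma> ''p''"
  define V' where "V' = V - {p}"
  define tab where "tab = narr \<sigma> ''tab''"
  have heap: "hheap (nvar \<sigma> ''n'') (nvar \<sigma> ''cnt'') V (insert p (set rs) \<union> tab ` I) K (narr \<sigma> ''rank'')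
      (narr \<sigma> ''item'') (rarr \<sigma> ''key'') (narr \<sigma> ''node'') (rarr \<sigma> ''d'')"
    and kids: "\<And>u. u \<in> V \<Longrightarrow> chain (narr \<sigma> ''nxt'') (narr \<sigma> ''kid'' u) (K u)"
    and rank0: "narr \<sigma> ''rank'' 0 = 0"
    and disj: "p \<notin> set rs" "p \<notin> tab ` I" "set rs \<inter> tab ` I = {}"
    and roots: "chain (narr \<sigma> ''nxt'') (nvar \<sigma> ''roots'') rs" "distinct rs"
    and tabm: "tab_mem \<sigma> I" and lim: "lim_bounded \<sigma> V"
    using work unfolding heap_work_def heap_mem_def p_def tab_def by auto
  have pV: "p \<in> V" using hheap_R[OF heap] by auto
  note destroy = hheap_destroy[OF heap _ hollow[folded p_def]]
  have heap': "hheap (nvar \<sigma> ''n'') (nvar \<sigma> ''cnt'') V' (set (K p) \<union> set rs \<union> tab ` I) K (narr \<sigma> ''rank'')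
      (narr \<sigma> ''item'') (rarr \<sigma> ''key'') (narr \<sigma> ''node'') (rarr \<sigma> ''d'')"
  proof -
    have "insert p (set rs) \<union> tab ` I - {p} \<union> set (K p) = set (K p) \<union> set rs \<union> tab ` I" using disj by auto
    then show ?thesis using destroy(1) unfolding V'_def by simp
  qed
  have weight': "hollow_weight V' K (narr \<sigma> ''item'') (narr \<sigma> ''node'') + length (K p) + 1 = weight \<sigma> V K"
    using destroy(2) unfolding V'_def weight_def by simp
  have Kp: "set (K p) \<inter> (set rs \<union> tab ` I) = {}" using hheap_K[OF heap pV] by auto
  define \<sigma>1 where "\<sigma>1 = \<sigma>\<lparr>nvar := (nvar \<sigma>)(''c'' := narr \<sigma> ''kid'' p)\<rparr>"
  define Inv where "Inv \<tau> \<phi> \<longleftrightarrow> (\<exists>xs rs'. heap_work \<tau> V' (set xs) rs' I K \<and>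
      chain (narr \<tau> ''nxt'') (nvar \<tau> ''c'') xs \<and> distinct xs \<and>
      length xs + length rs' = length (K p) + length rs \<and> \<phi> = 50 * length xs)" for \<tau> \<phi>
  let ?b = "NLess (NConst 0) (NVar ''c'')"
  let ?body = "Seq (NAssign ''t'' (NGet ''nxt'' (NVar ''c'')))
        (Seq (NPut ''nxt'' (NVar ''c'') (NVar ''roots''))
        (Seq (NAssign ''roots'' (NVar ''c''))
          (NAssign ''c'' (NVar ''t''))))"
  have loop: "exec (While ?b ?body) \<sigma>1 (\<lambda>k \<tau>. (\<exists>\<phi>'. Inv \<tau> \<phi>' \<and> \<not> bval ?b \<tau> \<and>
      k + \<phi>' \<le> 50 * length (K p) + bcost ?b + 1) \<and> agree (writes ?body) \<sigma>1 \<tau>)"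
  proof (rule exec_While[where I = Inv])
    \<comment> \<open>The invariant is stated from the start for the nodes without \<open>p\<close>.
      Hence the list of \<open>p\<close> may be taken apart by redirecting its \<open>nxt\<close>
      pointers, while all remaining lists are disjoint from it.\<close>
    have "heap_mem \<sigma>1 V' (set (K p) \<union> set rs \<union> tab ` I) K"
      using heap' kids rank0 unfolding heap_mem_def \<sigma>1_def V'_def by simp
    moreover have "tab_mem \<sigma>1 I" "lim_bounded \<sigma>1 V'"
      using tabm lim unfolding tab_mem_def lim_bounded_def \<sigma>1_def V'_def by simp_all
    moreover have "narr \<sigma>1 = narr \<sigma>" "nvar \<sigma>1 ''roots'' = nvar \<sigma> ''roots''" "nvar \<sigma>1 ''c'' = narr \<sigma> ''kid'' p"
      by (simp_all add: \<sigma>1_def)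
    ultimately show "Inv \<sigma>1 (50 * length (K p))"
      unfolding Inv_def heap_work_def
      using roots disj Kp kids[OF pV] hheap_distinct[OF heap pV]
      by (intro exI[of _ "K p"] exI[of _ rs]) (auto simp: tab_def)
    show "exec ?body \<tau> (\<lambda>k \<tau>'. \<exists>\<phi>'. Inv \<tau>' \<phi>' \<and> k + bcost ?b + 1 + \<phi>' \<le> \<phi>)"
      if inv: "Inv \<tau> \<phi>" and b: "bval ?b \<tau>" for \<tau> \<phi>
    proof -
      define c where "c = nvar \<tau> ''c''"
      obtain xs rs' where work: "heap_work \<tau> V' (set xs) rs' I K"
        and xs: "chain (narr \<tau> ''nxt'') c xs" "distinct xs"
          "length xs + length rs' = length (K p) + length rs" "\<phi> = 50 * length xs"
        using inv unfolding Inv_def c_def by blast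
      obtain ys where ys: "xs = c # ys" "chain (narr \<tau> ''nxt'') (narr \<tau> ''nxt'' c) ys"
        using chain_nonempty[OF xs(1)] b unfolding c_def by auto
      define \<tau>' where "\<tau>' = \<tau>\<lparr>nvar := (nvar \<tau>)(''t'' := narr \<tau> ''nxt'' c, ''roots'' := c, ''c'' := narr \<tau> ''nxt'' c),
        narr := (narr \<tau>)(''nxt'' := (narr \<tau> ''nxt'')(c := nvar \<tau> ''roots''))\<rparr>"
      have cK: "c \<notin> set (K u)" if "u \<in> V'" for u
        using work that hheap_K unfolding heap_work_def heap_mem_def ys(1) by fastforce
      have eq: "set (c # ys) \<union> set rs' = set ys \<union> set (c # rs')" by auto
      have "heap_mem \<tau>' V' (set ys \<union> set (c # rs') \<union> narr \<tau>' ''tab'' ` I) K"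
        using work cK unfolding heap_work_def heap_mem_def ys(1) eq by (simp add: \<tau>'_def chain_upd)
      moreover have ag: "agree {NV ''t'', NV ''roots'', NV ''c'', NA ''nxt''} \<tau> \<tau>'"
        by (simp add: agree_def \<tau>'_def)
      have "tab_mem \<tau>' I" "lim_bounded \<tau>' V'"
        using work unfolding heap_work_def
        by (simp_all add: tab_mem_agree[OF ag] lim_bounded_agree[OF ag])
      moreover have "chain (narr \<tau>' ''nxt'') (nvar \<tau>' ''roots'') (c # rs')" "distinct (c # rs')"
        "set ys \<inter> (set (c # rs') \<union> narr \<tau>' ''tab'' ` I) = {}" "set (c # rs') \<inter> narr \<tau>' ''tab'' ` I = {}"
        using work xs unfolding heap_work_def ys(1) by (auto simp: \<tau>'_def chain_upd)
      moreover have "chain (narr \<tau>' ''nxt'') (nvar \<tau>' ''c'') ys"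
        using xs ys by (auto simp: \<tau>'_def chain_upd)
      ultimately have "Inv \<tau>' (50 * length ys)"
        unfolding Inv_def heap_work_def using xs ys by (intro exI[of _ ys] exI[of _ "c # rs'"]) auto
      moreover have "exec ?body \<tau> (\<lambda>k \<tau>''. k \<le> 20 \<and> \<tau>'' = \<tau>')"
        by (simp add: \<tau>'_def c_def)
      ultimately show ?thesis using xs(4) ys(1) by (auto elim!: exec_mono intro!: exI[of _ "50 * length ys"])
    qed
  qed auto
  show ?thesis
    unfolding heap_destroy_def
  proof (rule exec_SeqI[where Q' = "\<lambda>k \<tau>. k = 3 \<and> \<tau> = \<sigma>1"])
    show "exec (NAssign ''c'' (NGet ''kid'' (NVar ''p''))) \<sigma> (\<lambda>k \<tau>. k = 3 \<and> \<tau> = \<sigma>1)"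
      by (simp add: \<sigma>1_def p_def)
    fix k0 :: nat and \<tau>0 :: state assume k0: "k0 = 3 \<and> \<tau>0 = \<sigma>1"
    show "exec (While ?b ?body) \<tau>0 (\<lambda>l. ?post (k0 + l))"
      unfolding conjunct2[OF k0] conjunct1[OF k0]
    proof (rule exec_mono[OF loop], elim conjE exE)
      fix k :: nat and \<tau> :: state and \<phi>' :: nat
      assume inv: "Inv \<tau> \<phi>'" and b: "\<not> bval ?b \<tau>" and k: "k + \<phi>' \<le> 50 * length (K p) + bcost ?b + 1"
        and ag: "agree (writes ?body) \<sigma>1 \<tau>"
      obtain xs rs' where work: "heap_work \<tau> V' (set xs) rs' I K"
        and xs: "chain (narr \<tau> ''nxt'') (nvar \<tau> ''c'') xs"
          "length xs + length rs' = length (K p) + length rs"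
        using inv unfolding Inv_def by blast
      have "xs = []" using xs(1) b by (simp add: chain_empty)
      moreover have "weight \<tau> V' K + length (K p) + 1 = weight \<sigma> V K"
        using weight' unfolding weight_def by (simp add: agreeD[OF ag] \<sigma>1_def)
      ultimately show "?post (3 + k) \<tau>"
        using work xs(2) k by (intro exI[of _ V'] exI[of _ rs']) auto
    qed
  qed
qed

text \<open>The 300 credits of a processed root cover either the 200 of its placement or the
  overhead of its destruction, plus at most 50 steps of this loop; the destruction itself is paid
  from the hollow weight. Links consume the 100 credits of the cells that they empty.\<close>

lemma heap_consolidate:
  assumes "heap_work \<sigma> V {} rs I K"
  shows "exec heap_consolidate \<sigma> (\<lambda>k \<sigma>'. \<exists>V' I' K'. heap_work \<sigma>' V' {} [] I' K' \<and>
    k + 400 * weight \<sigma>' V' K' \<le> 300 * length rs + 100 * card I + 400 * weight \<sigma> V K + 4)"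
proof -
  define Inv where "Inv \<tau> \<phi> \<longleftrightarrow> (\<exists>V rs I K. heap_work \<tau> V {} rs I K \<and>
    \<phi> = 300 * length rs + 100 * card I + 400 * weight \<tau> V K)" for \<tau> \<phi>
  have InvI: "Inv \<tau> (300 * length rs + 100 * card I + 400 * weight \<tau> V K)" if "heap_work \<tau> V {} rs I K" for \<tau> V rs I K
    unfolding Inv_def using that by blast
  let ?b = "NLess (NConst 0) (NVar ''roots'')"
  let ?body = "Seq (NAssign ''p'' (NVar ''roots''))
      (Seq (NAssign ''roots'' (NGet ''nxt'' (NVar ''p'')))
      (Seq (NAssign ''c'' (NGet ''node'' (NGet ''item'' (NVar ''p''))))
        (Cond (Conj (Neg (NLess (NVar ''c'') (NVar ''p''))) (Neg (NLess (NVar ''p'') (NVar ''c''))))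
          heap_place heap_destroy)))"
  show ?thesis
    unfolding heap_consolidate_def
  proof (rule exec_While[where I = Inv])
    show "Inv \<sigma> (300 * length rs + 100 * card I + 400 * weight \<sigma> V K)"
      unfolding Inv_def using assms by blast
    show "exec ?body \<tau> (\<lambda>k \<tau>'. \<exists>\<phi>'. Inv \<tau>' \<phi>' \<and> k + bcost ?b + 1 + \<phi>' \<le> \<phi>)"
      if inv: "Inv \<tau> \<phi>" and b: "bval ?b \<tau>" for \<tau> \<phi>
    proof -
      obtain V rs I K where work: "heap_work \<tau> V {} rs I K"
        and \<phi>: "\<phi> = 300 * length rs + 100 * card I + 400 * weight \<tau> V K"
        using inv unfolding Inv_def by blast
      define p where "p = nvar \<tau> ''roots''"
      have "chain (narr \<tau> ''nxt'') p rs" using work unfolding heap_work_def p_def by blast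
      then obtain ps where rs: "rs = p # ps" and ps: "chain (narr \<tau> ''nxt'') (narr \<tau> ''nxt'' p) ps"
        using chain_nonempty b p_def by fastforce
      define c where "c = narr \<tau> ''node'' (narr \<tau> ''item'' p)"
      define \<tau>1 where "\<tau>1 = \<tau>\<lparr>nvar := (nvar \<tau>)(''p'' := p, ''roots'' := narr \<tau> ''nxt'' p, ''c'' := c)\<rparr>"
      have ag: "agree {NV ''p'', NV ''roots'', NV ''c''} \<tau> \<tau>1"
        by (simp add: agree_def \<tau>1_def)
      have p1: "nvar \<tau>1 ''p'' = p" "nvar \<tau>1 ''roots'' = narr \<tau> ''nxt'' p" "nvar \<tau>1 ''c'' = c"
        by (simp_all add: \<tau>1_def)
      have mem: "heap_mem \<tau> V ({p} \<union> set ps \<union> narr \<tau> ''tab'' ` I) K"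
        using work unfolding heap_work_def rs by simp
      have weight: "weight \<tau>1 V K = weight \<tau> V K" unfolding weight_def by (simp add: agreeD[OF ag])
      have "heap_mem \<tau>1 V ({p} \<union> set ps \<union> narr \<tau>1 ''tab'' ` I) K"
        using mem unfolding heap_mem_def by (simp add: agreeD[OF ag])
      moreover have "tab_mem \<tau>1 I" "lim_bounded \<tau>1 V"
        using work unfolding heap_work_def by (simp_all add: tab_mem_agree[OF ag] lim_bounded_agree[OF ag])
      ultimately have work1: "heap_work \<tau>1 V {nvar \<tau>1 ''p''} ps I K"
        using work ps unfolding heap_work_def rs p1 by (simp add: agreeD[OF ag])
      have c1: "narr \<tau>1 ''node'' (narr \<tau>1 ''item'' (nvar \<tau>1 ''p'')) = c"
        by (simp add: agreeD[OF ag] p1 c_def)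
      show ?thesis
      proof (cases "c = p")
        case True
        have "exec heap_place \<tau>1 (\<lambda>k \<tau>'. \<exists>\<phi>'. Inv \<tau>' \<phi>' \<and> k + 50 + \<phi>' \<le> \<phi>)"
        proof (rule exec_mono[OF heap_place[OF work1]], unfold c1 p1)
          fix k \<tau>' assume "\<exists>I' K'. heap_work \<tau>' V {} ps I' K' \<and> weight \<tau>' V K' = weight \<tau>1 V K \<and>
            k + 100 * card I' \<le> 100 * card I + 200"
          then obtain I' K' where "heap_work \<tau>' V {} ps I' K'" "weight \<tau>' V K' = weight \<tau>1 V K"
            "k + 100 * card I' \<le> 100 * card I + 200" by blast
          then show "\<exists>\<phi>'. Inv \<tau>' \<phi>' \<and> k + 50 + \<phi>' \<le> \<phi>"
            unfolding \<phi> rs weight by (intro exI[of _ "300 * length ps + 100 * card I' + 400 * weight \<tau>' V K'"] conjI InvI) auto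
        qed (use True c1 p1 in simp)
        then show ?thesis
          using True by (auto simp: \<tau>1_def c_def p_def elim!: exec_mono)
      next
        case False
        have "exec heap_destroy \<tau>1 (\<lambda>k \<tau>'. \<exists>\<phi>'. Inv \<tau>' \<phi>' \<and> k + 50 + \<phi>' \<le> \<phi>)"
        proof (rule exec_mono[OF heap_destroy[OF work1]], unfold c1 p1)
          fix k \<tau>' assume "\<exists>V' rs'. heap_work \<tau>' V' {} rs' I K \<and>
            k + 300 * length rs' + 400 * weight \<tau>' V' K \<le> 300 * length ps + 400 * weight \<tau>1 V K"
          then obtain V' rs' where "heap_work \<tau>' V' {} rs' I K"
            "k + 300 * length rs' + 400 * weight \<tau>' V' K \<le> 300 * length ps + 400 * weight \<tau>1 V K" by blast
          then show "\<exists>\<phi>'. Inv \<tau>' \<phi>' \<and> k + 50 + \<phi>' \<le> \<phi>"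
            unfolding \<phi> rs weight by (intro exI[of _ "300 * length rs' + 100 * card I + 400 * weight \<tau>' V' K"] conjI InvI) auto
        qed (use False c1 p1 in simp)
        then show ?thesis
          using False by (auto simp: \<tau>1_def c_def p_def not_less_iff_gr_or_eq elim!: exec_mono)
      qed
    qed
    show "\<exists>V' I' K'. heap_work \<tau> V' {} [] I' K' \<and>
      k + 400 * weight \<tau> V' K' \<le> 300 * length rs + 100 * card I + 400 * weight \<sigma> V K + 4"
      if inv: "Inv \<tau> \<phi>'" and b: "\<not> bval ?b \<tau>" and
        k: "k + \<phi>' \<le> 300 * length rs + 100 * card I + 400 * weight \<sigma> V K + bcost ?b + 1" for k \<tau> \<phi>'
    proof -
      obtain V' rs' I' K' where work: "heap_work \<tau> V' {} rs' I' K'"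
        and \<phi>': "\<phi>' = 300 * length rs' + 100 * card I' + 400 * weight \<tau> V' K'"
        using inv unfolding Inv_def by blast
      have "rs' = []" using work b unfolding heap_work_def by (simp add: chain_empty)
      then show ?thesis using work k \<phi>' by (intro exI[of _ V'] exI[of _ I'] exI[of _ K']) auto
    qed
  qed
qed

text \<open>This pass is paid in full, 60 steps for each rank below \<open>lim\<close>. The table
  yields at most one root per rank, so at most \<open>lim\<close> roots remain. That the minimal
  root has rank below \<open>lim\<close> is recorded in order to bound the hollow weight created by
  its extraction.\<close>

lemma heap_collect:
  assumes work0: "heap_work \<sigma> V {} [] I K"
  shows "exec heap_collect \<sigma> (\<lambda>k \<sigma>'. k \<le> 60 * nvar \<sigma> ''lim'' + 10 \<and> (\<exists>rs. heap_work \<sigma>' V {} rs {} K \<and>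
    length rs \<le> nvar \<sigma> ''lim'' \<and>
    (if rs = [] then nvar \<sigma>' ''u'' = nvar \<sigma> ''n'' else \<exists>m\<in>set rs. nvar \<sigma>' ''u'' = narr \<sigma> ''item'' m \<and>
      rvar \<sigma>' ''du'' = rarr \<sigma> ''key'' m \<and> (\<forall>m'\<in>set rs. rarr \<sigma> ''key'' m \<le> rarr \<sigma> ''key'' m') \<and>
      narr \<sigma> ''node'' (narr \<sigma> ''item'' m) = m \<and> narr \<sigma> ''rank'' m < nvar \<sigma> ''lim'')))"
    (is "exec _ _ ?post")
proof -
  define n lim key item node rank where defs: "n = nvar \<sigma> ''n''" "lim = nvar \<sigma> ''lim''"
    "key = rarr \<sigma> ''key''" "item = narr \<sigma> ''item''" "node = narr \<sigma> ''node''" "rank = narr \<sigma> ''rank''"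
  define \<sigma>1 where "\<sigma>1 = \<sigma>\<lparr>nvar := (nvar \<sigma>)(''u'' := n, ''r'' := 0)\<rparr>"
  let ?min = "\<lambda>\<tau> rs. if rs = [] then nvar \<tau> ''u'' = n else \<exists>m\<in>set rs. nvar \<tau> ''u'' = item m \<and>
      rvar \<tau> ''du'' = key m \<and> (\<forall>m'\<in>set rs. key m \<le> key m')"
  define Inv where "Inv \<tau> \<phi> \<longleftrightarrow> (\<exists>rs J. heap_work \<tau> V {} rs J K \<and> (\<forall>r\<in>J. nvar \<tau> ''r'' \<le> r) \<and>
      nvar \<tau> ''r'' \<le> lim \<and> length rs \<le> nvar \<tau> ''r'' \<and> ?min \<tau> rs \<and>
      (\<forall>m\<in>set rs. item m < n \<and> node (item m) = m \<and> rank m < lim) \<and>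
      \<phi> = 60 * (lim - nvar \<tau> ''r''))" for \<tau> \<phi>
  let ?b = "NLess (NVar ''r'') (NVar ''lim'')"
  let ?body = "Seq (NAssign ''t'' (NGet ''tab'' (NVar ''r'')))
        (Seq
          (Cond (NLess (NConst 0) (NVar ''t''))
            (Seq (NPut ''tab'' (NVar ''r'') (NConst 0))
            (Seq (NPut ''nxt'' (NVar ''t'') (NVar ''roots''))
            (Seq (NAssign ''roots'' (NVar ''t''))
              (Cond (Conj (NLess (NVar ''u'') (NVar ''n''))
                          (Neg (RLess (RGet ''key'' (NVar ''t'')) (RVar ''du''))))
                Skip
                (Seq (NAssign ''u'' (NGet ''item'' (NVar ''t'')))
                  (RAssign ''du'' (RGet ''key'' (NVar ''t''))))))))
            Skip)
          (NAssign ''r'' (Inc (NVar ''r''))))"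
  have body: "exec ?body \<tau> (\<lambda>k \<tau>'. k \<le> 50 \<and> nvar \<tau>' ''r'' = Suc (nvar \<tau> ''r'') \<and>
    (let r = nvar \<tau> ''r''; t = narr \<tau> ''tab'' r in
      if t = 0 then \<tau>' = \<tau>\<lparr>nvar := (nvar \<tau>)(''t'' := 0, ''r'' := Suc r)\<rparr>
      else narr \<tau>' ''tab'' = (narr \<tau> ''tab'')(r := 0) \<and>
        narr \<tau>' ''nxt'' = (narr \<tau> ''nxt'')(t := nvar \<tau> ''roots'') \<and> nvar \<tau>' ''roots'' = t \<and>
        (if nvar \<tau> ''u'' < nvar \<tau> ''n'' \<and> \<not> rarr \<tau> ''key'' t < rvar \<tau> ''du''
         then nvar \<tau>' ''u'' = nvar \<tau> ''u'' \<and> rvar \<tau>' ''du'' = rvar \<tau> ''du''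
         else nvar \<tau>' ''u'' = narr \<tau> ''item'' t \<and> rvar \<tau>' ''du'' = rarr \<tau> ''key'' t)))" for \<tau>
    by (simp add: Let_def)
  have loop: "exec (While ?b ?body) \<sigma>1 (\<lambda>k \<tau>. (\<exists>\<phi>'. Inv \<tau> \<phi>' \<and> \<not> bval ?b \<tau> \<and>
      k + \<phi>' \<le> 60 * lim + bcost ?b + 1) \<and> agree (writes ?body) \<sigma>1 \<tau>)"
  proof (rule exec_While[where I = Inv])
    have ag: "agree {NV ''u'', NV ''r''} \<sigma> \<sigma>1" by (simp add: agree_def \<sigma>1_def)
    have "heap_work \<sigma>1 V {} [] I K" using work0 by (simp add: heap_agree[OF ag] heap_locs_def)
    then show "Inv \<sigma>1 (60 * lim)"
      unfolding Inv_def by (intro exI[of _ "[]"] exI[of _ I]) (simp add: \<sigma>1_def)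
    show "exec ?body \<tau> (\<lambda>k \<tau>'. \<exists>\<phi>'. Inv \<tau>' \<phi>' \<and> k + bcost ?b + 1 + \<phi>' \<le> \<phi>)"
      if inv: "Inv \<tau> \<phi>" and b: "bval ?b \<tau>" and ag: "agree (writes ?body) \<sigma>1 \<tau>" for \<tau> \<phi>
    proof -
      have same: "nvar \<tau> ''n'' = n" "nvar \<tau> ''lim'' = lim" "narr \<tau> ''item'' = item"
        "narr \<tau> ''node'' = node" "narr \<tau> ''rank'' = rank" "rarr \<tau> ''key'' = key"
        by (simp_all add: agreeD[OF ag]) (simp_all add: \<sigma>1_def defs)
      define r t where "r = nvar \<tau> ''r''" and "t = narr \<tau> ''tab'' r"
      obtain rs J where work: "heap_work \<tau> V {} rs J K" and J: "\<forall>i\<in>J. r \<le> i" and r: "r \<le> lim"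
        and len: "length rs \<le> r" and min: "?min \<tau> rs"
        and rs: "\<forall>m\<in>set rs. item m < n \<and> node (item m) = m \<and> rank m < lim" and \<phi>: "\<phi> = 60 * (lim - r)"
        using inv unfolding Inv_def r_def by blast
      have rlim: "r < lim" using b by (simp add: same r_def)
      have tabm: "tab_mem \<tau> J" using work unfolding heap_work_def by blast
      show ?thesis
      proof (rule exec_agree[OF body], goal_cases)
        case (1 k \<tau>')
        note k = 1(1) and ag' = 1(2)
        have "Inv \<tau>' (60 * (lim - Suc r))"
        proof (cases "t = 0")
          case True
          then have \<tau>': "\<tau>' = \<tau>\<lparr>nvar := (nvar \<tau>)(''t'' := 0, ''r'' := Suc r)\<rparr>"
            using k unfolding r_def t_def by (simp add: Let_def)
          have "agree {NV ''t'', NV ''r''} \<tau> \<tau>'" by (simp add: agree_def \<tau>')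
          from heap_work_agree[OF this] work have "heap_work \<tau>' V {} rs J K" by (simp add: heap_locs_def)
          moreover have "r \<notin> J" using tabm True unfolding tab_mem_def t_def by auto
          then have "\<forall>i\<in>J. Suc r \<le> i" using J by (auto simp: Suc_le_eq le_less)
          ultimately show ?thesis
            unfolding Inv_def using rlim len min rs by (intro exI[of _ rs] exI[of _ J]) (simp add: \<tau>')
        next
          case False
          then have new: "narr \<tau>' ''tab'' = (narr \<tau> ''tab'')(r := 0)"
            "narr \<tau>' ''nxt'' = (narr \<tau> ''nxt'')(t := nvar \<tau> ''roots'')" "nvar \<tau>' ''roots'' = t"
            "nvar \<tau>' ''r'' = Suc r"
            and u: "if nvar \<tau> ''u'' < n \<and> \<not> key t < rvar \<tau> ''du''
               then nvar \<tau>' ''u'' = nvar \<tau> ''u'' \<and> rvar \<tau>' ''du'' = rvar \<tau> ''du''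
               else nvar \<tau>' ''u'' = item t \<and> rvar \<tau>' ''du'' = key t"
            using k unfolding r_def t_def same by (simp_all add: Let_def)
          have same': "nvar \<tau>' ''n'' = n" "nvar \<tau>' ''lim'' = lim" "nvar \<tau>' ''cnt'' = nvar \<tau> ''cnt''"
            "narr \<tau>' ''item'' = item" "narr \<tau>' ''kid'' = narr \<tau> ''kid''"
            "narr \<tau>' ''node'' = node" "narr \<tau>' ''rank'' = rank" "rarr \<tau>' ''key'' = key"
            "rarr \<tau>' ''d'' = rarr \<tau> ''d''"
            by (simp_all add: agreeD[OF ag'] same)
          define tab where "tab = narr \<tau> ''tab''"
          have J_eq: "J = {i. i < lim \<and> tab i \<noteq> 0}" and tab_rank: "\<And>i. i \<in> J \<Longrightarrow> rank (tab i) = i"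
            and tab_full: "\<And>i. i \<in> J \<Longrightarrow> node (item (tab i)) = tab i"
            using tabm unfolding tab_mem_def same tab_def by auto
          have rJ: "r \<in> J" using False rlim unfolding J_eq t_def tab_def by simp
          have mem: "heap_mem \<tau> V (set rs \<union> tab ` J) K" and disj: "set rs \<inter> tab ` J = {}"
            and roots: "chain (narr \<tau> ''nxt'') (nvar \<tau> ''roots'') rs" "distinct rs"
            and lims: "lim_bounded \<tau> V"
            using work unfolding heap_work_def tab_def by auto
          have heap: "hheap n (nvar \<tau> ''cnt'') V (set rs \<union> tab ` J) K rank item key node (rarr \<tau> ''d'')"
            using mem unfolding heap_mem_def same by simp
          have tR: "t \<in> tab ` J" unfolding t_def tab_def using rJ by simp
          have tV: "t \<in> V" using hheap_R[OF heap] tR by auto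
          have tK: "t \<notin> set (K u)" if "u \<in> V" for u using hheap_K[OF heap that] tR by auto
          have t_tab: "t \<notin> tab ` (J - {r})"
            using tab_rank tab_rank[OF rJ] unfolding t_def tab_def by force
          have img: "tab(r := 0) ` (J - {r}) = tab ` (J - {r})" by auto
          have R: "set rs \<union> tab ` J = set (t # rs) \<union> tab ` (J - {r})"
            using rJ unfolding t_def tab_def by auto
          have trs: "t \<notin> set rs" using disj tR by auto
          have "heap_mem \<tau>' V ({} \<union> set (t # rs) \<union> narr \<tau>' ''tab'' ` (J - {r})) K"
            using mem tK unfolding heap_mem_def new same' same tab_def[symmetric] R img
            by (simp add: chain_upd)
          moreover have "tab_mem \<tau>' (J - {r})"
            using tab_rank tab_full unfolding tab_mem_def new same' J_eq tab_def[symmetric] by auto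
          moreover have "lim_bounded \<tau>' V" using lims unfolding lim_bounded_def same same' .
          moreover have "chain (narr \<tau>' ''nxt'') (nvar \<tau>' ''roots'') (t # rs)"
            unfolding new using roots False trs by (simp add: chain_upd)
          ultimately have "heap_work \<tau>' V {} (t # rs) (J - {r}) K"
            using disj t_tab trs roots unfolding heap_work_def new tab_def[symmetric] img by auto
          moreover have "\<forall>i\<in>J - {r}. Suc r \<le> i" using J by (auto simp: Suc_le_eq le_less)
          moreover have t: "item t < n" "node (item t) = t" "rank t < lim"
            using hheap_item[OF heap tV] tab_full[OF rJ] tab_rank[OF rJ] rlim unfolding t_def tab_def by auto
          moreover have "?min \<tau>' (t # rs)"
          proof (cases "rs = []")
            case True
            then show ?thesis using min u by simp
          next
            case False
            then obtain m where m: "m \<in> set rs" "nvar \<tau> ''u'' = item m" "rvar \<tau> ''du'' = key m"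
              "\<forall>m'\<in>set rs. key m \<le> key m'" using min by auto
            \<comment> \<open>Items of heap nodes are below n, so the test \<open>u < n\<close> in
              the code succeeds precisely because a candidate exists.\<close>
            then have "nvar \<tau> ''u'' < n" using rs by simp
            then show ?thesis using u m by (cases "key t < key m") (auto intro: less_imp_le order_trans)
          qed
          ultimately show ?thesis
            unfolding Inv_def new using rlim len rs by (intro exI[of _ "t # rs"] exI[of _ "J - {r}"]) auto
        qed
        then show ?case
          using k \<phi> rlim by (intro exI[of _ "60 * (lim - Suc r)"]) auto
      qed
    qed
  qed auto
  show ?thesis
    unfolding heap_collect_def
  proof (rule exec_SeqI[where Q' = "\<lambda>k \<tau>. k = 2 \<and> \<tau> = \<sigma>\<lparr>nvar := (nvar \<sigma>)(''u'' := n)\<rparr>"], (simp add: defs; fail),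
      rule exec_SeqI[where Q' = "\<lambda>k \<tau>. k = 2 \<and> \<tau> = \<sigma>1"], (simp add: \<sigma>1_def; fail))
    fix k0 k1 :: nat and \<tau>0 \<tau>1 :: state
    assume *: "k0 = 2 \<and> \<tau>0 = \<sigma>\<lparr>nvar := (nvar \<sigma>)(''u'' := n)\<rparr>" "k1 = 2 \<and> \<tau>1 = \<sigma>1"
    show "exec (While ?b ?body) \<tau>1 (\<lambda>l. ?post (k0 + (k1 + l)))"
      unfolding conjunct2[OF *(2)]
    proof (rule exec_mono[OF loop], elim conjE exE)
      fix k \<phi>' :: nat and \<tau> :: state
      assume inv: "Inv \<tau> \<phi>'" and b: "\<not> bval ?b \<tau>" and k: "k + \<phi>' \<le> 60 * lim + bcost ?b + 1"
        and ag: "agree (writes ?body) \<sigma>1 \<tau>"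
      have lim: "nvar \<tau> ''lim'' = lim" by (simp add: agreeD[OF ag]) (simp add: \<sigma>1_def defs)
      obtain rs J where work: "heap_work \<tau> V {} rs J K" and J: "\<forall>i\<in>J. nvar \<tau> ''r'' \<le> i"
        and r: "nvar \<tau> ''r'' \<le> lim" "length rs \<le> nvar \<tau> ''r''" and min: "?min \<tau> rs"
        and rs: "\<forall>m\<in>set rs. item m < n \<and> node (item m) = m \<and> rank m < lim"
        using inv unfolding Inv_def by blast
      have "tab_mem \<tau> J" using work unfolding heap_work_def by blast
      then have "J \<subseteq> {..<lim}" unfolding tab_mem_def lim by blast
      moreover have "lim \<le> nvar \<tau> ''r''" using b by (simp add: lim)
      ultimately have "i \<notin> J" for i using J by fastforce
      then have "J = {}" by blast
      then show "?post (k0 + (k1 + k)) \<tau>"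
        unfolding defs[symmetric] using * k work r min rs by (intro conjI exI[of _ rs]) (auto split: if_splits)
    qed
  qed
qed

text \<open>Consolidation has destroyed all hollow roots, so the minimal root is full and its key is
  the current label of its vertex. Apart from constants, the cost is 60 \<open>lim\<close> for the
  pass over the table, 300 \<open>lim\<close> for the surviving roots, and 400 \<open>lim\<close>
  for the new hollow node. With \<open>lim \<le> 2 * L\<close> this is at most 1520 L.\<close>

lemma heap_extract:
  assumes inv: "heap_inv M \<sigma> Q j \<phi>" and M: "M < 2 ^ L"
  shows "exec heap_extract \<sigma> (\<lambda>k \<sigma>'. if Q = {} then nvar \<sigma>' ''u'' = nvar \<sigma> ''n'' \<and> k \<le> \<phi> + 1600 * L + 100
    else \<exists>\<phi>'. k + \<phi>' \<le> \<phi> + 1600 * L + 100 \<and> nvar \<sigma>' ''u'' \<in> Q \<and>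
      (\<forall>v\<in>Q. rarr \<sigma> ''d'' (nvar \<sigma>' ''u'') \<le> rarr \<sigma> ''d'' v) \<and>
      rvar \<sigma>' ''du'' = rarr \<sigma> ''d'' (nvar \<sigma>' ''u'') \<and> heap_inv M \<sigma>' (Q - {nvar \<sigma>' ''u''}) j \<phi>')"
    (is "exec _ _ ?post")
proof -
  obtain V K rs where mem: "heap_mem \<sigma> V (set rs) K" "chain (narr \<sigma> ''nxt'') (nvar \<sigma> ''roots'') rs"
    "distinct rs" "tab_mem \<sigma> {}" "lim_bounded \<sigma> V" and cnt: "nvar \<sigma> ''cnt'' + j \<le> M"
    and Q: "Q = {v. v < nvar \<sigma> ''n'' \<and> narr \<sigma> ''node'' v \<noteq> 0}"
    and \<phi>: "\<phi> = 300 * length rs + 400 * weight \<sigma> V K"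
    using inv unfolding heap_inv_def by blast
  have work: "heap_work \<sigma> V {} rs {} K" using mem unfolding heap_work_def by simp
  let ?tail = "Cond (NLess (NVar ''u'') (NVar ''n'')) (NPut ''node'' (NVar ''u'') (NConst 0)) Skip"
  show ?thesis
    unfolding heap_extract_def
  proof (rule exec_SeqI[OF heap_consolidate[OF work]], elim exE conjE)
    fix k1 :: nat and \<sigma>1 :: state and V1 I K1
    assume work1: "heap_work \<sigma>1 V1 {} [] I K1" and ag1: "agree (writes heap_consolidate) \<sigma> \<sigma>1"
      and k1: "k1 + 400 * weight \<sigma>1 V1 K1 \<le>
        300 * length rs + 100 * card ({}::nat set) + 400 * weight \<sigma> V K + 4"
    have same1: "nvar \<sigma>1 ''n'' = nvar \<sigma> ''n''" "nvar \<sigma>1 ''cnt'' = nvar \<sigma> ''cnt''"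
      "narr \<sigma>1 ''item'' = narr \<sigma> ''item''" "narr \<sigma>1 ''node'' = narr \<sigma> ''node''"
      "rarr \<sigma>1 ''key'' = rarr \<sigma> ''key''" "rarr \<sigma>1 ''d'' = rarr \<sigma> ''d''"
      by (simp_all add: agreeD[OF ag1] heap_consolidate_def heap_place_def heap_link_def heap_destroy_def)
    define n lim where "n = nvar \<sigma> ''n''" and "lim = nvar \<sigma>1 ''lim''"
    have "lim_bounded \<sigma>1 V1" using work1 unfolding heap_work_def by blast
    then have "lim = 0 \<or> 2 ^ ((lim - 1) div 2) \<le> nvar \<sigma> ''cnt''"
      unfolding lim_bounded_def same1 lim_def by simp
    moreover have "nvar \<sigma> ''cnt'' < 2 ^ L" using cnt M by simp
    ultimately have "lim = 0 \<or> (2::nat) ^ ((lim - 1) div 2) < 2 ^ L" by linarith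
    \<comment> \<open>Comparing exponents gives \<open>(lim - 1) div 2 < L\<close>.\<close>
    then have lim: "lim \<le> 2 * L" by (auto simp: power_strict_increasing_iff)
    show "exec (Seq heap_collect ?tail) \<sigma>1 (\<lambda>l. ?post (k1 + l))"
    proof (rule exec_SeqI[OF heap_collect[OF work1]], elim exE conjE)
      fix k2 :: nat and \<sigma>2 :: state and ms
      assume k2: "k2 \<le> 60 * nvar \<sigma>1 ''lim'' + 10" and work2: "heap_work \<sigma>2 V1 {} ms {} K1"
        and ms: "length ms \<le> nvar \<sigma>1 ''lim''" and ag2: "agree (writes heap_collect) \<sigma>1 \<sigma>2"
        and min: "if ms = [] then nvar \<sigma>2 ''u'' = nvar \<sigma>1 ''n''
          else \<exists>m\<in>set ms. nvar \<sigma>2 ''u'' = narr \<sigma>1 ''item'' m \<and> rvar \<sigma>2 ''du'' = rarr \<sigma>1 ''key'' m \<and>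
            (\<forall>m'\<in>set ms. rarr \<sigma>1 ''key'' m \<le> rarr \<sigma>1 ''key'' m') \<and>
            narr \<sigma>1 ''node'' (narr \<sigma>1 ''item'' m) = m \<and> narr \<sigma>1 ''rank'' m < nvar \<sigma>1 ''lim''"
      have same2: "nvar \<sigma>2 ''n'' = nvar \<sigma> ''n''" "nvar \<sigma>2 ''cnt'' = nvar \<sigma> ''cnt''"
        "narr \<sigma>2 ''item'' = narr \<sigma> ''item''" "narr \<sigma>2 ''node'' = narr \<sigma> ''node''"
        "rarr \<sigma>2 ''key'' = rarr \<sigma> ''key''" "rarr \<sigma>2 ''d'' = rarr \<sigma> ''d''"
        and rank2: "narr \<sigma>2 ''rank'' = narr \<sigma>1 ''rank''" and lim2: "nvar \<sigma>2 ''lim'' = lim"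
        by (simp_all add: agreeD[OF ag2] heap_collect_def same1 lim_def)
      have weight2: "weight \<sigma>2 V1 K1 = weight \<sigma>1 V1 K1" unfolding weight_def same1 same2 ..
      have heap: "hheap n (nvar \<sigma> ''cnt'') V1 (set ms) K1 (narr \<sigma>2 ''rank'')
          (narr \<sigma> ''item'') (rarr \<sigma> ''key'') (narr \<sigma> ''node'') (rarr \<sigma> ''d'')"
        using work2 unfolding heap_work_def heap_mem_def same2 n_def by simp
      show "exec ?tail \<sigma>2 (\<lambda>l. ?post (k1 + (k2 + l)))"
      proof (cases "ms = []")
        case True
        \<comment> \<open>The node of a queued vertex would have some root above it or be one, but
          no root is left.\<close>
        have "Q = {}"
        proof (rule ccontr)
          assume "Q \<noteq> {}"
          then obtain v where "v < n" "narr \<sigma> ''node'' v \<noteq> 0" unfolding Q n_def by blast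
          with hheap_node[OF heap] hheap_root_le[OF heap] True show False by fastforce
        qed
        then show ?thesis
          using True min k1 k2 lim unfolding \<phi> lim_def[symmetric] by (simp add: same1 same2)
      next
        case False
        then obtain m where m: "m \<in> set ms" "nvar \<sigma>2 ''u'' = narr \<sigma> ''item'' m"
          "rvar \<sigma>2 ''du'' = rarr \<sigma> ''key'' m" "\<And>m'. m' \<in> set ms \<Longrightarrow> rarr \<sigma> ''key'' m \<le> rarr \<sigma> ''key'' m'"
          "narr \<sigma> ''node'' (narr \<sigma> ''item'' m) = m" "narr \<sigma>2 ''rank'' m < lim"
          using min unfolding same1 rank2 lim_def by auto
        define u where "u = narr \<sigma> ''item'' m"
        have mV: "m \<in> V1" using m(1) hheap_R[OF heap] by auto
        then have m0: "m \<noteq> 0" using hheap_zero[OF heap] by metis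
        have un: "u < n" using hheap_item[OF heap mV] unfolding u_def .
        have uQ: "u \<in> Q" using un m(5) m0 unfolding Q u_def n_def by simp
        have key: "rarr \<sigma> ''key'' m = rarr \<sigma> ''d'' u" using hheap_full[OF heap mV m(5)] unfolding u_def by simp
        have least: "rarr \<sigma> ''d'' u \<le> rarr \<sigma> ''d'' v" if "v \<in> Q" for v
          using hheap_min[OF heap m(1,4)] that key unfolding Q n_def by auto
        note extracted = hheap_extract[OF heap mV m(5), folded u_def]
        define \<sigma>3 where "\<sigma>3 = \<sigma>2\<lparr>narr := (narr \<sigma>2)(''node'' := (narr \<sigma> ''node'')(u := 0))\<rparr>"
        have new: "narr \<sigma>3 ''node'' = (narr \<sigma> ''node'')(u := 0)" by (simp add: \<sigma>3_def)
        have ag3: "agree {NA ''node''} \<sigma>2 \<sigma>3" by (simp add: agree_def \<sigma>3_def)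
        have "weight \<sigma>3 V1 K1 \<le> weight \<sigma>1 V1 K1 + lim"
          using extracted(2) m(6) unfolding weight2[symmetric] weight_def new
          by (simp add: agreeD[OF ag3] same1 same2)
        then have "(k1 + (k2 + 10)) + (300 * length ms + 400 * weight \<sigma>3 V1 K1) \<le> \<phi> + 1600 * L + 100"
          using k1 k2 ms lim unfolding \<phi> lim_def[symmetric] by simp
        moreover have "heap_inv M \<sigma>3 (Q - {u}) j (300 * length ms + 400 * weight \<sigma>3 V1 K1)"
          unfolding heap_inv_def
        proof (intro exI[of _ V1] exI[of _ K1] exI[of _ ms] conjI)
          show "heap_mem \<sigma>3 V1 (set ms) K1"
            using work2 extracted(1) unfolding heap_work_def heap_mem_def new
            by (simp add: agreeD[OF ag3] same2 n_def)
          show "tab_mem \<sigma>3 {}" using work2 unfolding heap_work_def tab_mem_def by (simp add: agreeD[OF ag3])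
          show "lim_bounded \<sigma>3 V1" using work2 unfolding heap_work_def by (simp add: lim_bounded_agree[OF ag3])
          show "Q - {u} = {v. v < nvar \<sigma>3 ''n'' \<and> narr \<sigma>3 ''node'' v \<noteq> 0}"
            unfolding Q new by (auto simp: agreeD[OF ag3] same2)
        qed (use work2 cnt in \<open>auto simp: heap_work_def agreeD[OF ag3] same2\<close>)
        moreover have "exec ?tail \<sigma>2 (\<lambda>l \<sigma>'. l \<le> 10 \<and> \<sigma>' = \<sigma>3)"
          using un m(2) unfolding \<sigma>3_def by (simp add: same2 n_def u_def)
        ultimately show ?thesis
          using uQ least m(2,3) key
          by (elim exec_mono) (auto simp: agreeD[OF ag3] u_def intro!: exI)
      qed
    qed
  qed
qed

section \<open>Distances in undirected graphs\<close>

locale weighted_graph = pair_graph G for G :: "nat pair_pre_digraph" +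
  fixes w :: "nat \<times> nat \<Rightarrow> real"
  assumes nonneg: "(u, v) \<in> parcs G \<Longrightarrow> 0 \<le> w (u, v)"
    and weight_sym: "(u, v) \<in> parcs G \<Longrightarrow> w (u, v) = w (v, u)"
begin

lemma weight_nonneg: "e \<in> arcs (with_proj G) \<Longrightarrow> 0 \<le> w e"
  using nonneg by (cases e) auto

lemma dist_nonneg: "0 \<le> dist_in G w u v"
  unfolding \<mu>_def by (intro INF_greatest) (auto intro!: pos_cost_pos_awalk_cost weight_nonneg)

lemma dist_self: "u \<in> pverts G \<Longrightarrow> dist_in G w u u = 0"
  using min_cost_le_walk_cost[of u "[]" u w] dist_nonneg[of u u]
  by (simp add: awalk_Nil_iff order_antisym zero_ereal_def)

lemma dist_step: "(u, v) \<in> parcs G \<Longrightarrow> dist_in G w s v \<le> dist_in G w s u + w (u, v)"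
  using pos_cost_mu_triangle[of w "(u, v)" u v s] weight_nonneg by (auto simp: arc_to_ends_def)

lemma dist_walk:
  assumes "dist_in G w u v \<noteq> \<infinity>"
  obtains p where "awalk u p v" "dist_in G w u v = awalk_cost w p"
proof -
  have "u \<rightarrow>\<^sup>*\<^bsub>with_proj G\<^esub> v" using assms shortest_path_inf by blast
  from min_cost_awalk[OF this, of w] weight_nonneg that show thesis by (auto simp: apath_def)
qed

lemma dist_triangle: "dist_in G w a c \<le> dist_in G w a b + dist_in G w b c"
proof (cases "dist_in G w a b = \<infinity> \<or> dist_in G w b c = \<infinity>")
  case True
  then show ?thesis by auto
next
  case False
  then obtain p q where "awalk a p b" "dist_in G w a b = awalk_cost w p"
    "awalk b q c" "dist_in G w b c = awalk_cost w q" by (metis dist_walk)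
  moreover from this have "awalk a (p @ q) c" by (blast intro: awalk_appendI)
  from min_cost_le_walk_cost[OF this] have "dist_in G w a c \<le> awalk_cost w p + awalk_cost w q" by simp
  ultimately show ?thesis by simp
qed

lemma awalk_cost_rev: "set p \<subseteq> parcs G \<Longrightarrow> awalk_cost w (rev_path p) = awalk_cost w p"
  by (induction p) (auto simp: rev_path_def dest: weight_sym)

text \<open>Undirectedness enters here: a reversed walk is again a walk, of the same cost because
  opposite arcs have equal weights.\<close>

lemma dist_sym: "dist_in G w a b = dist_in G w b a"
proof -
  have "dist_in G w b a \<le> dist_in G w a b" for a b
  proof (cases "dist_in G w a b = \<infinity>")
    case False
    then obtain p where p: "awalk a p b" "dist_in G w a b = awalk_cost w p" by (metis dist_walk)
    then have "awalk b (rev_path p) a" by simp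
    from min_cost_le_walk_cost[OF this, of w] show ?thesis
      using p awalk_cost_rev[of p] by (auto simp: awalk_def)
  qed simp
  then show ?thesis by (metis order_antisym)
qed

text \<open>The principle of feasible potentials: summing the inequalities along a walk from
  \<open>s\<close> telescopes. It serves twice, for the final labels of the search and for the
  infinite radius of a graph without crossing edges.\<close>

lemma le_dist:
  assumes "f s \<le> 0" "\<And>u v. (u, v) \<in> parcs G \<Longrightarrow> f v \<le> f u + ereal (w (u, v))"
  shows "f v \<le> dist_in G w s v"
proof -
  have "f v \<le> f u + ereal (awalk_cost w p)" if "awalk u p v" for u p
    using that
  proof (induction p arbitrary: u)
    case (Cons e p)
    obtain x y where e: "e = (x, y)" by (cases e)
    then have "f v \<le> f y + ereal (awalk_cost w p)" "f y \<le> f u + ereal (w e)"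
      using Cons assms(2)[of u y] by (auto simp: awalk_Cons_iff)
    then have "f v \<le> f u + ereal (w e) + ereal (awalk_cost w p)"
      by (meson add_right_mono order_trans)
    then show ?case by (simp add: add.assoc)
  qed (auto simp: awalk_Nil_iff zero_ereal_def[symmetric])
  then have "f v \<le> ereal (awalk_cost w p)" if "awalk s p v" for p
    using that assms(1) by (metis add_right_mono add_0 order_trans)
  then show ?thesis unfolding \<mu>_def by (auto intro: INF_greatest)
qed

section \<open>Dijkstra's algorithm\<close>

text \<open>Finished vertices are those with a finite label that have left the queue \<open>Q\<close>. The vertex \<open>u\<close>
  has just been extracted, and its arcs into \<open>P\<close> have been relaxed.\<close>

definition unfinished :: "nat set \<Rightarrow> (nat \<Rightarrow> ereal) \<Rightarrow> nat set" where
  "unfinished Q d = {v \<in> pverts G. v \<in> Q \<or> d v = \<infinity>}"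

text \<open>No exactness is claimed for finished vertices. Labels bound distances from above, arcs
  out of finished vertices cannot improve them, and finished labels do not exceed queued ones. The
  form \<open>d s \<le> 0\<close> is the one that \<open>le_dist\<close> takes.\<close>

definition dijkstra :: "nat \<Rightarrow> nat set \<Rightarrow> (nat \<Rightarrow> ereal) \<Rightarrow> bool" where
  "dijkstra s Q d \<longleftrightarrow> d s \<le> 0 \<and> Q \<subseteq> pverts G \<and> (\<forall>v\<in>Q. d v \<noteq> \<infinity>) \<and>
    (\<forall>v\<in>pverts G. dist_in G w s v \<le> d v) \<and>
    (\<forall>a\<in>pverts G - unfinished Q d. \<forall>q\<in>Q. d a \<le> d q) \<and>
    (\<forall>a\<in>pverts G - unfinished Q d. \<forall>b. (a, b) \<in> parcs G \<longrightarrow> d b \<le> d a + w (a, b))"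

definition scanning :: "nat \<Rightarrow> nat set \<Rightarrow> (nat \<Rightarrow> ereal) \<Rightarrow> nat \<Rightarrow> nat set \<Rightarrow> bool" where
  "scanning s Q d u P \<longleftrightarrow> d s \<le> 0 \<and> Q \<subseteq> pverts G \<and> (\<forall>v\<in>Q. d v \<noteq> \<infinity>) \<and>
    (\<forall>v\<in>pverts G. dist_in G w s v \<le> d v) \<and>
    u \<in> pverts G - unfinished Q d \<and>
    (\<forall>a\<in>pverts G - unfinished Q d. d a \<le> d u) \<and> (\<forall>q\<in>Q. d u \<le> d q) \<and>
    (\<forall>a\<in>pverts G - unfinished Q d. \<forall>b. (a, b) \<in> parcs G \<longrightarrow> (a = u \<longrightarrow> b \<in> P) \<longrightarrow>
      d b \<le> d a + w (a, b))"

lemma dijkstra_init: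
  assumes "s \<in> pverts G" "\<And>v. v \<in> pverts G \<Longrightarrow> d v = (if v = s then 0 else \<infinity>)"
  shows "dijkstra s {s} d"
  using assms dist_self by (auto simp: dijkstra_def unfinished_def)

text \<open>The last two claims carry the time bound: extraction removes exactly \<open>u\<close>
  from the unfinished vertices, so the credits set aside for \<open>u\<close> become available
  exactly once.\<close>

lemma dijkstra_extract:
  assumes "dijkstra s Q d" "u \<in> Q" "\<And>q. q \<in> Q \<Longrightarrow> d u \<le> d q"
  shows "scanning s (Q - {u}) d u {}" and "unfinished Q d = insert u (unfinished (Q - {u}) d)"
    and "u \<notin> unfinished (Q - {u}) d"
proof -
  have uG: "u \<in> pverts G" "d u \<noteq> \<infinity>" using assms unfolding dijkstra_def by auto
  show "unfinished Q d = insert u (unfinished (Q - {u}) d)" "u \<notin> unfinished (Q - {u}) d"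
    using uG assms(2) unfolding unfinished_def by auto
  then have "pverts G - unfinished (Q - {u}) d = insert u (pverts G - unfinished Q d)"
    using uG by auto
  then show "scanning s (Q - {u}) d u {}"
    using assms uG unfolding dijkstra_def scanning_def by auto
qed

lemma scanning_done:
  assumes "scanning s Q d u P" "{v. (u, v) \<in> parcs G} \<subseteq> P"
  shows "dijkstra s Q d"
  unfolding dijkstra_def
proof (intro conjI)
  show "\<forall>a\<in>pverts G - unfinished Q d. \<forall>q\<in>Q. d a \<le> d q"
    using assms(1) unfolding scanning_def by (meson order_trans)
  show "\<forall>a\<in>pverts G - unfinished Q d. \<forall>b. (a, b) \<in> parcs G \<longrightarrow> d b \<le> d a + w (a, b)"
    using assms unfolding scanning_def by blast
qed (use assms in \<open>auto simp: scanning_def\<close>)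

text \<open>With an empty queue, a vertex is either finished, so that its outgoing arcs are relaxed,
  or has label \<infinity>, so that they impose no constraint. The labels are therefore a feasible
  potential, and \<open>le_dist\<close> gives the missing inequality.\<close>

lemma dijkstra_final:
  assumes "dijkstra s {} d" "v \<in> pverts G"
  shows "d v = dist_in G w s v"
proof (rule order_antisym)
  show "dist_in G w s v \<le> d v" using assms unfolding dijkstra_def by blast
  have "d b \<le> d a + ereal (w (a, b))" if "(a, b) \<in> parcs G" for a b
    using assms(1) that in_arcsD1[OF that] unfolding dijkstra_def unfinished_def by (cases "d a = \<infinity>") auto
  then show "d v \<le> dist_in G w s v" using assms(1) unfolding dijkstra_def by (intro le_dist) auto
qed

lemma scanning_skip:
  assumes "scanning s Q d u P" "\<not> d u + w (u, v) < d v"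
  shows "scanning s Q d u (insert v P)"
proof -
  have "d b \<le> d a + w (a, b)"
    if "a \<in> pverts G - unfinished Q d" "(a, b) \<in> parcs G" "a = u \<longrightarrow> b \<in> insert v P" for a b
  proof (cases "a = u \<and> b = v")
    case True
    then show ?thesis using assms(2) by simp
  next
    case False
    then show ?thesis using assms(1) that unfolding scanning_def by blast
  qed
  then show ?thesis using assms(1) unfolding scanning_def by blast
qed

text \<open>Nonnegative weights are decisive: a finished \<open>v\<close> has
  \<open>d v \<le> d u \<le> d u + w (u, v)\<close>, so only an unfinished vertex can improve.
  Labels of finished vertices thus stay fixed, and the set of unfinished vertices does not change
  during a scan.\<close>

lemma scanning_relax:
  assumes scan: "scanning s Q d u P" and arc: "(u, v) \<in> parcs G" and less: "d u + w (u, v) < d v"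
  defines "d' \<equiv> d(v := d u + w (u, v))"
  shows "scanning s (insert v Q) d' u (insert v P)"
    and "unfinished (insert v Q) d' = unfinished Q d" and "v \<in> unfinished Q d"
proof -
  have vG: "v \<in> pverts G" using in_arcsD2[OF arc] .
  have du: "d u \<le> d u + w (u, v)" "d u \<noteq> \<infinity>"
    using nonneg[OF arc] scan add_left_mono[of 0 "ereal (w (u, v))" "d u"]
    unfolding scanning_def unfinished_def by auto
  show v: "v \<in> unfinished Q d"
  proof (rule ccontr)
    assume "v \<notin> unfinished Q d"
    then have "d v \<le> d u" using scan vG unfolding scanning_def by blast
    with less du(1) show False by auto
  qed
  have x: "d u + w (u, v) \<noteq> \<infinity>" using less by auto
  show unf: "unfinished (insert v Q) d' = unfinished Q d"
    using v x unfolding unfinished_def d'_def by auto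
  have uv: "u \<noteq> v" using v scan unfolding scanning_def by auto
  have le: "d' b \<le> d b" for b using less unfolding d'_def by auto
  have same: "d' a = d a" if "a \<in> pverts G - unfinished Q d" for a
    using that v unfolding d'_def by auto
  have u: "u \<in> pverts G - unfinished Q d" using scan unfolding scanning_def by blast
  show "scanning s (insert v Q) d' u (insert v P)"
    unfolding scanning_def unf
  proof (intro conjI)
    show "d' s \<le> 0" using le[of s] scan unfolding scanning_def by (meson order_trans)
    show "\<forall>b\<in>pverts G. dist_in G w s b \<le> d' b"
    proof
      fix b assume "b \<in> pverts G"
      moreover have "dist_in G w s v \<le> d u + w (u, v)"
        using dist_step[OF arc, of s] scan u unfolding scanning_def by (meson DiffE add_right_mono order_trans)
      ultimately show "dist_in G w s b \<le> d' b" using scan unfolding scanning_def d'_def by auto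
    qed
    show "\<forall>a\<in>pverts G - unfinished Q d. \<forall>b. (a, b) \<in> parcs G \<longrightarrow> (a = u \<longrightarrow> b \<in> insert v P) \<longrightarrow>
      d' b \<le> d' a + w (a, b)"
    proof (intro ballI allI impI)
      fix a b assume a: "a \<in> pverts G - unfinished Q d" and ab: "(a, b) \<in> parcs G" "a = u \<longrightarrow> b \<in> insert v P"
      show "d' b \<le> d' a + w (a, b)"
      proof (cases "a = u \<and> b = v")
        case True
        then show ?thesis using uv by (simp add: d'_def)
      next
        case False
        then have "d b \<le> d a + w (a, b)" using scan a ab unfolding scanning_def by blast
        then show ?thesis using le[of b] same[OF a] by (metis order_trans)
      qed
    qed
    show "\<forall>a\<in>pverts G - unfinished Q d. d' a \<le> d' u"
      using same u scan unfolding scanning_def by simp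
    show "\<forall>q\<in>insert v Q. d' u \<le> d' q"
      using scan du uv unfolding scanning_def d'_def by auto
  qed (use scan vG x u in \<open>auto simp: scanning_def d'_def\<close>)
qed

end

section \<open>Graph search with an abstract priority queue\<close>

definition degree :: "nat pair_pre_digraph \<Rightarrow> nat \<Rightarrow> nat" where
  "degree G u = card {v. (u, v) \<in> parcs G}"

lemma holds_inputD:
  assumes "holds_input \<sigma> G w S"
  shows "pverts G = {..<nvar \<sigma> ''n''}"
    and "u < nvar \<sigma> ''n'' \<Longrightarrow> narr \<sigma> ''off'' u \<le> narr \<sigma> ''off'' (Suc u)"
    and "u < nvar \<sigma> ''n'' \<Longrightarrow>
      narr \<sigma> ''adj'' ` {narr \<sigma> ''off'' u..<narr \<sigma> ''off'' (Suc u)} = {v. (u, v) \<in> parcs G}"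
    and "u < nvar \<sigma> ''n'' \<Longrightarrow> i \<in> {narr \<sigma> ''off'' u..<narr \<sigma> ''off'' (Suc u)} \<Longrightarrow>
      (u, narr \<sigma> ''adj'' i) \<in> parcs G \<and> rarr \<sigma> ''wt'' i = ereal (w (u, narr \<sigma> ''adj'' i))"
    and "u < nvar \<sigma> ''n'' \<Longrightarrow> narr \<sigma> ''off'' (Suc u) - narr \<sigma> ''off'' u = degree G u"
    and "u < nvar \<sigma> ''n'' \<Longrightarrow> narr \<sigma> ''inS'' u = (if u \<in> S then 1 else 0)"
proof -
  note * = assms[unfolded holds_input_def Let_def Suc_eq_plus1[symmetric]]
  show "pverts G = {..<nvar \<sigma> ''n''}" using * by blast
  show "narr \<sigma> ''inS'' u = (if u \<in> S then 1 else 0)" if "u < nvar \<sigma> ''n''" using * that by blast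
  show "narr \<sigma> ''off'' u \<le> narr \<sigma> ''off'' (Suc u)" if "u < nvar \<sigma> ''n''" using * that by blast
  have bij: "bij_betw (narr \<sigma> ''adj'') {narr \<sigma> ''off'' u..<narr \<sigma> ''off'' (Suc u)} {v. (u, v) \<in> parcs G}"
    if "u < nvar \<sigma> ''n''" using * that by blast
  from bij_betw_imp_surj_on[OF bij] show img:
    "narr \<sigma> ''adj'' ` {narr \<sigma> ''off'' u..<narr \<sigma> ''off'' (Suc u)} = {v. (u, v) \<in> parcs G}"
    if "u < nvar \<sigma> ''n''" using that by blast
  show "(u, narr \<sigma> ''adj'' i) \<in> parcs G \<and> rarr \<sigma> ''wt'' i = ereal (w (u, narr \<sigma> ''adj'' i))"
    if "u < nvar \<sigma> ''n''" "i \<in> {narr \<sigma> ''off'' u..<narr \<sigma> ''off'' (Suc u)}"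
    using * that img[OF that(1)] by blast
  show "narr \<sigma> ''off'' (Suc u) - narr \<sigma> ''off'' u = degree G u" if "u < nvar \<sigma> ''n''"
    using bij_betw_same_card[OF bij[OF that]] unfolding degree_def by simp
qed

definition scan :: "com \<Rightarrow> com" where
  "scan push =
    Seq (NAssign ''i'' (NGet ''off'' (NVar ''u'')))
    (Seq (NAssign ''e'' (NGet ''off'' (Inc (NVar ''u''))))
      (While (NLess (NVar ''i'') (NVar ''e''))
        (Seq (NAssign ''v'' (NGet ''adj'' (NVar ''i'')))
        (Seq (RAssign ''x'' (Add (RVar ''du'') (RGet ''wt'' (NVar ''i''))))
        (Seq (Cond (RLess (RVar ''x'') (RGet ''d'' (NVar ''v''))) push Skip)
          (NAssign ''i'' (Inc (NVar ''i''))))))))"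

definition search :: "com \<Rightarrow> com \<Rightarrow> com" where
  "search push extr = Seq extr (While (NLess (NVar ''u'') (NVar ''n'')) (Seq (scan push) extr))"

text \<open>\<open>qinv \<sigma> Q j \<phi>\<close>: the queue holds \<open>Q\<close> with potential \<open>\<phi>\<close> and admits \<open>j\<close> more insertions.\<close>

locale vertex_queue =
  fixes push extr :: com
    and qinv :: "state \<Rightarrow> nat set \<Rightarrow> nat \<Rightarrow> nat \<Rightarrow> bool"
    and ok :: "ereal \<Rightarrow> bool" and A E :: nat
  assumes push: "qinv \<sigma> Q (Suc j) \<phi> \<Longrightarrow> nvar \<sigma> ''v'' < nvar \<sigma> ''n'' \<Longrightarrow> ok c \<Longrightarrow>
      rvar \<sigma> ''x'' = rvar \<sigma> ''du'' + c \<Longrightarrow> rvar \<sigma> ''x'' < rarr \<sigma> ''d'' (nvar \<sigma> ''v'') \<Longrightarrow>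
      exec push \<sigma> (\<lambda>k \<sigma>'. \<exists>\<phi>'. k + \<phi>' \<le> \<phi> + A \<and>
        rarr \<sigma>' ''d'' = (rarr \<sigma> ''d'')(nvar \<sigma> ''v'' := rvar \<sigma> ''x'') \<and>
        qinv \<sigma>' (insert (nvar \<sigma> ''v'') Q) j \<phi>')"
    and extr: "qinv \<sigma> Q j \<phi> \<Longrightarrow> Q \<subseteq> {..<nvar \<sigma> ''n''} \<Longrightarrow> exec extr \<sigma> (\<lambda>k \<sigma>'.
      if Q = {} then nvar \<sigma>' ''u'' = nvar \<sigma> ''n'' \<and> k \<le> \<phi> + E
      else \<exists>\<phi>'. k + \<phi>' \<le> \<phi> + E \<and> nvar \<sigma>' ''u'' \<in> Q \<and>
        (\<forall>v\<in>Q. rarr \<sigma> ''d'' (nvar \<sigma>' ''u'') \<le> rarr \<sigma> ''d'' v) \<and>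
        rvar \<sigma>' ''du'' = rarr \<sigma> ''d'' (nvar \<sigma>' ''u'') \<and> qinv \<sigma>' (Q - {nvar \<sigma>' ''u''}) j \<phi>')"
    and qinv_agree: "agree {NV ''i'', NV ''e'', NV ''v'', RV ''x''} \<sigma> \<sigma>' \<Longrightarrow> qinv \<sigma> Q j \<phi> \<Longrightarrow> qinv \<sigma>' Q j \<phi>"
    and writes_push: "writes push \<inter> {NV ''n'', NV ''i'', NV ''e'', NV ''u'', RV ''du'',
      NA ''off'', NA ''adj'', NA ''inS'', RA ''wt''} = {}"
    and writes_extr: "writes extr \<inter> {NV ''n'', NA ''off'', NA ''adj'', NA ''inS'', RA ''wt'', RA ''d''} = {}"

locale graph_search = weighted_graph G w + vertex_queue push extr qinv ok A E
  for G w push extr qinv ok A E +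
  fixes \<sigma>\<^sub>0 :: state and S :: "nat set"
  assumes input: "holds_input \<sigma>\<^sub>0 G w S"
    and weights_ok: "\<And>e. e \<in> parcs G \<Longrightarrow> ok (ereal (w e))"
begin

definition static :: "state \<Rightarrow> bool" where
  "static \<sigma> \<longleftrightarrow> nvar \<sigma> ''n'' = nvar \<sigma>\<^sub>0 ''n'' \<and> narr \<sigma> ''off'' = narr \<sigma>\<^sub>0 ''off'' \<and>
    narr \<sigma> ''adj'' = narr \<sigma>\<^sub>0 ''adj'' \<and> narr \<sigma> ''inS'' = narr \<sigma>\<^sub>0 ''inS'' \<and> rarr \<sigma> ''wt'' = rarr \<sigma>\<^sub>0 ''wt''"

text \<open>The credits reserved for vertices not yet finished: each is still to be extracted at
  most once, with cost \<open>E\<close>, and each of its arcs scanned at most once, with at most one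
  insertion of cost \<open>A\<close>. The terms 50 absorb the loop overhead.\<close>

definition todo :: "nat set \<Rightarrow> nat" where
  "todo U = (\<Sum>v\<in>U. (A + 50) * degree G v + (E + 50))"

lemma push_keeps:
  assumes ag: "agree (writes push) \<sigma> \<sigma>'"
  shows "static \<sigma>' \<longleftrightarrow> static \<sigma>" "nvar \<sigma>' ''i'' = nvar \<sigma> ''i''" "nvar \<sigma>' ''e'' = nvar \<sigma> ''e''"
    "nvar \<sigma>' ''u'' = nvar \<sigma> ''u''" "rvar \<sigma>' ''du'' = rvar \<sigma> ''du''"
proof -
  have "l \<notin> writes push" if "l \<in> {NV ''n'', NV ''i'', NV ''e'', NV ''u'', RV ''du'',
      NA ''off'', NA ''adj'', NA ''inS'', RA ''wt''}" for l
    using writes_push that by blast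
  then show "static \<sigma>' \<longleftrightarrow> static \<sigma>" "nvar \<sigma>' ''i'' = nvar \<sigma> ''i''" "nvar \<sigma>' ''e'' = nvar \<sigma> ''e''"
    "nvar \<sigma>' ''u'' = nvar \<sigma> ''u''" "rvar \<sigma>' ''du'' = rvar \<sigma> ''du''"
    by (simp_all add: static_def agreeD[OF ag])
qed

lemma extr_keeps:
  assumes ag: "agree (writes extr) \<sigma> \<sigma>'"
  shows "static \<sigma>' \<longleftrightarrow> static \<sigma>" "rarr \<sigma>' ''d'' = rarr \<sigma> ''d''"
proof -
  have "l \<notin> writes extr" if "l \<in> {NV ''n'', NA ''off'', NA ''adj'', NA ''inS'', RA ''wt'', RA ''d''}" for l
    using writes_extr that by blast
  then show "static \<sigma>' \<longleftrightarrow> static \<sigma>" "rarr \<sigma>' ''d'' = rarr \<sigma> ''d''"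
    by (simp_all add: static_def agreeD[OF ag])
qed

text \<open>An arc causes at most one insertion, so a scan uses at most \<open>degree\<close> of the
  \<open>j\<close> insertions allowed and leaves \<open>c\<close> for later. As the unfinished set
  is unchanged, the credits reserved for it are not affected.\<close>

lemma scan:
  assumes static: "static \<sigma>" and scan: "scanning s Q (rarr \<sigma> ''d'') (nvar \<sigma> ''u'') {}"
    and q: "qinv \<sigma> Q j \<phi>" and du: "rvar \<sigma> ''du'' = rarr \<sigma> ''d'' (nvar \<sigma> ''u'')"
    and j: "degree G (nvar \<sigma> ''u'') + c \<le> j"
  shows "exec (scan push) \<sigma> (\<lambda>k \<sigma>'. static \<sigma>' \<and> (\<exists>Q' j' \<phi>'. k + \<phi>' \<le> \<phi> + (A + 50) * degree G (nvar \<sigma> ''u'') + 20 \<and>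
    dijkstra s Q' (rarr \<sigma>' ''d'') \<and> qinv \<sigma>' Q' j' \<phi>' \<and>
    unfinished Q' (rarr \<sigma>' ''d'') = unfinished Q (rarr \<sigma> ''d'') \<and> c \<le> j'))"
proof -
  define u n off adj where defs: "u = nvar \<sigma> ''u''" "n = nvar \<sigma>\<^sub>0 ''n''" "off = narr \<sigma>\<^sub>0 ''off''" "adj = narr \<sigma>\<^sub>0 ''adj''"
  note inp = holds_inputD[OF input, folded defs(2,3,4)]
  have un: "u < n" using scan inp(1) unfolding scanning_def defs by auto
  define U where "U = unfinished Q (rarr \<sigma> ''d'')"
  define Inv where "Inv \<tau> \<psi> \<longleftrightarrow> static \<tau> \<and> nvar \<tau> ''u'' = u \<and> nvar \<tau> ''e'' = off (Suc u) \<and>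
    off u \<le> nvar \<tau> ''i'' \<and> nvar \<tau> ''i'' \<le> off (Suc u) \<and> rvar \<tau> ''du'' = rarr \<tau> ''d'' u \<and>
    (\<exists>Q j \<phi>. scanning s Q (rarr \<tau> ''d'') u (adj ` {off u..<nvar \<tau> ''i''}) \<and> qinv \<tau> Q j \<phi> \<and>
      unfinished Q (rarr \<tau> ''d'') = U \<and> off (Suc u) - nvar \<tau> ''i'' + c \<le> j \<and>
      \<psi> = \<phi> + (A + 50) * (off (Suc u) - nvar \<tau> ''i''))" for \<tau> \<psi>
  have InvI: "Inv \<tau> (\<phi> + (A + 50) * (off (Suc u) - i))"
    if "static \<tau>" "nvar \<tau> ''u'' = u" "nvar \<tau> ''e'' = off (Suc u)" "nvar \<tau> ''i'' = i" "off u \<le> i" "i \<le> off (Suc u)"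
      "rarr \<tau> ''d'' = d" "rvar \<tau> ''du'' = d u"
      "scanning s Q d u (adj ` {off u..<i})" "qinv \<tau> Q j \<phi>" "unfinished Q d = U" "off (Suc u) - i + c \<le> j"
    for \<tau> i d Q j \<phi>
    unfolding Inv_def using that by blast
  define \<sigma>1 where "\<sigma>1 = \<sigma>\<lparr>nvar := (nvar \<sigma>)(''i'' := off u, ''e'' := off (Suc u))\<rparr>"
  let ?b = "NLess (NVar ''i'') (NVar ''e'')"
  let ?body = "Seq (NAssign ''v'' (NGet ''adj'' (NVar ''i'')))
        (Seq (RAssign ''x'' (Add (RVar ''du'') (RGet ''wt'' (NVar ''i''))))
        (Seq (Cond (RLess (RVar ''x'') (RGet ''d'' (NVar ''v''))) push Skip)
          (NAssign ''i'' (Inc (NVar ''i'')))))"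
  have loop: "exec (While ?b ?body) \<sigma>1 (\<lambda>k \<tau>. \<exists>\<psi>. Inv \<tau> \<psi> \<and> \<not> bval ?b \<tau> \<and>
      k + \<psi> \<le> \<phi> + (A + 50) * degree G u + bcost ?b + 1)"
  proof (rule exec_While[where I = Inv])
    have "agree {NV ''i'', NV ''e'', NV ''v'', RV ''x''} \<sigma> \<sigma>1" by (simp add: agree_def \<sigma>1_def)
    from qinv_agree[OF this q] have "qinv \<sigma>1 Q j \<phi>" .
    moreover have "static \<sigma>1" using static unfolding static_def by (simp add: \<sigma>1_def)
    ultimately show "Inv \<sigma>1 (\<phi> + (A + 50) * degree G u)"
      unfolding inp(5)[OF un, symmetric] using inp(2)[OF un] inp(5)[OF un] scan du j
      by (intro InvI[where d = "rarr \<sigma> ''d''" and Q = Q and j = j])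
        (simp_all add: \<sigma>1_def U_def defs(1)[symmetric])
    show "exec ?body \<tau> (\<lambda>k \<tau>'. \<exists>\<psi>'. Inv \<tau>' \<psi>' \<and> k + bcost ?b + 1 + \<psi>' \<le> \<psi>)"
      if inv: "Inv \<tau> \<psi>" and b: "bval ?b \<tau>" for \<tau> \<psi>
    proof -
      define i d where "i = nvar \<tau> ''i''" and "d = rarr \<tau> ''d''"
      obtain Q j \<phi> where st: "static \<tau>" and u: "nvar \<tau> ''u'' = u" "nvar \<tau> ''e'' = off (Suc u)"
        and i: "off u \<le> i" "i < off (Suc u)" and du: "rvar \<tau> ''du'' = d u"
        and sc: "scanning s Q d u (adj ` {off u..<i})" and q: "qinv \<tau> Q j \<phi>"
        and U: "unfinished Q d = U" and j: "off (Suc u) - i + c \<le> j"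
        and \<psi>: "\<psi> = \<phi> + (A + 50) * (off (Suc u) - i)"
        using inv b unfolding Inv_def i_def d_def by auto
      define v where "v = adj i"
      define x where "x = d u + ereal (w (u, v))"
      have arc: "(u, v) \<in> parcs G" and wt: "rarr \<sigma>\<^sub>0 ''wt'' i = ereal (w (u, v))"
        using inp(4)[OF un, of i] i unfolding v_def by auto
      have vn: "v < n" using in_arcsD2[OF arc] inp(1) by simp
      have ins: "insert v (adj ` {off u..<i}) = adj ` {off u..<Suc i}"
        using i unfolding v_def by (simp add: atLeastLessThanSuc)
      obtain j' where j': "j = Suc j'" "off (Suc u) - Suc i + c \<le> j'" using j i by (cases j) auto
      have step: "(A + 50) * (off (Suc u) - i) = (A + 50) * (off (Suc u) - Suc i) + (A + 50)"
        using i by (simp add: Suc_diff_Suc[symmetric] del: Suc_diff_Suc)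
      define \<tau>1 where "\<tau>1 = \<tau>\<lparr>nvar := (nvar \<tau>)(''v'' := v), rvar := (rvar \<tau>)(''x'' := x)\<rparr>"
      have ag1: "agree {NV ''i'', NV ''e'', NV ''v'', RV ''x''} \<tau> \<tau>1" by (simp add: agree_def \<tau>1_def)
      have t1: "nvar \<tau>1 ''v'' = v" "rvar \<tau>1 ''x'' = x" "rarr \<tau>1 ''d'' = d" "nvar \<tau>1 ''n'' = n"
        "rvar \<tau>1 ''du'' = d u" "static \<tau>1" "nvar \<tau>1 ''i'' = i" "nvar \<tau>1 ''u'' = u" "nvar \<tau>1 ''e'' = off (Suc u)"
        using st u du i by (simp_all add: \<tau>1_def d_def static_def defs(2) i_def)
      let ?rest = "Seq (Cond (RLess (RVar ''x'') (RGet ''d'' (NVar ''v''))) push Skip) (NAssign ''i'' (Inc (NVar ''i'')))"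
      have "exec ?rest \<tau>1 (\<lambda>k \<tau>'. \<exists>\<psi>'. Inv \<tau>' \<psi>' \<and> k + 20 + \<psi>' \<le> \<psi>)"
      proof (cases "x < d v")
        case True
        note relax = scanning_relax[OF sc arc True[unfolded x_def], folded x_def]
        have "exec push \<tau>1 (\<lambda>k \<sigma>'. \<exists>\<phi>'. k + \<phi>' \<le> \<phi> + A \<and> rarr \<sigma>' ''d'' = d(v := x) \<and>
          qinv \<sigma>' (insert v Q) j' \<phi>')"
          using push[OF qinv_agree[OF ag1 q, unfolded j'(1)] _ weights_ok[OF arc]] vn True
          by (simp add: t1 x_def)
        then have "exec push \<tau>1 (\<lambda>k \<tau>'. \<exists>\<psi>'. Inv (\<tau>'\<lparr>nvar := (nvar \<tau>')(''i'' := Suc (nvar \<tau>' ''i''))\<rparr>) \<psi>' \<and> k + 30 + \<psi>' \<le> \<psi>)"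
        proof (rule exec_agree, elim exE conjE)
          fix k \<phi>' :: nat and \<tau>' :: state
          assume ag: "agree (writes push) \<tau>1 \<tau>'" and k: "k + \<phi>' \<le> \<phi> + A"
            and d': "rarr \<tau>' ''d'' = d(v := x)" and q': "qinv \<tau>' (insert v Q) j' \<phi>'"
          define \<tau>'' where "\<tau>'' = \<tau>'\<lparr>nvar := (nvar \<tau>')(''i'' := Suc (nvar \<tau>' ''i''))\<rparr>"
          have ag'': "agree {NV ''i'', NV ''e'', NV ''v'', RV ''x''} \<tau>' \<tau>''" by (simp add: agree_def \<tau>''_def)
          have keep: "static \<tau>''" "nvar \<tau>'' ''i'' = Suc i" "nvar \<tau>'' ''e'' = off (Suc u)" "nvar \<tau>'' ''u'' = u"
            "rvar \<tau>'' ''du'' = d u" "rarr \<tau>'' ''d'' = d(v := x)"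
            using push_keeps[OF ag] t1 d' by (simp_all add: \<tau>''_def static_def)
          \<comment> \<open>The register \<open>du\<close> caches the label of \<open>u\<close>; the
            cache stays valid because the label that changes belongs to another vertex.\<close>
          have "u \<noteq> v" using relax(3) sc unfolding scanning_def by auto
          then have "Inv \<tau>'' (\<phi>' + (A + 50) * (off (Suc u) - Suc i))"
            using i relax(1,2) U j'(2) qinv_agree[OF ag'' q'] keep
            by (intro InvI[where d = "d(v := x)" and Q = "insert v Q" and j = j']) (simp_all add: ins)
          then show "\<exists>\<psi>'. Inv (\<tau>'\<lparr>nvar := (nvar \<tau>')(''i'' := Suc (nvar \<tau>' ''i''))\<rparr>) \<psi>' \<and> k + 30 + \<psi>' \<le> \<psi>"
            using k unfolding \<tau>''_def \<psi> step by (intro exI conjI) auto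
        qed
        then show ?thesis
          using True by (auto simp: t1 elim!: exec_mono)
      next
        case False
        define \<tau>'' where "\<tau>'' = \<tau>1\<lparr>nvar := (nvar \<tau>1)(''i'' := Suc i)\<rparr>"
        have ag'': "agree {NV ''i'', NV ''e'', NV ''v'', RV ''x''} \<tau>1 \<tau>''" by (simp add: agree_def \<tau>''_def)
        have keep: "static \<tau>''" "nvar \<tau>'' ''i'' = Suc i" "nvar \<tau>'' ''e'' = off (Suc u)" "nvar \<tau>'' ''u'' = u"
          "rvar \<tau>'' ''du'' = d u" "rarr \<tau>'' ''d'' = d"
          using t1 by (simp_all add: \<tau>''_def static_def)
        have "Inv \<tau>'' (\<phi> + (A + 50) * (off (Suc u) - Suc i))"
          using i U j' scanning_skip[OF sc, of v] False qinv_agree[OF ag'' qinv_agree[OF ag1 q]] keep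
          by (intro InvI[where d = d and Q = Q and j = j]) (simp_all add: ins x_def)
        then show ?thesis
          using False unfolding \<psi> step \<tau>''_def
          by (auto simp: t1 intro!: exI[of _ "\<phi> + (A + 50) * (off (Suc u) - Suc i)"])
      qed
      then have rest: "exec ?rest \<tau>1 (\<lambda>k \<tau>'. \<exists>\<psi>'. Inv \<tau>' \<psi>' \<and> 3 + (5 + k) + bcost ?b + 1 + \<psi>' \<le> \<psi>)"
        by (rule exec_mono) auto
      show ?thesis
      proof (rule exec_SeqI[where Q' = "\<lambda>k \<tau>'. k = 3 \<and> \<tau>' = \<tau>\<lparr>nvar := (nvar \<tau>)(''v'' := v)\<rparr>"],
          goal_cases)
        case 1
        show ?case using st by (simp add: static_def v_def i_def defs)
      next
        case (2 k2 \<tau>2)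
        show ?case
        proof (rule exec_SeqI[where Q' = "\<lambda>k \<tau>'. k = 5 \<and> \<tau>' = \<tau>1"], goal_cases)
          case 1
          show ?case using 2 st du wt by (simp add: \<tau>1_def static_def x_def i_def)
        next
          case (2 k3 \<tau>3)
          with \<open>k2 = 3 \<and> _\<close> rest show ?case by simp
        qed
      qed
    qed
  qed blast
  have "exec (scan push) \<sigma> Q \<longleftrightarrow> exec (While ?b ?body) \<sigma>1 (\<lambda>k. Q (7 + k))" for Q
    using static by (simp add: scan_def \<sigma>1_def static_def defs eval_nat_numeral)
  moreover have "static \<tau> \<and> (\<exists>Q' j' \<phi>'. 7 + k + \<phi>' \<le> \<phi> + (A + 50) * degree G u + 20 \<and>
    dijkstra s Q' (rarr \<tau> ''d'') \<and> qinv \<tau> Q' j' \<phi>' \<and>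
    unfinished Q' (rarr \<tau> ''d'') = U \<and> c \<le> j')"
    if inv: "Inv \<tau> \<psi>" and b: "\<not> bval ?b \<tau>" and k: "k + \<psi> \<le> \<phi> + (A + 50) * degree G u + bcost ?b + 1" for k \<tau> \<psi>
  proof -
    obtain Q' j' \<phi>' where "static \<tau>" and sc: "scanning s Q' (rarr \<tau> ''d'') u (adj ` {off u..<off (Suc u)})"
      and "qinv \<tau> Q' j' \<phi>'" "unfinished Q' (rarr \<tau> ''d'') = U" "c \<le> j'" "\<psi> = \<phi>'"
      using inv b unfolding Inv_def by auto
    moreover have "dijkstra s Q' (rarr \<tau> ''d'')"
      using scanning_done[OF sc] inp(3)[OF un] by simp
    ultimately show ?thesis using k by (auto intro!: exI)
  qed
  ultimately show ?thesis
    unfolding defs(1)[symmetric] U_def[symmetric] by (auto intro!: exec_mono[OF loop])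
qed

lemma finite_unfinished: "finite (unfinished Q d)"
  unfolding unfinished_def using pair_finite_verts by simp

text \<open>While a vertex \<open>u\<close> has been extracted but not scanned, the supply covers
  its scan, the extraction that follows, and the share of every unfinished vertex. Reaching
  \<open>u = n\<close> signals an empty queue.\<close>

definition loop_inv :: "nat \<Rightarrow> state \<Rightarrow> nat \<Rightarrow> bool" where
  "loop_inv s \<sigma> \<psi> \<longleftrightarrow> static \<sigma> \<and>
    (if nvar \<sigma> ''u'' < nvar \<sigma>\<^sub>0 ''n'' then \<exists>Q j \<phi>.
      scanning s Q (rarr \<sigma> ''d'') (nvar \<sigma> ''u'') {} \<and> qinv \<sigma> Q j \<phi> \<and>
      rvar \<sigma> ''du'' = rarr \<sigma> ''d'' (nvar \<sigma> ''u'') \<and>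
      degree G (nvar \<sigma> ''u'') + (\<Sum>v\<in>unfinished Q (rarr \<sigma> ''d''). degree G v) \<le> j \<and>
      \<psi> = \<phi> + (A + 50) * degree G (nvar \<sigma> ''u'') + (E + 50) + todo (unfinished Q (rarr \<sigma> ''d''))
     else dijkstra s {} (rarr \<sigma> ''d''))"

lemma extr_loop_inv:
  assumes static: "static \<sigma>" and dij: "dijkstra s Q (rarr \<sigma> ''d'')" and q: "qinv \<sigma> Q j \<phi>"
    and j: "(\<Sum>v\<in>unfinished Q (rarr \<sigma> ''d''). degree G v) \<le> j"
  shows "exec extr \<sigma> (\<lambda>k \<sigma>'. \<exists>\<psi>. loop_inv s \<sigma>' \<psi> \<and>
    k + \<psi> \<le> \<phi> + E + todo (unfinished Q (rarr \<sigma> ''d'')))"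
proof -
  define d where "d = rarr \<sigma> ''d''"
  have n: "nvar \<sigma> ''n'' = nvar \<sigma>\<^sub>0 ''n''" using static unfolding static_def by blast
  have Q: "Q \<subseteq> {..<nvar \<sigma> ''n''}" using dij holds_inputD(1)[OF input] unfolding dijkstra_def n by simp
  show ?thesis
  proof (rule exec_agree[OF extr[OF q Q]], goal_cases)
    case (1 k \<sigma>')
    note post = 1(1) and ag = 1(2)
    have static': "static \<sigma>'" and d': "rarr \<sigma>' ''d'' = d" using extr_keeps[OF ag] static d_def by auto
    show ?case
    proof (cases "Q = {}")
      case True
      then have "loop_inv s \<sigma>' 0" using static' dij post unfolding loop_inv_def d' n d_def by simp
      then show ?thesis using post True by (intro exI[of _ 0]) simp
    next
      case False
      define u where "u = nvar \<sigma>' ''u''"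
      obtain \<phi>' where \<phi>': "k + \<phi>' \<le> \<phi> + E" and u: "u \<in> Q" "\<And>v. v \<in> Q \<Longrightarrow> d u \<le> d v" "rvar \<sigma>' ''du'' = d u"
        and q': "qinv \<sigma>' (Q - {u}) j \<phi>'"
        using post False unfolding u_def d_def by auto
      note ex = dijkstra_extract[OF dij[folded d_def] u(1,2)]
      have un: "u < nvar \<sigma>\<^sub>0 ''n''" using u(1) Q n by auto
      let ?\<psi> = "\<phi>' + (A + 50) * degree G u + (E + 50) + todo (unfinished (Q - {u}) d)"
      have "degree G u + (\<Sum>v\<in>unfinished (Q - {u}) d. degree G v) \<le> j"
        using j ex(2,3) finite_unfinished unfolding d_def[symmetric] by simp
      then have "loop_inv s \<sigma>' ?\<psi>"
        using static' un ex(1) q' u(3) unfolding loop_inv_def d' u_def[symmetric] by auto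
      moreover have "todo (unfinished Q d) = (A + 50) * degree G u + (E + 50) + todo (unfinished (Q - {u}) d)"
        using ex(2,3) finite_unfinished unfolding todo_def by simp
      ultimately show ?thesis using \<phi>' unfolding d_def[symmetric] by (intro exI[of _ ?\<psi>]) simp
    qed
  qed
qed

lemma search:
  assumes static: "static \<sigma>" and dij: "dijkstra s Q (rarr \<sigma> ''d'')" and q: "qinv \<sigma> Q j \<phi>"
    and j: "(\<Sum>v\<in>unfinished Q (rarr \<sigma> ''d''). degree G v) \<le> j"
  shows "exec (search push extr) \<sigma> (\<lambda>k \<sigma>'. (\<forall>v\<in>pverts G. rarr \<sigma>' ''d'' v = dist_in G w s v) \<and>
    k \<le> \<phi> + E + todo (unfinished Q (rarr \<sigma> ''d'')) + 4)"
  unfolding search_def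
proof (rule exec_SeqI[OF extr_loop_inv[OF assms]], elim exE conjE)
  fix k1 \<sigma>1 \<psi>
  assume inv1: "loop_inv s \<sigma>1 \<psi>" and k1: "k1 + \<psi> \<le> \<phi> + E + todo (unfinished Q (rarr \<sigma> ''d''))"
  let ?b = "NLess (NVar ''u'') (NVar ''n'')"
  have n: "nvar \<tau> ''n'' = nvar \<sigma>\<^sub>0 ''n''" if "loop_inv s \<tau> \<psi>" for \<tau> \<psi>
    using that unfolding loop_inv_def static_def by blast
  show "exec (While ?b (Seq (scan push) extr)) \<sigma>1 (\<lambda>l \<sigma>'.
    (\<forall>v\<in>pverts G. rarr \<sigma>' ''d'' v = dist_in G w s v) \<and>
    k1 + l \<le> \<phi> + E + todo (unfinished Q (rarr \<sigma> ''d'')) + 4)"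
  proof (rule exec_While[where I = "loop_inv s"])
    show "loop_inv s \<sigma>1 \<psi>" by (rule inv1)
    show "exec (Seq (scan push) extr) \<tau> (\<lambda>k \<tau>'. \<exists>\<psi>'. loop_inv s \<tau>' \<psi>' \<and> k + bcost ?b + 1 + \<psi>' \<le> \<psi>)"
      if inv: "loop_inv s \<tau> \<psi>" and b: "bval ?b \<tau>" for \<tau> \<psi>
    proof -
      define u d where "u = nvar \<tau> ''u''" and "d = rarr \<tau> ''d''"
      obtain Q j \<phi> where st: "static \<tau>" and sc: "scanning s Q d u {}" and q: "qinv \<tau> Q j \<phi>"
        and du: "rvar \<tau> ''du'' = d u" and j: "degree G u + (\<Sum>v\<in>unfinished Q d. degree G v) \<le> j"
        and \<psi>: "\<psi> = \<phi> + (A + 50) * degree G u + (E + 50) + todo (unfinished Q d)"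
        using inv b n[OF inv] unfolding loop_inv_def u_def d_def by auto
      show ?thesis
      proof (rule exec_SeqI[OF scan[OF st sc[unfolded u_def d_def] q du[unfolded u_def d_def] j[unfolded u_def d_def]]],
          elim conjE exE, unfold u_def[symmetric] d_def[symmetric])
        fix k \<tau>1 Q1 j1 \<phi>1
        assume st1: "static \<tau>1" and k: "k + \<phi>1 \<le> \<phi> + (A + 50) * degree G u + 20"
          and dij1: "dijkstra s Q1 (rarr \<tau>1 ''d'')" and q1: "qinv \<tau>1 Q1 j1 \<phi>1"
          and unf: "unfinished Q1 (rarr \<tau>1 ''d'') = unfinished Q d"
          and j1: "(\<Sum>v\<in>unfinished Q d. degree G v) \<le> j1"
        show "exec extr \<tau>1 (\<lambda>l \<tau>'. \<exists>\<psi>'. loop_inv s \<tau>' \<psi>' \<and> k + l + bcost ?b + 1 + \<psi>' \<le> \<psi>)"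
          using k unfolding \<psi>
          by (intro exec_mono[OF extr_loop_inv[OF st1 dij1 q1, unfolded unf, OF j1]]) auto
      qed
    qed
    show "(\<forall>v\<in>pverts G. rarr \<tau> ''d'' v = dist_in G w s v) \<and>
      k1 + k \<le> \<phi> + E + todo (unfinished Q (rarr \<sigma> ''d'')) + 4"
      if inv: "loop_inv s \<tau> \<psi>'" and b: "\<not> bval ?b \<tau>" and k: "k + \<psi>' \<le> \<psi> + bcost ?b + 1" for k \<tau> \<psi>'
    proof -
      have "dijkstra s {} (rarr \<tau> ''d'')" using inv b n[OF inv] unfolding loop_inv_def by simp
      from dijkstra_final[OF this] k k1 show ?thesis by auto
    qed
  qed
qed

end

lemma heap_vertex_queue:
  assumes "M < 2 ^ L"
  shows "vertex_queue heap_push heap_extract (heap_inv M) (\<lambda>_. True) 1560 (1600 * L + 100)"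
proof
  show "exec heap_extract \<sigma> (\<lambda>k \<sigma>'.
      if Q = {} then nvar \<sigma>' ''u'' = nvar \<sigma> ''n'' \<and> k \<le> \<phi> + (1600 * L + 100)
      else \<exists>\<phi>'. k + \<phi>' \<le> \<phi> + (1600 * L + 100) \<and> nvar \<sigma>' ''u'' \<in> Q \<and>
        (\<forall>v\<in>Q. rarr \<sigma> ''d'' (nvar \<sigma>' ''u'') \<le> rarr \<sigma> ''d'' v) \<and>
        rvar \<sigma>' ''du'' = rarr \<sigma> ''d'' (nvar \<sigma>' ''u'') \<and> heap_inv M \<sigma>' (Q - {nvar \<sigma>' ''u''}) j \<phi>')"
    if "heap_inv M \<sigma> Q j \<phi>" for \<sigma> Q j \<phi>
    using heap_extract[OF that assms] unfolding add.assoc .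
  show "heap_inv M \<sigma>' Q j \<phi>"
    if "agree {NV ''i'', NV ''e'', NV ''v'', RV ''x''} \<sigma> \<sigma>'" "heap_inv M \<sigma> Q j \<phi>" for \<sigma> \<sigma>' Q j \<phi>
    using that(2) heap_inv_agree[OF that(1)] by (simp add: heap_locs_def)
qed ((rule heap_push; assumption), auto simp: heap_push_def heap_extract_def heap_consolidate_def heap_collect_def
    heap_place_def heap_link_def heap_destroy_def)

section \<open>The first-in first-out queue for unit weights\<close>

definition queue_push :: com where
  "queue_push =
    Seq (RPut ''d'' (NVar ''v'') (RVar ''x''))
    (Seq (NPut ''qu'' (NVar ''tail'') (NVar ''v''))
      (NAssign ''tail'' (Inc (NVar ''tail''))))"

definition queue_extract :: com where
  "queue_extract =
    Cond (NLess (NVar ''head'') (NVar ''tail''))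
      (Seq (NAssign ''u'' (NGet ''qu'' (NVar ''head'')))
      (Seq (NAssign ''head'' (Inc (NVar ''head'')))
        (RAssign ''du'' (RGet ''d'' (NVar ''u'')))))
      (NAssign ''u'' (NVar ''n''))"

text \<open>With unit weights the labels in the queue are sorted and span an interval of length one.\<close>

definition queue_inv :: "state \<Rightarrow> nat set \<Rightarrow> nat \<Rightarrow> nat \<Rightarrow> bool" where
  "queue_inv \<sigma> Q j \<phi> \<longleftrightarrow> nvar \<sigma> ''head'' \<le> nvar \<sigma> ''tail'' \<and>
    (let xs = map (narr \<sigma> ''qu'') [nvar \<sigma> ''head''..<nvar \<sigma> ''tail''] in
      Q = set xs \<and> distinct xs \<and> sorted_wrt (\<lambda>a b. rarr \<sigma> ''d'' a \<le> rarr \<sigma> ''d'' b) xs \<and>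
      (\<forall>q\<in>Q. rvar \<sigma> ''du'' \<le> rarr \<sigma> ''d'' q \<and> rarr \<sigma> ''d'' q \<le> rvar \<sigma> ''du'' + 1)) \<and> \<phi> = 0"

text \<open>All queued labels lie between \<open>du\<close> and \<open>du + 1\<close>. With unit
  weights an inserted vertex gets the label \<open>du + 1\<close>, the largest possible, so
  appending keeps the queue sorted and its head is minimal. All operations take constant time, so
  the potential is 0.\<close>

lemma queue_vertex_queue: "vertex_queue queue_push queue_extract queue_inv (\<lambda>c. c = 1) 20 20"
proof
  fix \<sigma> :: state and Q j \<phi> and c :: ereal
  assume inv: "queue_inv \<sigma> Q (Suc j) \<phi>" and c: "c = 1" and x: "rvar \<sigma> ''x'' = rvar \<sigma> ''du'' + c"
    and less: "rvar \<sigma> ''x'' < rarr \<sigma> ''d'' (nvar \<sigma> ''v'')"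
  define h t v x d xs where defs: "h = nvar \<sigma> ''head''" "t = nvar \<sigma> ''tail''" "v = nvar \<sigma> ''v''"
    "x = rvar \<sigma> ''x''" "d = rarr \<sigma> ''d''" "xs = map (narr \<sigma> ''qu'') [h..<t]"
  have q: "h \<le> t" "Q = set xs" "distinct xs" "sorted_wrt (\<lambda>a b. d a \<le> d b) xs"
    and du: "\<And>q. q \<in> set xs \<Longrightarrow> rvar \<sigma> ''du'' \<le> d q \<and> d q \<le> x"
    using inv x c unfolding queue_inv_def Let_def defs by auto
  \<comment> \<open>An improvable vertex has a label above \<open>du + 1\<close> and so cannot be
    queued already: a key in the queue never has to decrease.\<close>
  have v: "v \<notin> set xs" using du[of v] less unfolding defs by auto
  define \<sigma>' where "\<sigma>' = \<sigma>\<lparr>rarr := (rarr \<sigma>)(''d'' := d(v := x)),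
    narr := (narr \<sigma>)(''qu'' := (narr \<sigma> ''qu'')(t := v)), nvar := (nvar \<sigma>)(''tail'' := Suc t)\<rparr>"
  have "map ((narr \<sigma> ''qu'')(t := v)) [h..<t] = xs" unfolding defs(6) by (auto intro: map_cong)
  then have xs': "map (narr \<sigma>' ''qu'') [nvar \<sigma>' ''head''..<nvar \<sigma>' ''tail''] = xs @ [v]"
    using q(1) by (simp add: \<sigma>'_def defs(1)[symmetric])
  have new: "rarr \<sigma>' ''d'' = d(v := x)" "nvar \<sigma>' ''head'' = h" "nvar \<sigma>' ''tail'' = Suc t"
    "rvar \<sigma>' ''du'' = rvar \<sigma> ''du''" by (simp_all add: \<sigma>'_def defs(1))
  have "sorted_wrt (\<lambda>a b. (d(v := x)) a \<le> (d(v := x)) b) xs"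
    using q(4) v by (auto elim!: sorted_wrt_mono_rel[rotated])
  then have "sorted_wrt (\<lambda>a b. (d(v := x)) a \<le> (d(v := x)) b) (xs @ [v])"
    using du v by (auto simp: sorted_wrt_append)
  moreover have "rvar \<sigma> ''du'' \<le> x" unfolding defs using x c by (cases "rvar \<sigma> ''du''") auto
  then have "rvar \<sigma> ''du'' \<le> (d(v := x)) a \<and> (d(v := x)) a \<le> rvar \<sigma> ''du'' + 1" if "a \<in> set (xs @ [v])" for a
    using that du[of a] v x c unfolding defs(4) by auto
  ultimately have "queue_inv \<sigma>' (insert v Q) j 0"
    unfolding queue_inv_def Let_def xs' unfolding new using q v by auto
  moreover have "exec queue_push \<sigma> (\<lambda>k \<tau>. k \<le> 20 \<and> \<tau> = \<sigma>')"
    by (simp add: queue_push_def \<sigma>'_def defs)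
  ultimately show "exec queue_push \<sigma> (\<lambda>k \<sigma>'. \<exists>\<phi>'. k + \<phi>' \<le> \<phi> + 20 \<and>
      rarr \<sigma>' ''d'' = (rarr \<sigma> ''d'')(nvar \<sigma> ''v'' := rvar \<sigma> ''x'') \<and>
      queue_inv \<sigma>' (insert (nvar \<sigma> ''v'') Q) j \<phi>')"
    using new(1) unfolding defs by (auto elim!: exec_mono intro!: exI[of _ 0])
next
  fix \<sigma> :: state and Q j \<phi>
  assume inv: "queue_inv \<sigma> Q j \<phi>"
  define h t d xs where defs: "h = nvar \<sigma> ''head''" "t = nvar \<sigma> ''tail''"
    "d = rarr \<sigma> ''d''" "xs = map (narr \<sigma> ''qu'') [h..<t]"
  have q: "h \<le> t" "Q = set xs" "distinct xs" "sorted_wrt (\<lambda>a b. d a \<le> d b) xs"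
    and du: "\<And>q. q \<in> set xs \<Longrightarrow> rvar \<sigma> ''du'' \<le> d q \<and> d q \<le> rvar \<sigma> ''du'' + 1" and \<phi>: "\<phi> = 0"
    using inv unfolding queue_inv_def Let_def defs by auto
  show "exec queue_extract \<sigma> (\<lambda>k \<sigma>'.
      if Q = {} then nvar \<sigma>' ''u'' = nvar \<sigma> ''n'' \<and> k \<le> \<phi> + 20
      else \<exists>\<phi>'. k + \<phi>' \<le> \<phi> + 20 \<and> nvar \<sigma>' ''u'' \<in> Q \<and>
        (\<forall>v\<in>Q. rarr \<sigma> ''d'' (nvar \<sigma>' ''u'') \<le> rarr \<sigma> ''d'' v) \<and>
        rvar \<sigma>' ''du'' = rarr \<sigma> ''d'' (nvar \<sigma>' ''u'') \<and> queue_inv \<sigma>' (Q - {nvar \<sigma>' ''u''}) j \<phi>')"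
  proof (cases "h < t")
    case False
    then have "Q = {}" using q unfolding defs by simp
    then show ?thesis using False by (simp add: queue_extract_def defs(1,2))
  next
    case True
    define u ys where "u = narr \<sigma> ''qu'' h" and "ys = map (narr \<sigma> ''qu'') [Suc h..<t]"
    have xs: "xs = u # ys" unfolding defs(4) u_def ys_def using True by (simp add: upt_conv_Cons)
    define \<sigma>' where "\<sigma>' = \<sigma>\<lparr>nvar := (nvar \<sigma>)(''u'' := u, ''head'' := Suc h), rvar := (rvar \<sigma>)(''du'' := d u)\<rparr>"
    have new: "nvar \<sigma>' ''u'' = u" "rvar \<sigma>' ''du'' = d u" "rarr \<sigma>' ''d'' = d" by (simp_all add: \<sigma>'_def defs)
    have ys': "map (narr \<sigma>' ''qu'') [nvar \<sigma>' ''head''..<nvar \<sigma>' ''tail''] = ys"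
      unfolding ys_def by (simp add: \<sigma>'_def defs)
    \<comment> \<open>The interval moves up with its lower end: \<open>d a\<close> is at most the
      old \<open>du + 1\<close>, and the old \<open>du\<close> is at most
      \<open>d u\<close>.\<close>
    have "d a \<le> d u + 1" if "a \<in> set ys" for a
      using du[of a] du[of u] that unfolding xs by (auto intro: order_trans add_right_mono)
    then have "queue_inv \<sigma>' (Q - {u}) j 0"
      unfolding queue_inv_def Let_def ys' unfolding new using q True unfolding xs by (auto simp: \<sigma>'_def defs(2)[symmetric])
    moreover have "exec queue_extract \<sigma> (\<lambda>k \<tau>. k \<le> 20 \<and> \<tau> = \<sigma>')"
      using True by (simp add: queue_extract_def \<sigma>'_def defs u_def)
    moreover have "u \<in> Q" "\<forall>v\<in>Q. d u \<le> d v" using q unfolding xs by auto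
    ultimately show ?thesis
      using new unfolding defs(3)[symmetric] by (auto elim!: exec_mono)
  qed
next
  fix \<sigma> \<sigma>' :: state and Q j \<phi>
  assume ag: "agree {NV ''i'', NV ''e'', NV ''v'', RV ''x''} \<sigma> \<sigma>'" and "queue_inv \<sigma> Q j \<phi>"
  then show "queue_inv \<sigma>' Q j \<phi>" unfolding queue_inv_def by (simp add: agreeD[OF ag])
qed (auto simp: queue_push_def queue_extract_def)

section \<open>The radius estimate\<close>

text \<open>An arc is determined by its edge and its direction, the latter encoded as the truth
  value of \<open>u < v\<close>.\<close>

lemma card_parcs_le: "card (parcs G) \<le> 2 * num_edges G" if "finite (parcs G)" for G :: "nat pair_pre_digraph"
proof -
  let ?f = "\<lambda>(u, v). ({u, v}, u < v) :: nat set \<times> bool"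
  have "inj_on ?f (parcs G)" by (auto simp: inj_on_def doubleton_eq_iff)
  then have "card (parcs G) = card (?f ` parcs G)" by (simp add: card_image)
  also have "\<dots> \<le> card (((\<lambda>(u, v). {u, v}) ` parcs G) \<times> (UNIV :: bool set))"
    using that by (intro card_mono) (auto simp: image_iff)
  finally show ?thesis unfolding num_edges_def by (simp add: card_cartesian_product)
qed

section \<open>Counting arcs, and eccentricities against the radius\<close>

context weighted_graph
begin

lemma card_parcs: "card (parcs G) = (\<Sum>u\<in>pverts G. degree G u)"
proof -
  have "parcs G = (SIGMA u:pverts G. {v. (u, v) \<in> parcs G})" using in_arcsD1 by auto
  then have "card (parcs G) = card (SIGMA u:pverts G. {v. (u, v) \<in> parcs G})" by simp
  also have "\<dots> = (\<Sum>u\<in>pverts G. degree G u)"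
    unfolding degree_def
  proof (rule card_SigmaI)
    show "\<forall>u\<in>pverts G. finite {v. (u, v) \<in> parcs G}"
      using in_arcsD2 pair_finite_verts by (auto intro: finite_subset[of _ "pverts G"])
  qed (rule pair_finite_verts)
  finally show ?thesis .
qed

text \<open>There are no loops, so the arcs and the n diagonal pairs are disjoint subsets of the n^2
  pairs. The left-hand side is the number of heap nodes that a search may create.\<close>

lemma card_parcs_less: "2 \<le> card (pverts G) \<Longrightarrow> card (parcs G) + 1 < card (pverts G) ^ 2"
proof -
  assume n: "2 \<le> card (pverts G)"
  let ?D = "(\<lambda>v. (v, v)) ` pverts G"
  have "parcs G \<union> ?D \<subseteq> pverts G \<times> pverts G" using in_arcsD1 in_arcsD2 by auto
  then have "card (parcs G \<union> ?D) \<le> card (pverts G \<times> pverts G)"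
    using pair_finite_verts by (intro card_mono) auto
  moreover have "card (parcs G \<union> ?D) = card (parcs G) + card ?D"
    using pair_finite_verts pair_finite_arcs no_loops' by (intro card_Un_disjoint) auto
  moreover have "card ?D = card (pverts G)" by (intro card_image) (auto simp: inj_on_def)
  ultimately show ?thesis using n by (simp add: card_cartesian_product power2_eq_square)
qed

context
  fixes S T :: "nat set"
  assumes S: "S \<subseteq> pverts G" "S \<noteq> {}" and T: "T = pverts G - S" "T \<noteq> {}"
begin

lemma finite_S: "finite S" and finite_T: "finite T"
  using S(1) T(1) pair_finite_verts by (auto intro: finite_subset)

lemma radius_le: "s \<in> S \<Longrightarrow> ST_radius G w S T \<le> ST_ecc G w T s"
  unfolding ST_radius_def using finite_S by (intro Min_le) auto

lemma ecc_le:
  assumes "s \<in> S" "t \<in> T" "(s, t) \<in> parcs G"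
  shows "ST_ecc G w T s \<le> 2 * ST_radius G w S T + w (s, t)"
proof -
  define R where "R = ST_radius G w S T"
  have "R \<in> ST_ecc G w T ` S" unfolding R_def ST_radius_def using finite_S S by (intro Min_in) auto
  then obtain c where c: "c \<in> S" "R = ST_ecc G w T c" by blast
  have R: "dist_in G w c u \<le> R" if "u \<in> T" for u
    unfolding c(2) ST_ecc_def using that finite_T by (intro Max_ge) auto
  have R0: "0 \<le> R" using R[OF assms(2)] dist_nonneg order_trans by blast
  have "dist_in G w s u \<le> 2 * R + w (s, t)" if "u \<in> T" for u
  proof -
    have "dist_in G w s t \<le> w (s, t)"
      using dist_step[OF assms(3), of s] dist_self[of s] assms S by auto
    then have "dist_in G w s u \<le> w (s, t) + (dist_in G w t c + dist_in G w c u)"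
      using dist_triangle[of s u t] dist_triangle[of t u c] by (meson add_mono order_trans)
    also have "\<dots> \<le> w (s, t) + (R + R)"
      using R[OF assms(2)] R[OF that] dist_sym[of t c] by (intro add_mono) auto
    also have "R + R = 2 * R" using R0 by (cases R) auto
    finally show ?thesis by (simp add: add.commute)
  qed
  then show ?thesis unfolding R_def[symmetric] ST_ecc_def using finite_T T by (subst Max_le_iff) auto
qed

text \<open>The function that is 0 on \<open>S\<close> and \<infinity> elsewhere is a feasible
  potential when no arc leaves \<open>S\<close>, so \<open>le_dist\<close> makes every distance from
  \<open>S\<close> to \<open>T\<close> infinite.\<close>

lemma radius_infinite:
  assumes "parcs G \<inter> S \<times> T = {}"
  shows "ST_radius G w S T = \<infinity>"
proof -
  have "ST_ecc G w T s = \<infinity>" if "s \<in> S" for s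
  proof -
    have "dist_in G w s t = \<infinity>" if "t \<in> T" for t
    proof -
      let ?f = "\<lambda>v. if v \<in> S then 0 else \<infinity> :: ereal"
      have "?f t \<le> dist_in G w s t"
      proof (rule le_dist)
        show "?f s \<le> 0" using \<open>s \<in> S\<close> by simp
        show "?f v \<le> ?f u + w (u, v)" if "(u, v) \<in> parcs G" for u v
          using that assms T in_arcsD2[OF that] nonneg[OF that] by auto
      qed
      then show ?thesis using that T by simp
    qed
    then have "(\<lambda>t. dist_in G w s t) ` T = {\<infinity>}" using T by auto
    then show ?thesis unfolding ST_ecc_def by simp
  qed
  then have "ST_ecc G w T ` S = {\<infinity>}" using S by auto
  then show ?thesis unfolding ST_radius_def by simp
qed

end

end

section \<open>The phases of the program\<close>

lemma exec_Seq_det: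
  assumes "exec c \<sigma> (\<lambda>k \<tau>'. k = l \<and> \<tau>' = \<tau>)" "exec d \<tau> (\<lambda>k. Q (l + k))"
  shows "exec (Seq c d) \<sigma> Q"
  using assms(2) by (intro exec_SeqI[OF assms(1)]) simp

lemma holds_input_agree:
  assumes "agree L \<sigma> \<sigma>'" "L \<inter> {NV ''n'', NA ''off'', NA ''adj'', NA ''inS'', RA ''wt''} = {}"
  shows "holds_input \<sigma>' G w S \<longleftrightarrow> holds_input \<sigma> G w S"
  using assms(2) unfolding holds_input_def by (simp add: agreeD[OF assms(1)])

definition inspect_arc :: com where
  "inspect_arc =
    Seq (NAssign ''v'' (NGet ''adj'' (NVar ''i'')))
    (Seq
      (Cond (Conj (Neg (RLess (RGet ''wt'' (NVar ''i'')) One)) (Neg (RLess One (RGet ''wt'' (NVar ''i'')))))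
        Skip (NAssign ''unit'' (NConst 0)))
    (Seq
      (Cond (Conj (Conj (NLess (NConst 0) (NGet ''inS'' (NVar ''u''))) (NLess (NGet ''inS'' (NVar ''v'')) (NConst 1)))
                  (RLess (RGet ''wt'' (NVar ''i'')) (RVar ''best'')))
        (Seq (RAssign ''best'' (RGet ''wt'' (NVar ''i''))) (NAssign ''s'' (NVar ''u''))) Skip)
      (NAssign ''i'' (Inc (NVar ''i'')))))"

definition inspect_vertex :: com where
  "inspect_vertex =
    Seq (Seq (NAssign ''i'' (NGet ''off'' (NVar ''u''))) (NAssign ''e'' (NGet ''off'' (Inc (NVar ''u'')))))
    (Seq (While (NLess (NVar ''i'') (NVar ''e'')) inspect_arc)
      (NAssign ''u'' (Inc (NVar ''u''))))"

definition inspect :: com where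
  "inspect =
    Seq (Seq (RAssign ''best'' Infty) (Seq (NAssign ''unit'' (NConst 1)) (NAssign ''u'' (NConst 0))))
      (While (NLess (NVar ''u'') (NVar ''n'')) inspect_vertex)"

definition init_labels :: com where
  "init_labels =
    Seq (NAssign ''v'' (NConst 0))
      (While (NLess (NVar ''v'') (NVar ''n''))
        (Seq (RPut ''d'' (NVar ''v'') Infty)
        (Seq (NPut ''node'' (NVar ''v'') (NConst 0))
          (NAssign ''v'' (Inc (NVar ''v''))))))"

definition queue_search :: com where
  "queue_search =
    Seq
      (Seq (RPut ''d'' (NVar ''s'') Zero)
      (Seq (NPut ''qu'' (NConst 0) (NVar ''s''))
      (Seq (NAssign ''head'' (NConst 0))
      (Seq (NAssign ''tail'' (NConst 1))
        (RAssign ''du'' Zero)))))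
      (search queue_push queue_extract)"

text \<open>Constantly many assignments set up an empty heap in arbitrary memory:
  \<open>lim = 0\<close> declares the whole table empty, and a node's cells are filled when it is
  created. The source enters by an ordinary insertion with label 0.\<close>

definition heap_search :: com where
  "heap_search =
    Seq
      (Seq (NPut ''rank'' (NConst 0) (NConst 0))
      (Seq (NAssign ''roots'' (NConst 0))
      (Seq (NAssign ''lim'' (NConst 0))
      (Seq (NAssign ''cnt'' (NConst 0))
      (Seq (NAssign ''v'' (NVar ''s''))
        (RAssign ''x'' Zero))))))
    (Seq heap_push (search heap_push heap_extract))"

definition eccentricity :: com where
  "eccentricity =
    Seq (Seq (RAssign ''result'' Zero) (NAssign ''v'' (NConst 0)))
      (While (NLess (NVar ''v'') (NVar ''n''))
        (Seq
          (Cond (Conj (NLess (NGet ''inS'' (NVar ''v'')) (NConst 1)) (RLess (RVar ''result'') (RGet ''d'' (NVar ''v''))))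
            (RAssign ''result'' (RGet ''d'' (NVar ''v''))) Skip)
          (NAssign ''v'' (Inc (NVar ''v'')))))"

definition radius_estimate :: com where
  "radius_estimate =
    Seq inspect
      (Cond (RLess (RVar ''best'') Infty)
        (Seq init_labels
        (Seq (Cond (NLess (NConst 0) (NVar ''unit'')) queue_search heap_search)
          eccentricity))
        (RAssign ''result'' Infty))"

text \<open>\<open>P\<close> is the set of arcs read so far. The other end \<open>t\<close> of the
  lightest crossing arc is not stored, since only the eccentricity of \<open>s\<close> is computed
  later.\<close>

definition inspected :: "(nat \<times> nat \<Rightarrow> real) \<Rightarrow> nat set \<Rightarrow> state \<Rightarrow> (nat \<times> nat) set \<Rightarrow> bool" where
  "inspected w S \<sigma> P \<longleftrightarrow> nvar \<sigma> ''unit'' = (if \<forall>e\<in>P. w e = 1 then 1 else 0) \<and>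
    (if P \<inter> S \<times> - S = {} then rvar \<sigma> ''best'' = \<infinity>
     else \<exists>t. (nvar \<sigma> ''s'', t) \<in> P \<inter> S \<times> - S \<and> rvar \<sigma> ''best'' = w (nvar \<sigma> ''s'', t) \<and>
       (\<forall>e\<in>P \<inter> S \<times> - S. rvar \<sigma> ''best'' \<le> w e))"

lemma exec_inspect_arc:
  "exec inspect_arc \<sigma> (\<lambda>k \<sigma>'. k \<le> 50 \<and> nvar \<sigma>' ''i'' = Suc (nvar \<sigma> ''i'') \<and>
    (let v = narr \<sigma> ''adj'' (nvar \<sigma> ''i''); x = rarr \<sigma> ''wt'' (nvar \<sigma> ''i''); u = nvar \<sigma> ''u'';
         b = narr \<sigma> ''inS'' u > 0 \<and> narr \<sigma> ''inS'' v < 1 \<and> x < rvar \<sigma> ''best'' in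
      nvar \<sigma>' ''unit'' = (if x = 1 then nvar \<sigma> ''unit'' else 0) \<and>
      rvar \<sigma>' ''best'' = (if b then x else rvar \<sigma> ''best'') \<and>
      nvar \<sigma>' ''s'' = (if b then u else nvar \<sigma> ''s'')))"
  by (auto simp: inspect_arc_def Let_def)

lemma inspected_cong:
  assumes "nvar \<sigma>' ''unit'' = nvar \<sigma> ''unit''" "nvar \<sigma>' ''s'' = nvar \<sigma> ''s''" "rvar \<sigma>' ''best'' = rvar \<sigma> ''best''"
  shows "inspected w S \<sigma>' P \<longleftrightarrow> inspected w S \<sigma> P"
  unfolding inspected_def assms ..

lemma inspected_insert:
  assumes "inspected w S \<sigma> P"
    and "nvar \<sigma>' ''unit'' = (if w (u, v) = 1 then nvar \<sigma> ''unit'' else 0)"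
    and b: "b \<longleftrightarrow> u \<in> S \<and> v \<notin> S \<and> ereal (w (u, v)) < rvar \<sigma> ''best''"
    and "rvar \<sigma>' ''best'' = (if b then ereal (w (u, v)) else rvar \<sigma> ''best'')"
    and "nvar \<sigma>' ''s'' = (if b then u else nvar \<sigma> ''s'')"
  shows "inspected w S \<sigma>' (insert (u, v) P)"
proof (cases "u \<in> S \<and> v \<notin> S")
  case False
  then have set: "insert (u, v) P \<inter> S \<times> - S = P \<inter> S \<times> - S" by auto
  have same: "rvar \<sigma>' ''best'' = rvar \<sigma> ''best''" "nvar \<sigma>' ''s'' = nvar \<sigma> ''s''" using assms(3,4,5) False by auto
  show ?thesis
    unfolding inspected_def set same
  proof
    show "nvar \<sigma>' ''unit'' = (if \<forall>e\<in>insert (u, v) P. w e = 1 then 1 else 0)"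
      using assms(1,2) unfolding inspected_def by auto
  qed (rule conjunct2[OF assms(1)[unfolded inspected_def]])
next
  case True
  then have ins: "insert (u, v) P \<inter> S \<times> - S = insert (u, v) (P \<inter> S \<times> - S)" by auto
  show ?thesis
  proof (cases "P \<inter> S \<times> - S = {}")
    case empty: True
    \<comment> \<open>The initial value \<infinity> exceeds every real weight, so the first crossing
      arc is always taken.\<close>
    have "rvar \<sigma> ''best'' = \<infinity>" using assms(1) empty unfolding inspected_def by simp
    then have b using b True by simp
    moreover have "nvar \<sigma>' ''unit'' = (if \<forall>e\<in>insert (u, v) P. w e = 1 then 1 else 0)"
      using assms(1,2) unfolding inspected_def by auto
    ultimately show ?thesis using assms(4,5) unfolding inspected_def ins empty by simp
  next
    case False
    obtain t where t: "(nvar \<sigma> ''s'', t) \<in> P \<inter> S \<times> - S" "rvar \<sigma> ''best'' = w (nvar \<sigma> ''s'', t)"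
      "\<And>e. e \<in> P \<inter> S \<times> - S \<Longrightarrow> rvar \<sigma> ''best'' \<le> w e"
      using conjunct2[OF assms(1)[unfolded inspected_def], unfolded if_not_P[OF False]] by blast
    define t' where "t' = (if b then v else t)"
    have "(nvar \<sigma>' ''s'', t') \<in> insert (u, v) (P \<inter> S \<times> - S) \<and> rvar \<sigma>' ''best'' = w (nvar \<sigma>' ''s'', t')"
      using assms(4,5) t(1,2) unfolding t'_def by auto
    moreover have "rvar \<sigma>' ''best'' \<le> w e" if "e \<in> insert (u, v) (P \<inter> S \<times> - S)" for e
    proof (cases "e = (u, v)")
      case True
      then show ?thesis using assms(4) b \<open>u \<in> S \<and> v \<notin> S\<close> by auto
    next
      case False
      have "rvar \<sigma>' ''best'' \<le> rvar \<sigma> ''best''" using assms(4) b by auto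
      with that False t(3)[of e] show ?thesis by (auto intro: order_trans)
    qed
    moreover have "nvar \<sigma>' ''unit'' = (if \<forall>e\<in>insert (u, v) P. w e = 1 then 1 else 0)"
      using assms(1,2) unfolding inspected_def by auto
    ultimately show ?thesis unfolding inspected_def ins by auto
  qed
qed

lemma init_labels:
  "exec init_labels \<sigma> (\<lambda>k \<sigma>'. k \<le> 20 * nvar \<sigma> ''n'' + 10 \<and>
    (\<forall>v<nvar \<sigma> ''n''. rarr \<sigma>' ''d'' v = \<infinity> \<and> narr \<sigma>' ''node'' v = 0))"
proof -
  define n where "n = nvar \<sigma> ''n''"
  define Inv where "Inv \<tau> \<phi> \<longleftrightarrow> nvar \<tau> ''v'' \<le> n \<and> \<phi> = 20 * (n - nvar \<tau> ''v'') \<and>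
    (\<forall>v<nvar \<tau> ''v''. rarr \<tau> ''d'' v = \<infinity> \<and> narr \<tau> ''node'' v = 0)" for \<tau> :: state and \<phi>
  define \<sigma>1 where "\<sigma>1 = \<sigma>\<lparr>nvar := (nvar \<sigma>)(''v'' := 0)\<rparr>"
  show ?thesis
    unfolding init_labels_def n_def[symmetric]
  proof (rule exec_Seq_det[where l = 2 and \<tau> = \<sigma>1], simp add: \<sigma>1_def,
      rule exec_While[where I = Inv and \<phi> = "20 * n"], goal_cases)
    case 1
    show ?case by (simp add: Inv_def \<sigma>1_def)
  next
    case (2 \<tau> \<phi>)
    have "nvar \<tau> ''n'' = n" by (simp add: agreeD[OF 2(3)]) (simp add: \<sigma>1_def n_def)
    then show ?case using 2(1,2) unfolding Inv_def by (auto simp: less_Suc_eq)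
  next
    case (3 k \<tau> \<phi>)
    have "nvar \<tau> ''n'' = n" by (simp add: agreeD[OF 3(3)]) (simp add: \<sigma>1_def n_def)
    then show ?case using 3(1,2,4) unfolding Inv_def by auto
  qed
qed

lemma eccentricity:
  assumes inS: "\<And>v. v < nvar \<sigma> ''n'' \<Longrightarrow> narr \<sigma> ''inS'' v = (if v \<in> S then 1 else 0)"
    and T: "T = {..<nvar \<sigma> ''n''} - S" "T \<noteq> {}" and nonneg: "\<And>v. v \<in> T \<Longrightarrow> 0 \<le> rarr \<sigma> ''d'' v"
  shows "exec eccentricity \<sigma> (\<lambda>k \<sigma>'. k \<le> 40 * nvar \<sigma> ''n'' + 10 \<and> result \<sigma>' = Max (rarr \<sigma> ''d'' ` T))"
proof -
  define n d where "n = nvar \<sigma> ''n''" and "d = rarr \<sigma> ''d''"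
  define Inv where "Inv \<tau> \<phi> \<longleftrightarrow> nvar \<tau> ''v'' \<le> n \<and> \<phi> = 40 * (n - nvar \<tau> ''v'') \<and>
    rvar \<tau> ''result'' = Max (insert 0 (d ` ({..<nvar \<tau> ''v''} - S)))" for \<tau> :: state and \<phi>
  define \<sigma>1 where "\<sigma>1 = \<sigma>\<lparr>nvar := (nvar \<sigma>)(''v'' := 0), rvar := (rvar \<sigma>)(''result'' := 0)\<rparr>"
  show ?thesis
    unfolding eccentricity_def n_def[symmetric] d_def[symmetric]
  proof (rule exec_Seq_det[where l = 4 and \<tau> = \<sigma>1], simp add: \<sigma>1_def,
      rule exec_While[where I = Inv and \<phi> = "40 * n"], goal_cases)
    case 1
    show ?case by (simp add: Inv_def \<sigma>1_def)
  next
    case (2 \<tau> \<phi>)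
    have same: "nvar \<tau> ''n'' = n" "narr \<tau> ''inS'' = narr \<sigma> ''inS''" "rarr \<tau> ''d'' = d"
      by (simp_all add: agreeD[OF 2(3)]) (simp_all add: \<sigma>1_def n_def d_def)
    define v where "v = nvar \<tau> ''v''"
    have v: "v < n" using 2(2) by (simp add: same v_def)
    define M where "M = Max (insert 0 (d ` ({..<v} - S)))"
    have "{..<Suc v} - S = (if v \<in> S then {..<v} - S else insert v ({..<v} - S))"
      by (auto simp: less_Suc_eq)
    then have "Max (insert 0 (d ` ({..<Suc v} - S))) = (if v \<in> S then M else max (d v) M)"
      unfolding M_def by (simp add: insert_commute[of 0 "d v"])
    then show ?case
      using 2(1) v inS[of v] unfolding Inv_def v_def[symmetric] M_def[symmetric]
      by (auto simp: same v_def[symmetric] n_def[symmetric] max_def)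
  next
    case (3 k \<tau> \<phi>)
    have "nvar \<tau> ''n'' = n" by (simp add: agreeD[OF 3(3)]) (simp add: \<sigma>1_def n_def)
    then have "result \<tau> = Max (insert 0 (d ` T))" "k \<le> 40 * n + 4"
      using 3(1,2,4) unfolding Inv_def result_def T n_def by auto
    \<comment> \<open>The running maximum starts from 0; since \<open>T\<close> is nonempty and its
      labels are nonnegative, the extra 0 does not change the result.\<close>
    moreover have "0 \<le> Max (d ` T)" "finite T"
      using T nonneg unfolding d_def[symmetric] by (auto simp: Max_ge_iff)
    ultimately show ?case using T(2) by (simp add: max_absorb2)
  qed
qed

context weighted_graph
begin

lemma inspect:
  assumes input: "holds_input \<sigma> G w S"
  shows "exec inspect \<sigma> (\<lambda>k \<sigma>'. k \<le> 60 * card (parcs G) + 40 * nvar \<sigma> ''n'' + 20 \<and>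
    inspected w S \<sigma>' (parcs G))"
proof -
  define n off adj where defs: "n = nvar \<sigma> ''n''" "off = narr \<sigma> ''off''" "adj = narr \<sigma> ''adj''"
  note inp = holds_inputD[OF input, folded defs]
  \<comment> \<open>The supply is 40 credits for each vertex still to be visited and 60 for each of
    its arcs.\<close>
  define Inv where "Inv \<tau> \<phi> \<longleftrightarrow> nvar \<tau> ''u'' \<le> n \<and>
    inspected w S \<tau> {e \<in> parcs G. fst e < nvar \<tau> ''u''} \<and>
    \<phi> = (\<Sum>a\<in>{nvar \<tau> ''u''..<n}. 60 * degree G a + 40)" for \<tau> \<phi>
  define \<sigma>1 where "\<sigma>1 = \<sigma>\<lparr>rvar := (rvar \<sigma>)(''best'' := \<infinity>), nvar := (nvar \<sigma>)(''unit'' := 1, ''u'' := 0)\<rparr>"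
  have same: "nvar \<tau> ''n'' = n" "narr \<tau> ''off'' = off" "narr \<tau> ''adj'' = adj" "narr \<tau> ''inS'' = narr \<sigma> ''inS''"
    "rarr \<tau> ''wt'' = rarr \<sigma> ''wt''" if "agree (writes inspect_vertex) \<sigma>1 \<tau>" for \<tau>
    by (simp_all add: agreeD[OF that] inspect_vertex_def inspect_arc_def) (simp_all add: \<sigma>1_def defs)
  show ?thesis
    unfolding inspect_def defs(1)[symmetric]
  proof (rule exec_Seq_det[where l = 6 and \<tau> = \<sigma>1], simp add: \<sigma>1_def,
      rule exec_While[where I = Inv and \<phi> = "60 * card (parcs G) + 40 * n"], goal_cases)
    case 1
    have "inspected w S \<sigma>1 {}" by (simp add: inspected_def \<sigma>1_def)
    moreover have "60 * card (parcs G) + 40 * n = (\<Sum>a\<in>{0..<n}. 60 * degree G a + 40)"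
      unfolding card_parcs inp(1) by (simp add: sum.distrib sum_distrib_left atLeast0LessThan)
    ultimately show ?case unfolding Inv_def by (simp add: \<sigma>1_def)
  next
    case (2 \<tau> \<phi>)
    note same = same[OF 2(3)]
    define u P where "u = nvar \<tau> ''u''" and "P = {e \<in> parcs G. fst e < u}"
    have u: "u < n" using 2(2) by (simp add: same u_def)
    have P: "inspected w S \<tau> P" and \<phi>: "\<phi> = (\<Sum>a\<in>{u..<n}. 60 * degree G a + 40)"
      using 2(1) unfolding Inv_def P_def u_def by auto
    have "{u..<n} = insert u {Suc u..<n}" using u by auto
    then have \<phi>': "\<phi> = 60 * degree G u + 40 + (\<Sum>a\<in>{Suc u..<n}. 60 * degree G a + 40)"
      unfolding \<phi> by simp
    define \<tau>1 where "\<tau>1 = \<tau>\<lparr>nvar := (nvar \<tau>)(''i'' := off u, ''e'' := off (Suc u))\<rparr>"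
    define J where "J \<rho> \<psi> \<longleftrightarrow> off u \<le> nvar \<rho> ''i'' \<and> nvar \<rho> ''i'' \<le> off (Suc u) \<and>
      inspected w S \<rho> (P \<union> {u} \<times> adj ` {off u..<nvar \<rho> ''i''}) \<and>
      \<psi> = 60 * (off (Suc u) - nvar \<rho> ''i'')" for \<rho> \<psi>
    have loop: "exec (While (NLess (NVar ''i'') (NVar ''e'')) inspect_arc) \<tau>1 (\<lambda>k \<rho>.
      k \<le> 60 * degree G u + 4 \<and> nvar \<rho> ''u'' = u \<and> inspected w S \<rho> {e \<in> parcs G. fst e < Suc u})"
    proof (rule exec_While[where I = J and \<phi> = "60 * degree G u"], goal_cases)
      case 1
      have "inspected w S \<tau>1 P" using P by (subst inspected_cong[where \<sigma> = \<tau>]) (simp_all add: \<tau>1_def)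
      then show ?case using inp(2,5)[OF u] unfolding J_def by (simp add: \<tau>1_def)
    next
      case (2 \<rho> \<psi>)
      have same': "narr \<rho> ''adj'' = adj" "nvar \<rho> ''u'' = u" "narr \<rho> ''inS'' = narr \<sigma> ''inS''"
        "rarr \<rho> ''wt'' = rarr \<sigma> ''wt''" "nvar \<rho> ''e'' = off (Suc u)"
        by (simp_all add: agreeD[OF 2(3)] inspect_arc_def) (simp_all add: \<tau>1_def same u_def)
      define i where "i = nvar \<rho> ''i''"
      have i: "off u \<le> i" "i < off (Suc u)" and ins: "inspected w S \<rho> (P \<union> {u} \<times> adj ` {off u..<i})"
        and \<psi>: "\<psi> = 60 * (off (Suc u) - i)"
        using 2(1,2) unfolding J_def i_def by (simp_all add: same')
      define v where "v = adj i"
      have arc: "(u, v) \<in> parcs G" and wt: "rarr \<sigma> ''wt'' i = ereal (w (u, v))"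
        using inp(4)[OF u, of i] i unfolding v_def by auto
      have v: "v < n" using in_arcsD2[OF arc] inp(1) by simp
      have set: "insert (u, v) (P \<union> {u} \<times> adj ` {off u..<i}) = P \<union> {u} \<times> adj ` {off u..<Suc i}"
        using i unfolding v_def by (auto simp: less_Suc_eq)
      show ?case
      proof (rule exec_mono[OF exec_inspect_arc], goal_cases)
        case (1 k \<rho>')
        have "inspected w S \<rho>' (insert (u, v) (P \<union> {u} \<times> adj ` {off u..<i}))"
          by (rule inspected_insert[OF ins _ refl])
            (use 1 in \<open>simp_all add: Let_def same' i_def[symmetric] v_def[symmetric] wt inp(6)[OF u] inp(6)[OF v] one_ereal_def\<close>)
        then show ?case
          using 1 i unfolding J_def set \<psi> by (auto simp: i_def[symmetric])
      qed
    next
      case (3 k \<rho> \<psi>)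
      have same': "nvar \<rho> ''u'' = u" "nvar \<rho> ''e'' = off (Suc u)"
        by (simp_all add: agreeD[OF 3(3)] inspect_arc_def) (simp_all add: \<tau>1_def u_def)
      have "nvar \<rho> ''i'' = off (Suc u)" using 3(1,2) unfolding J_def by (simp add: same')
      moreover have "P \<union> {u} \<times> {v. (u, v) \<in> parcs G} = {e \<in> parcs G. fst e < Suc u}"
        unfolding P_def by (auto simp: less_Suc_eq)
      ultimately show ?case using 3(1,4) inp(3)[OF u] unfolding J_def by (simp add: same')
    qed
    show ?case
      unfolding inspect_vertex_def
    proof (rule exec_Seq_det[where l = 7 and \<tau> = \<tau>1], simp add: \<tau>1_def same u_def, rule exec_SeqI[OF loop], goal_cases)
      case (1 k \<rho>)
      define \<rho>' where "\<rho>' = \<rho>\<lparr>nvar := (nvar \<rho>)(''u'' := Suc u)\<rparr>"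
      have "inspected w S \<rho>' {e \<in> parcs G. fst e < Suc u}"
        using 1(1) by (subst inspected_cong[where \<sigma> = \<rho>]) (simp_all add: \<rho>'_def)
      then have "Inv \<rho>' (\<Sum>a\<in>{Suc u..<n}. 60 * degree G a + 40)"
        using u unfolding Inv_def by (simp add: \<rho>'_def)
      then show ?case
        using 1(1) \<phi>' by (auto simp: \<rho>'_def intro!: exI[of _ "\<Sum>a\<in>{Suc u..<n}. 60 * degree G a + 40"])
    qed
  next
    case (3 k \<tau> \<phi>)
    have "nvar \<tau> ''u'' = n" using 3(1,2) unfolding Inv_def by (simp add: same(1)[OF 3(3)])
    moreover have "{e \<in> parcs G. fst e < n} = parcs G" using in_arcsD1 inp(1) by auto
    ultimately show ?case using 3(1,4) unfolding Inv_def by simp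
  qed
qed

end

context weighted_graph
begin

lemma queue_search:
  assumes input: "holds_input \<sigma> G w S" and unit: "\<forall>e\<in>parcs G. w e = 1"
    and s: "nvar \<sigma> ''s'' \<in> pverts G" and labels: "\<forall>v<nvar \<sigma> ''n''. rarr \<sigma> ''d'' v = \<infinity>"
  shows "exec queue_search \<sigma> (\<lambda>k \<sigma>'. k \<le> 70 * card (parcs G) + 70 * nvar \<sigma> ''n'' + 100 \<and>
    (\<forall>v\<in>pverts G. rarr \<sigma>' ''d'' v = dist_in G w (nvar \<sigma> ''s'') v))"
proof -
  define s n where "s = nvar \<sigma> ''s''" and "n = nvar \<sigma> ''n''"
  define \<sigma>1 where "\<sigma>1 = \<sigma>\<lparr>rarr := (rarr \<sigma>)(''d'' := (rarr \<sigma> ''d'')(s := 0)), narr := (narr \<sigma>)(''qu'' := (narr \<sigma> ''qu'')(0 := s)),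
    nvar := (nvar \<sigma>)(''head'' := 0, ''tail'' := 1), rvar := (rvar \<sigma>)(''du'' := 0)\<rparr>"
  have "agree {RA ''d'', NA ''qu'', NV ''head'', NV ''tail'', RV ''du''} \<sigma> \<sigma>1"
    by (simp add: agree_def \<sigma>1_def)
  from holds_input_agree[OF this] input have input1: "holds_input \<sigma>1 G w S" by simp
  interpret graph_search G w queue_push queue_extract queue_inv "\<lambda>c. c = 1" 20 20 \<sigma>1 S
    using input1 unit
    by (intro graph_search.intro weighted_graph_axioms queue_vertex_queue graph_search_axioms.intro)
      (auto simp: one_ereal_def)
  note V = holds_inputD(1)[OF input, folded n_def]
  have d: "rarr \<sigma>1 ''d'' v = (if v = s then 0 else \<infinity>)" if "v \<in> pverts G" for v
    using labels that V unfolding n_def by (simp add: \<sigma>1_def)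
  have dij: "dijkstra s {s} (rarr \<sigma>1 ''d'')" using s d unfolding s_def by (rule dijkstra_init)
  have unf: "unfinished {s} (rarr \<sigma>1 ''d'') = pverts G" unfolding unfinished_def using d by (auto split: if_splits)
  \<comment> \<open>With \<open>du = 0\<close> the label 0 of the source lies in the required
    interval from \<open>du\<close> to \<open>du + 1\<close>.\<close>
  have q: "queue_inv \<sigma>1 {s} (card (parcs G)) 0" unfolding queue_inv_def by (simp add: \<sigma>1_def)
  have todo: "todo (pverts G) = 70 * card (parcs G) + 70 * n"
    unfolding todo_def card_parcs V by (simp add: sum.distrib sum_distrib_left \<sigma>1_def n_def)
  show ?thesis
    unfolding queue_search_def s_def[symmetric] n_def[symmetric]
  proof (rule exec_Seq_det[where l = 12 and \<tau> = \<sigma>1], goal_cases)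
    case 1
    show ?case by (simp add: \<sigma>1_def s_def)
  next
    case 2
    have "static \<sigma>1" unfolding static_def by simp
    from search[OF this dij q] show ?case
      by (auto simp: unf card_parcs todo elim!: exec_mono)
  qed
qed

lemma heap_search:
  assumes input: "holds_input \<sigma> G w S" and L: "card (parcs G) + 1 < 2 ^ L"
    and s: "nvar \<sigma> ''s'' \<in> pverts G"
    and labels: "\<forall>v<nvar \<sigma> ''n''. rarr \<sigma> ''d'' v = \<infinity> \<and> narr \<sigma> ''node'' v = 0"
  shows "exec heap_search \<sigma> (\<lambda>k \<sigma>'.
    k \<le> 1610 * card (parcs G) + (1600 * L + 150) * nvar \<sigma> ''n'' + 1600 * L + 2000 \<and>
    (\<forall>v\<in>pverts G. rarr \<sigma>' ''d'' v = dist_in G w (nvar \<sigma> ''s'') v))"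
proof -
  define s n m where "s = nvar \<sigma> ''s''" and "n = nvar \<sigma> ''n''" and "m = card (parcs G)"
  define \<sigma>1 where "\<sigma>1 = \<sigma>\<lparr>narr := (narr \<sigma>)(''rank'' := (narr \<sigma> ''rank'')(0 := 0)),
    nvar := (nvar \<sigma>)(''roots'' := 0, ''lim'' := 0, ''cnt'' := 0, ''v'' := s), rvar := (rvar \<sigma>)(''x'' := 0)\<rparr>"
  note V = holds_inputD(1)[OF input, folded n_def]
  have "hheap n 0 {} {} (\<lambda>_. []) (narr \<sigma>1 ''rank'') (narr \<sigma>1 ''item'') (rarr \<sigma>1 ''key'') (narr \<sigma>1 ''node'') (rarr \<sigma>1 ''d'')"
    using labels by (intro hheapI) (auto simp: \<sigma>1_def n_def)
  \<comment> \<open>The total allowance \<open>m + 1\<close> is one insertion for the source and one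
    per arc; it bounds the number of nodes and hence, through L, the ranks.\<close>
  then have q0: "heap_inv (m + 1) \<sigma>1 {} (Suc m) 0"
    unfolding heap_inv_def using labels
    by (intro exI[of _ "{}"] exI[of _ "\<lambda>_. []"] exI[of _ "[]"])
      (auto simp: heap_mem_def tab_mem_def lim_bounded_def weight_def hollow_weight_def \<sigma>1_def n_def)
  have push: "exec heap_push \<sigma>1 (\<lambda>k \<tau>. \<exists>\<phi>. k + \<phi> \<le> 1560 \<and> rarr \<tau> ''d'' = (rarr \<sigma> ''d'')(s := 0) \<and>
      heap_inv (m + 1) \<tau> {s} m \<phi>)"
    using heap_push[OF q0] s V labels by (simp add: \<sigma>1_def s_def n_def)
  show ?thesis
    unfolding heap_search_def s_def[symmetric] n_def[symmetric] m_def[symmetric]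
  proof (rule exec_Seq_det[where l = 13 and \<tau> = \<sigma>1], goal_cases)
    case 1
    show ?case by (simp add: \<sigma>1_def s_def)
  next
    case 2
    show ?case
    proof (rule exec_SeqI[OF push], elim exE conjE)
      fix k \<tau> \<phi>
      assume k: "k + \<phi> \<le> 1560" and d_eq: "rarr \<tau> ''d'' = (rarr \<sigma> ''d'')(s := 0)"
        and q: "heap_inv (m + 1) \<tau> {s} m \<phi>" and ag: "agree (writes heap_push) \<sigma>1 \<tau>"
      have "agree {NA ''rank'', NV ''roots'', NV ''lim'', NV ''cnt'', NV ''v'', RV ''x''} \<sigma> \<sigma>1"
        by (simp add: agree_def \<sigma>1_def)
      from holds_input_agree[OF this] holds_input_agree[OF ag] input
      have input1: "holds_input \<tau> G w S" by (simp add: heap_push_def)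
      interpret graph_search G w heap_push heap_extract "heap_inv (m + 1)" "\<lambda>_. True" 1560 "1600 * L + 100" \<tau> S
        using input1 L unfolding m_def
        by (intro graph_search.intro weighted_graph_axioms heap_vertex_queue graph_search_axioms.intro) auto
      have d: "rarr \<tau> ''d'' v = (if v = s then 0 else \<infinity>)" if "v \<in> pverts G" for v
        using labels that V unfolding n_def d_eq by simp
      have dij: "dijkstra s {s} (rarr \<tau> ''d'')" using s d unfolding s_def by (rule dijkstra_init)
      have unf: "unfinished {s} (rarr \<tau> ''d'') = pverts G" unfolding unfinished_def using d by (auto split: if_splits)
      \<comment> \<open>Per arc \<open>A + 50 = 1560 + 50\<close>, per vertex
        \<open>E + 50 = 1600 * L + 100 + 50\<close>.\<close>
      have todo: "todo (pverts G) = 1610 * m + (1600 * L + 150) * n"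
        unfolding todo_def m_def card_parcs V by (simp add: sum.distrib sum_distrib_left)
      have "static \<tau>" unfolding static_def by simp
      moreover have "(\<Sum>v\<in>unfinished {s} (rarr \<tau> ''d''). degree G v) \<le> m"
        unfolding unf m_def card_parcs ..
      ultimately show "exec (search heap_push heap_extract) \<tau> (\<lambda>l \<sigma>'.
        13 + (k + l) \<le> 1610 * m + (1600 * L + 150) * n + 1600 * L + 2000 \<and>
        (\<forall>v\<in>pverts G. rarr \<sigma>' ''d'' v = dist_in G w s v))"
        using k by (intro exec_mono[OF search[OF _ dij q]]) (auto simp: unf todo)
    qed
  qed
qed

lemma radius_estimate:
  assumes input: "holds_input \<sigma> G w S" and L: "card (parcs G) + 1 < 2 ^ L"
    and S: "S \<subseteq> pverts G" and T: "T = pverts G - S" "T \<noteq> {}"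
  shows "exec radius_estimate \<sigma> (\<lambda>k \<sigma>'.
    k \<le> 2000 * card (parcs G) + (1600 * L + 500) * nvar \<sigma> ''n'' + 1600 * L + 3000 \<and>
    ((\<forall>e\<in>parcs G. w e = 1) \<longrightarrow> k \<le> 2000 * card (parcs G) + 500 * nvar \<sigma> ''n'' + 3000) \<and>
    (if parcs G \<inter> S \<times> T = {} then result \<sigma>' = \<infinity>
     else \<exists>s t. (s, t) \<in> parcs G \<inter> S \<times> T \<and> (\<forall>e\<in>parcs G \<inter> S \<times> T. w (s, t) \<le> w e) \<and>
       result \<sigma>' = ST_ecc G w T s))"
proof -
  \<comment> \<open>Arcs end in vertices, so the complement of \<open>S\<close> that the membership
    bits describe may replace \<open>T\<close>.\<close>
  have ST: "parcs G \<inter> S \<times> - S = parcs G \<inter> S \<times> T" using T(1) in_arcsD2 by auto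
  define n m where "n = nvar \<sigma> ''n''" and "m = card (parcs G)"
  note V = holds_inputD(1)[OF input, folded n_def]
  show ?thesis
    unfolding radius_estimate_def m_def[symmetric] n_def[symmetric]
  proof (rule exec_SeqI[OF inspect[OF input]], elim conjE, fold m_def n_def, goal_cases)
    case (1 k1 \<sigma>1)
    have input1: "holds_input \<sigma>1 G w S"
      using input holds_input_agree[OF 1(1)] by (simp add: inspect_def inspect_vertex_def inspect_arc_def)
    have n1: "nvar \<sigma>1 ''n'' = n"
      unfolding n_def by (simp add: agreeD[OF 1(1)] inspect_def inspect_vertex_def inspect_arc_def)
    have unit1: "nvar \<sigma>1 ''unit'' = (if \<forall>e\<in>parcs G. w e = 1 then 1 else 0)"
      using 1(3) unfolding inspected_def by blast
    show ?case
    proof (cases "parcs G \<inter> S \<times> T = {}")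
      case True
      then have "rvar \<sigma>1 ''best'' = \<infinity>" using 1(3) unfolding inspected_def ST by simp
      then show ?thesis using True 1(2) by (simp add: result_def algebra_simps)
    next
      case False
      define s where "s = nvar \<sigma>1 ''s''"
      obtain t where st: "(s, t) \<in> parcs G \<inter> S \<times> T" "rvar \<sigma>1 ''best'' = w (s, t)"
        "\<And>e. e \<in> parcs G \<inter> S \<times> T \<Longrightarrow> rvar \<sigma>1 ''best'' \<le> w e"
        using conjunct2[OF 1(3)[unfolded inspected_def ST], unfolded if_not_P[OF False]] unfolding s_def by blast
      have sV: "s \<in> pverts G" using st(1) S by auto
      let ?choose = "Cond (NLess (NConst 0) (NVar ''unit'')) queue_search heap_search"
      have main: "exec (Seq init_labels (Seq ?choose eccentricity)) \<sigma>1 (\<lambda>l \<sigma>'.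
        l \<le> 1610 * m + (1600 * L + 250) * n + 1600 * L + 2100 \<and>
        ((\<forall>e\<in>parcs G. w e = 1) \<longrightarrow> l \<le> 70 * m + 200 * n + 200) \<and> result \<sigma>' = ST_ecc G w T s)"
        (is "exec _ _ ?main")
      proof (rule exec_SeqI[OF init_labels], elim conjE, unfold n1)
        fix k2 \<sigma>2
        assume k2: "k2 \<le> 20 * n + 10" and labels: "\<forall>v<n. rarr \<sigma>2 ''d'' v = \<infinity> \<and> narr \<sigma>2 ''node'' v = 0"
          and ag: "agree (writes init_labels) \<sigma>1 \<sigma>2"
        have input2: "holds_input \<sigma>2 G w S"
          using input1 holds_input_agree[OF ag] by (simp add: init_labels_def)
        have same: "nvar \<sigma>2 ''n'' = n" "nvar \<sigma>2 ''s'' = s" "nvar \<sigma>2 ''unit'' = nvar \<sigma>1 ''unit''"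
          using n1 unfolding s_def by (simp_all add: agreeD[OF ag] init_labels_def)
        have "exec ?choose \<sigma>2 (\<lambda>k \<tau>. (\<forall>v\<in>pverts G. rarr \<tau> ''d'' v = dist_in G w s v) \<and>
          k \<le> 1610 * m + (1600 * L + 150) * n + 1600 * L + 2010 \<and>
          ((\<forall>e\<in>parcs G. w e = 1) \<longrightarrow> k \<le> 70 * m + 70 * n + 110))"
        proof (cases "\<forall>e\<in>parcs G. w e = 1")
          case True
          have "exec queue_search \<sigma>2 (\<lambda>k \<tau>. k \<le> 70 * m + 70 * n + 100 \<and>
            (\<forall>v\<in>pverts G. rarr \<tau> ''d'' v = dist_in G w s v))"
            using queue_search[OF input2 True] sV labels by (simp add: same m_def)
          then show ?thesis using True by (auto simp: same unit1 algebra_simps elim!: exec_mono)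
        next
          case False
          have "exec heap_search \<sigma>2 (\<lambda>k \<tau>. k \<le> 1610 * m + (1600 * L + 150) * n + 1600 * L + 2000 \<and>
            (\<forall>v\<in>pverts G. rarr \<tau> ''d'' v = dist_in G w s v))"
            using heap_search[OF input2 L] sV labels by (simp add: same m_def)
          moreover have "nvar \<sigma>2 ''unit'' = 0" using False by (simp add: same unit1)
          ultimately show ?thesis using False by (auto simp: algebra_simps elim!: exec_mono)
        qed
        then show "exec (Seq ?choose eccentricity) \<sigma>2 (\<lambda>l. ?main (k2 + l))"
        proof (rule exec_SeqI, elim conjE)
          fix k3 \<sigma>3
          assume d: "\<forall>v\<in>pverts G. rarr \<sigma>3 ''d'' v = dist_in G w s v"
            and k3: "k3 \<le> 1610 * m + (1600 * L + 150) * n + 1600 * L + 2010"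
              "(\<forall>e\<in>parcs G. w e = 1) \<longrightarrow> k3 \<le> 70 * m + 70 * n + 110"
            and ag: "agree (writes ?choose) \<sigma>2 \<sigma>3"
          have L3: "NV ''n'' \<notin> writes ?choose" "NA ''inS'' \<notin> writes ?choose"
            by (simp_all add: queue_search_def heap_search_def search_def scan_def queue_push_def queue_extract_def
                heap_push_def heap_extract_def heap_consolidate_def heap_collect_def heap_place_def heap_link_def
                heap_destroy_def)
          have n3: "nvar \<sigma>3 ''n'' = n" and inS: "narr \<sigma>3 ''inS'' = narr \<sigma>2 ''inS''"
            using agreeD[OF ag] L3 same(1) by simp_all
          have "exec eccentricity \<sigma>3 (\<lambda>k \<sigma>'. k \<le> 40 * n + 10 \<and> result \<sigma>' = Max (rarr \<sigma>3 ''d'' ` T))"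
            unfolding n3[symmetric]
          proof (rule eccentricity)
            show "narr \<sigma>3 ''inS'' v = (if v \<in> S then 1 else 0)" if "v < nvar \<sigma>3 ''n''" for v
              using holds_inputD(6)[OF input2] that unfolding n3 inS same .
            show "T = {..<nvar \<sigma>3 ''n''} - S" unfolding n3 T V ..
            show "0 \<le> rarr \<sigma>3 ''d'' v" if "v \<in> T" for v using d that T dist_nonneg by simp
          qed (rule T)
          moreover have "rarr \<sigma>3 ''d'' ` T = dist_in G w s ` T" using d T by (intro image_cong) auto
          ultimately show "exec eccentricity \<sigma>3 (\<lambda>l. ?main (k2 + (k3 + l)))"
            using k2 k3 unfolding ST_ecc_def by (auto simp: algebra_simps elim!: exec_mono)
        qed
      qed
      have best: "bval (RLess (RVar ''best'') Infty) \<sigma>1" using st(2) by simp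
      have min: "\<forall>e\<in>parcs G \<inter> S \<times> T. w (s, t) \<le> w e" using st(2,3) by auto
      show ?thesis
        unfolding exec_Cond_iff if_P[OF best] if_not_P[OF False]
      proof (rule exec_mono[OF main], elim conjE, intro conjI impI, goal_cases)
        case (3 l \<tau>)
        then show ?case using st(1) min by blast
      qed (use 1(2) in \<open>auto simp: algebra_simps\<close>)
    qed
  qed
qed

end

section \<open>From explicit step counts to the asymptotic bounds\<close>

theorem theorem12:
  shows "\<exists>(P :: com) (C :: real).
    \<forall>(G :: nat pair_pre_digraph) (w :: nat \<times> nat \<Rightarrow> real) (S :: nat set) (T :: nat set)
      (n :: nat) (m :: nat) (\<sigma> :: state).
      pair_graph G \<and> n = card (pverts G) \<and> m = num_edges G \<and>
      (\<forall>(u, v)\<in>parcs G. 0 \<le> w (u, v) \<and> w (u, v) = w (v, u)) \<and>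
      S \<subseteq> pverts G \<and> T = pverts G - S \<and> S \<noteq> {} \<and> T \<noteq> {} \<and>
      holds_input \<sigma> G w S
      \<longrightarrow>
      (\<exists>(k :: nat) (\<sigma>' :: state). run P \<sigma> k \<sigma>' \<and>
        real k \<le> C * (real m + real n * log 2 (real n)) \<and>
        ST_radius G w S T \<le> result \<sigma>' \<and>
        result \<sigma>' \<le> 2 * ST_radius G w S T + (INF e \<in> parcs G \<inter> S \<times> T. ereal (w e)) \<and>
        ((\<forall>e\<in>parcs G. w e = 1) \<longrightarrow>
          real k \<le> C * (real m + real n) \<and>
          result \<sigma>' \<le> 2 * ST_radius G w S T + 1))"
proof (rule exI[of _ radius_estimate], rule exI[of _ 20000], intro allI impI, elim conjE)
  fix G :: "nat pair_pre_digraph" and w S T n m \<sigma>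
  assume "pair_graph G" and n: "n = card (pverts G)" and m: "m = num_edges G"
    and w: "\<forall>(u, v)\<in>parcs G. 0 \<le> w (u, v) \<and> w (u, v) = w (v, u)"
    and S: "S \<subseteq> pverts G" "S \<noteq> {}" and T: "T = pverts G - S" "T \<noteq> {}" and input: "holds_input \<sigma> G w S"
  interpret pair_graph G by fact
  interpret weighted_graph G w by unfold_locales (use w in auto)
  obtain s t where st: "s \<in> S" "t \<in> T" using S T by blast
  then have "card {s, t} \<le> n" unfolding n using S T pair_finite_verts by (intro card_mono) auto
  \<comment> \<open>Both sides being nonempty forces two vertices, so \<open>log 2 n\<close> is at
    least 1 and additive constants are absorbed by \<open>n * log 2 n\<close>.\<close>
  then have n2: "2 \<le> n" using st T by (auto simp: card_insert_if split: if_splits)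
  have nvar: "nvar \<sigma> ''n'' = n" using holds_inputD(1)[OF input] n by simp
  \<comment> \<open>The factor 2 gives \<open>2 ^ L \<ge> n ^ 2\<close>, which exceeds the number of
    heap nodes; rounding up costs at most one, hence \<open>L \<le> 3 * l\<close> below.\<close>
  define l L where "l = log 2 (real n)" and "L = nat \<lceil>2 * l\<rceil>"
  have l1: "1 \<le> l" using n2 unfolding l_def by (simp add: le_log_iff)
  have L_le: "real L \<le> 3 * l" using l1 unfolding L_def by linarith
  have "real n ^ 2 = 2 powr (2 * l)"
    using n2 unfolding l_def mult_2 powr_add by (simp add: power2_eq_square)
  also have "\<dots> \<le> 2 powr real L" unfolding L_def by (intro powr_mono) linarith+
  also have "\<dots> = 2 ^ L" by (simp add: powr_realpow)
  finally have "n ^ 2 \<le> 2 ^ L" by (metis of_nat_le_iff of_nat_numeral of_nat_power)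
  then have L: "card (parcs G) + 1 < 2 ^ L" using card_parcs_less n2 n by simp
  obtain k \<sigma>' where run: "run radius_estimate \<sigma> k \<sigma>'"
    and k: "k \<le> 2000 * card (parcs G) + (1600 * L + 500) * n + 1600 * L + 3000"
      "(\<forall>e\<in>parcs G. w e = 1) \<longrightarrow> k \<le> 2000 * card (parcs G) + 500 * n + 3000"
    and res: "if parcs G \<inter> S \<times> T = {} then result \<sigma>' = \<infinity>
     else \<exists>s t. (s, t) \<in> parcs G \<inter> S \<times> T \<and> (\<forall>e\<in>parcs G \<inter> S \<times> T. w (s, t) \<le> w e) \<and>
       result \<sigma>' = ST_ecc G w T s"
    using radius_estimate[OF input L S(1) T] unfolding exec_def nvar by blast
  have arcs: "card (parcs G) \<le> 2 * m" using card_parcs_le[OF pair_finite_arcs] m by simp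
  show "\<exists>(k :: nat) (\<sigma>' :: state). run radius_estimate \<sigma> k \<sigma>' \<and>
        real k \<le> 20000 * (real m + real n * log 2 (real n)) \<and>
        ST_radius G w S T \<le> result \<sigma>' \<and>
        result \<sigma>' \<le> 2 * ST_radius G w S T + (INF e \<in> parcs G \<inter> S \<times> T. ereal (w e)) \<and>
        ((\<forall>e\<in>parcs G. w e = 1) \<longrightarrow>
          real k \<le> 20000 * (real m + real n) \<and>
          result \<sigma>' \<le> 2 * ST_radius G w S T + 1)"
  proof (intro exI[of _ k] exI[of _ \<sigma>'] conjI impI)
    show "run radius_estimate \<sigma> k \<sigma>'" by (rule run)
    have nl: "2 \<le> real n * l" "l \<le> real n * l" "real n \<le> real n * l"
      using n2 l1 mult_mono[of 2 "real n" 1 l] by auto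
    have Ln: "real L * real n \<le> 3 * (real n * l)"
      using mult_right_mono[OF L_le, of "real n"] by (simp add: ac_simps)
    have "real k \<le> real (2000 * (2 * m) + (1600 * L + 500) * n + 1600 * L + 3000)"
      using k(1) arcs by (subst of_nat_le_iff) linarith
    also have "\<dots> = 4000 * real m + 1600 * (real L * real n) + 500 * real n + 1600 * real L + 3000"
      by (simp add: algebra_simps)
    \<comment> \<open>Here \<open>L \<le> 3 * l\<close> turns 1600 into 4800, and
      \<open>2 \<le> n * l\<close> turns the constant 3000 into 1500 times \<open>n * l\<close>. The
      coefficients of \<open>n * l\<close> sum to 11600, so 20000 is a round upper bound.\<close>
    also have "\<dots> \<le> 4000 * real m + 4800 * (real n * l) + 500 * (real n * l) + 4800 * (real n * l) + 1500 * (real n * l)"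
      using nl Ln L_le by linarith
    also have "\<dots> \<le> 20000 * (real m + real n * l)" unfolding distrib_left using nl by linarith
    finally show "real k \<le> 20000 * (real m + real n * log 2 (real n))" unfolding l_def .
    show "real k \<le> 20000 * (real m + real n)" if "\<forall>e\<in>parcs G. w e = 1"
      using k(2) that arcs n2 by simp
    show "ST_radius G w S T \<le> result \<sigma>'"
      using res radius_le[OF S T] by (auto split: if_splits)
    show "result \<sigma>' \<le> 2 * ST_radius G w S T + (INF e \<in> parcs G \<inter> S \<times> T. ereal (w e))"
    proof (cases "parcs G \<inter> S \<times> T = {}")
      case True
      \<comment> \<open>Without crossing arcs the infimum is taken over the empty set and equals
        \<infinity>, so the bound holds at once.\<close>
      then show ?thesis by (simp add: top_ereal_def)
    next
      case False
      then obtain s t where st: "(s, t) \<in> parcs G \<inter> S \<times> T" "\<forall>e\<in>parcs G \<inter> S \<times> T. w (s, t) \<le> w e"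
        "result \<sigma>' = ST_ecc G w T s" using res by auto
      have "ereal (w (s, t)) \<le> (INF e \<in> parcs G \<inter> S \<times> T. ereal (w e))"
        using st(2) by (intro INF_greatest) simp
      with ecc_le[OF S T, of s t] st(1) show ?thesis
        unfolding st(3) by (auto intro: order_trans add_left_mono)
    qed
    show "result \<sigma>' \<le> 2 * ST_radius G w S T + 1" if unit: "\<forall>e\<in>parcs G. w e = 1"
    proof (cases "parcs G \<inter> S \<times> T = {}")
      case True
      \<comment> \<open>Here the right-hand side contains no infimum, so the radius itself must be
        shown to be infinite.\<close>
      then show ?thesis using radius_infinite[OF S T] by simp
    next
      case False
      then obtain s t where st: "(s, t) \<in> parcs G \<inter> S \<times> T" "result \<sigma>' = ST_ecc G w T s"
        using res by auto
      with ecc_le[OF S T, of s t] unit show ?thesis by (auto simp: one_ereal_def)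
    qed
  qed
qed

end
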